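(* The class of separable reflexive Banach spaces with an unconditional basis is strongly bounded: for every analytic set $A\subseteq\mathrm{SB}$ consisting of reflexive spaces with an unconditional basis, there exists a reflexive Banach space $Y$ with an unconditional basis containing isomorphic copies of every $X\in A$.
   Context: Let $C(2^{\mathbb{N}})$ be the Banach space of continuous real functions on the Cantor set with the sup norm. $\mathrm{SB}$ denotes the set of closed linear subspaces of $C(2^{\mathbb{N}})$ with the Effros–Borel $\sigma$-algebra (generated by the sets $\{X: X\cap U\neq\varnothing\}$, $U\subseteq C(2^{\mathbb{N}})$ open), a standard Borel space; a subset of $\mathrm{SB}$ is analytic if it is analytic in this standard Borel space. A class $\mathcal{C}\subseteq\mathrm{SB}$ is called strongly bounded if for every analytic subset $A\subseteq\mathcal{C}$ there exists $Y\in\mathcal{C}$ that contains isomorphic copies of every $X\in A$. *)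

theory Defs
  imports "HOL-Analysis.Analysis"
begin

text \<open>The Cantor set 2^N is modelled as the type nat \<Rightarrow> bool with the product topology
(bool carries the discrete order topology). C(2^N) is the Banach space of bounded
continuous real functions on it with the sup norm (all continuous functions on the
compact Cantor set are bounded).\<close>

type_synonym C2N = "(nat \<Rightarrow> bool) \<Rightarrow>\<^sub>C real"

definition SB :: "C2N set set" where
  "SB = {X. subspace X \<and> closed X}"

definition Effros :: "C2N set measure" where
  "Effros = sigma SB {{X \<in> SB. X \<inter> U \<noteq> {}} | U. open U}"

definition analytic_SB :: "C2N set set \<Rightarrow> bool" where
  "analytic_SB A \<longleftrightarrow> A \<subseteq> SB \<and>
     (A = {} \<or> (\<exists>f \<in> (borel :: (nat \<Rightarrow> nat) measure) \<rightarrow>\<^sub>M Effros. A = range f))"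

definition dual :: "C2N set \<Rightarrow> (C2N \<Rightarrow> real) set" where
  "dual X = {\<phi>. (\<forall>x\<in>X. \<forall>y\<in>X. \<phi> (x + y) = \<phi> x + \<phi> y)
              \<and> (\<forall>x\<in>X. \<forall>r. \<phi> (r *\<^sub>R x) = r * \<phi> x)
              \<and> (\<exists>K. \<forall>x\<in>X. \<bar>\<phi> x\<bar> \<le> K * norm x)
              \<and> (\<forall>x. x \<notin> X \<longrightarrow> \<phi> x = 0)}"

definition dual_norm :: "C2N set \<Rightarrow> (C2N \<Rightarrow> real) \<Rightarrow> real" where
  "dual_norm X \<phi> = (SUP x\<in>{x \<in> X. norm x \<le> 1}. \<bar>\<phi> x\<bar>)"

definition reflexive_space :: "C2N set \<Rightarrow> bool" where
  "reflexive_space X \<longleftrightarrow>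
     (\<forall>\<Phi> :: (C2N \<Rightarrow> real) \<Rightarrow> real.
        ((\<forall>\<phi>\<in>dual X. \<forall>\<psi>\<in>dual X. \<Phi> (\<lambda>z. \<phi> z + \<psi> z) = \<Phi> \<phi> + \<Phi> \<psi>)
         \<and> (\<forall>\<phi>\<in>dual X. \<forall>r. \<Phi> (\<lambda>z. r * \<phi> z) = r * \<Phi> \<phi>)
         \<and> (\<exists>K. \<forall>\<phi>\<in>dual X. \<bar>\<Phi> \<phi>\<bar> \<le> K * dual_norm X \<phi>))
        \<longrightarrow> (\<exists>x\<in>X. \<forall>\<phi>\<in>dual X. \<Phi> \<phi> = \<phi> x))"

definition schauder_basis :: "C2N set \<Rightarrow> (nat \<Rightarrow> C2N) \<Rightarrow> bool" where
  "schauder_basis X e \<longleftrightarrow> (\<forall>n. e n \<in> X) \<and>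
     (\<forall>x\<in>X. \<exists>!a :: nat \<Rightarrow> real. (\<lambda>n. a n *\<^sub>R e n) sums x)"

definition unconditional_basis :: "C2N set \<Rightarrow> (nat \<Rightarrow> C2N) \<Rightarrow> bool" where
  "unconditional_basis X e \<longleftrightarrow> schauder_basis X e \<and>
     (\<forall>x\<in>X. \<forall>a :: nat \<Rightarrow> real. (\<lambda>n. a n *\<^sub>R e n) sums x \<longrightarrow>
        ((\<lambda>n. a n *\<^sub>R e n) has_sum x) UNIV)"

definition embeds :: "C2N set \<Rightarrow> C2N set \<Rightarrow> bool" where
  "embeds X Y \<longleftrightarrow> (\<exists>T :: C2N \<Rightarrow> C2N. \<exists>c Cn.
     (\<forall>x\<in>X. T x \<in> Y)
     \<and> (\<forall>x\<in>X. \<forall>y\<in>X. T (x + y) = T x + T y)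
     \<and> (\<forall>x\<in>X. \<forall>r. T (r *\<^sub>R x) = r *\<^sub>R T x)
     \<and> c > 0 \<and> (\<forall>x\<in>X. c * norm x \<le> norm (T x) \<and> norm (T x) \<le> Cn * norm x))"

end

theory Submission
  imports Defs "HOL-Library.Function_Algebras"
begin

text \<open>Perturb the bases of the members of the analytic family into a countable dense set. The perturbed
  bases, together with witnesses of membership in the family, become the branches of a tree on the
  natural numbers, and each branch carries an equivalent norm that does not depend on signs and is
  determined by the nodes. On the finitely supported functions on the tree let \<open>F\<close> be the supremum of
  the branch norms, and let \<open>E\<close> be the dual of the supremum of the dual branch norms. The functionals
  that are supported on a branch and have norm at most 1 there form a compact set on which disjoint
  bounded sequences tend to 0 pointwise, by reflexivity of the branches; hence such sequences have
  uniformly small convex combinations. It follows that \<open>F\<close> is shrinking and \<open>E\<close> is boundedly complete.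
  The Calderon product of \<open>E\<close> and \<open>F\<close>, whose ball consists of the \<open>y\<close> with \<open>y\<^sup>2 \<le> e f\<close> for some \<open>e\<close> and \<open>f\<close>
  in the two balls, inherits both properties, so its completion is reflexive and the nodes are an
  unconditional basis; on each branch it is the branch norm.\<close>

section \<open>The Hahn-Banach theorem\<close>

text \<open>Neither \<open>F\<close> nor \<open>E\<close> could serve alone. On an antichain of
  nodes the branch norms see one node at a time, so there \<open>F\<close> is a weighted c_0 and
  \<open>E\<close> a weighted l_1, neither of which is reflexive; their geometric mean is l_2. The
  product is shrinking because it is enough that the factor from \<open>F\<close> becomes small, and
  boundedly complete because it is enough that the factor from \<open>E\<close> does. On a branch
  both norms are the branch norm, and so is their mean. All this requires that every infinite set of
  pairwise comparable nodes spans a reflexive space. A branch through a tree of initial segments is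
  only a limit of codes, so the codes must form a closed set, whereas the natural set of codes is
  merely Borel. It is therefore written as a projection of a closed set, and the witnesses of the
  projection are carried along as further coordinates of the branches.\<close>

locale sublinear = vector_space scale
  for scale :: "real \<Rightarrow> 'b::ab_group_add \<Rightarrow> 'b" (infixr "*s" 75) +
  fixes V :: "'b set" and p :: "'b \<Rightarrow> real"
  assumes sub: "subspace V"
    and subadd: "x \<in> V \<Longrightarrow> y \<in> V \<Longrightarrow> p (x + y) \<le> p x + p y"
    and poshom: "x \<in> V \<Longrightarrow> 0 \<le> r \<Longrightarrow> p (r *s x) = r * p x"
begin

lemma p_zero: "p 0 = 0"
  using poshom[of 0 0] sub subspace_0 by simp

lemma neg_le: "x \<in> V \<Longrightarrow> - p (- x) \<le> p x"
  using subadd[of x "- x"] sub p_zero subspace_neg by fastforce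

text \<open>A sublinear minorant of \<open>p\<close> that is linear along \<open>y\<close>: at
  \<open>x = - y\<close> the choice \<open>t = 1\<close> gives a value of at most
  \<open>- p y\<close>.\<close>

definition shift :: "'b \<Rightarrow> 'b \<Rightarrow> real"
  where "shift y x = (INF t\<in>{0..}. p (x + t *s y) - t * p y)"

lemma shift_lower:
  assumes "x \<in> V" "y \<in> V" "0 \<le> t"
  shows "- p (- x) \<le> p (x + t *s y) - t * p y"
proof -
  have "p (t *s y) \<le> p (x + t *s y) + p (- x)"
    using subadd[of "x + t *s y" "- x"] assms sub
    by (simp add: subspace_add subspace_neg subspace_scale)
  then show ?thesis using poshom[of y t] assms by simp
qed

lemma shift_bdd: "x \<in> V \<Longrightarrow> y \<in> V \<Longrightarrow> bdd_below ((\<lambda>t. p (x + t *s y) - t * p y) ` {0..})"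
  using shift_lower by (intro bdd_belowI2) auto

lemma shift_le: "x \<in> V \<Longrightarrow> y \<in> V \<Longrightarrow> 0 \<le> t \<Longrightarrow> shift y x \<le> p (x + t *s y) - t * p y"
  unfolding shift_def by (intro cINF_lower shift_bdd) auto

lemma shift_le_self: "x \<in> V \<Longrightarrow> y \<in> V \<Longrightarrow> shift y x \<le> p x"
  using shift_le[of x y 0] by simp

lemma shift_approx:
  assumes "x \<in> V" "y \<in> V" "0 < e"
  obtains t where "0 \<le> t" "p (x + t *s y) - t * p y < shift y x + e"
proof -
  have "\<exists>t\<in>{0..}. p (x + t *s y) - t * p y < shift y x + e"
    using cINF_less_iff[OF _ shift_bdd[OF assms(1,2)], of "shift y x + e"] assms(3)
    by (auto simp: shift_def)
  then show ?thesis using that by auto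
qed

lemma sublinear_shift:
  assumes y: "y \<in> V"
  shows "sublinear scale V (shift y)"
proof unfold_locales
  show "subspace V" by (rule sub)
next
  fix x x' assume x: "x \<in> V" "x' \<in> V"
  show "shift y (x + x') \<le> shift y x + shift y x'"
  proof (rule field_le_epsilon)
    fix e :: real assume "0 < e"
    then obtain t t' where t: "0 \<le> t" "p (x + t *s y) - t * p y < shift y x + e/2"
      and t': "0 \<le> t'" "p (x' + t' *s y) - t' * p y < shift y x' + e/2"
      using shift_approx[OF x(1) y half_gt_zero] shift_approx[OF x(2) y half_gt_zero] by metis
    have "shift y (x + x') \<le> p ((x + x') + (t + t') *s y) - (t + t') * p y"
      using x y t t' sub by (intro shift_le) (auto intro: subspace_add)
    also have "(x + x') + (t + t') *s y = (x + t *s y) + (x' + t' *s y)"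
      by (simp add: scale_left_distrib)
    also have "p \<dots> \<le> p (x + t *s y) + p (x' + t' *s y)"
      using x y sub by (intro subadd) (auto intro: subspace_add subspace_scale)
    finally show "shift y (x + x') \<le> shift y x + shift y x' + e"
      using t t' by (simp add: algebra_simps)
  qed
next
  fix x and r :: real assume x: "x \<in> V" and r: "0 \<le> r"
  have le: "shift y (r *s x) \<le> r * shift y x" if x: "x \<in> V" and r: "0 < r" for x r
  proof (rule field_le_epsilon)
    fix e :: real assume e: "0 < e"
    then obtain t where t: "0 \<le> t" "p (x + t *s y) - t * p y < shift y x + e/r"
      using shift_approx[OF x y, of "e/r"] r by auto
    have "shift y (r *s x) \<le> p (r *s x + (r * t) *s y) - (r * t) * p y"
      using x y t r sub by (intro shift_le) (auto intro: subspace_scale)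
    also have "r *s x + (r * t) *s y = r *s (x + t *s y)"
      by (simp add: scale_right_distrib)
    also have "p \<dots> = r * p (x + t *s y)"
      using x y r sub by (intro poshom) (auto intro: subspace_add subspace_scale)
    finally have "shift y (r *s x) \<le> r * (p (x + t *s y) - t * p y)" by (simp add: algebra_simps)
    also have "\<dots> \<le> r * (shift y x + e/r)" using t r by simp
    finally show "shift y (r *s x) \<le> r * shift y x + e" using r by (simp add: algebra_simps)
  qed
  show "shift y (r *s x) = r * shift y x"
  proof (cases "r = 0")
    case True
    have "shift y 0 = (INF t\<in>{0::real..}. 0)"
      unfolding shift_def using poshom[OF y] by (intro INF_cong) auto
    then show ?thesis using True by simp
  next
    case False
    with r have r: "0 < r" by simp
    have "shift y (inverse r *s (r *s x)) \<le> inverse r * shift y (r *s x)"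
      using x r sub by (intro le) (auto intro: subspace_scale)
    with r have "r * shift y x \<le> shift y (r *s x)" by (simp add: field_simps)
    with le[OF x r] show ?thesis by simp
  qed
qed

end

text \<open>Fixing the value 0 outside \<open>V\<close> lets the pointwise order on all arguments
  compare the functionals on \<open>V\<close> alone.\<close>

definition subs :: "(real \<Rightarrow> 'b::ab_group_add \<Rightarrow> 'b) \<Rightarrow> 'b set \<Rightarrow> ('b \<Rightarrow> real) \<Rightarrow> ('b \<Rightarrow> real) set"
  where "subs sc V p = {q. sublinear sc V q \<and> (\<forall>x\<in>V. q x \<le> p x) \<and> (\<forall>x. x \<notin> V \<longrightarrow> q x = 0)}"

text \<open>The infimum is finite because every member is at least \<open>- p (- x)\<close> at
  \<open>x\<close>. It is subadditive because, of two members of a chain, the smaller one bounds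
  both summands at once.\<close>

lemma (in sublinear) subs_chain_lower:
  assumes ne: "C \<noteq> {}" and C: "C \<subseteq> subs scale V p"
    and ch: "\<And>q q'. q \<in> C \<Longrightarrow> q' \<in> C \<Longrightarrow> (\<forall>x. q x \<le> q' x) \<or> (\<forall>x. q' x \<le> q x)"
  shows "(\<lambda>x. INF q\<in>C. q x) \<in> subs scale V p"
    and "q \<in> C \<Longrightarrow> (INF q\<in>C. q x) \<le> q x"
proof -
  have low: "- p (- x) \<le> q x" if "q \<in> C" "x \<in> V" for q x
  proof -
    interpret q: sublinear scale V q using that C by (auto simp: subs_def)
    have "- x \<in> V" using that sub subspace_neg by blast
    then show ?thesis using q.neg_le[OF that(2)] that C by (fastforce simp: subs_def)
  qed
  have z: "q x = 0" if "q \<in> C" "x \<notin> V" for q x using that C by (auto simp: subs_def)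
  have bdd: "bdd_below ((\<lambda>q. q x) ` C)" for x
  proof (cases "x \<in> V")
    case True
    then show ?thesis using low by (intro bdd_belowI2) blast
  next
    case False
    then show ?thesis using eq_refl[OF z[symmetric]] by (intro bdd_belowI2) blast
  qed
  show l: "(INF q\<in>C. q x) \<le> q x" if "q \<in> C" for q x
    using that bdd by (intro cINF_lower) auto
  have sl: "sublinear scale V q" if "q \<in> C" for q using that C by (auto simp: subs_def)
  have "sublinear scale V (\<lambda>x. INF q\<in>C. q x)"
  proof unfold_locales
    show "subspace V" by (rule sub)
  next
    fix x y assume xy: "x \<in> V" "y \<in> V"
    have *: "(INF q\<in>C. q (x + y)) \<le> q1 x + q2 y" if q12: "q1 \<in> C" "q2 \<in> C" for q1 q2
    proof -
      obtain q where q: "q \<in> C" "q x \<le> q1 x" "q y \<le> q2 y"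
        using ch[OF q12] q12 by (meson order_refl)
      then show ?thesis using l[OF q(1), of "x + y"] sublinear.subadd[OF sl[OF q(1)] xy] by linarith
    qed
    have "(INF q\<in>C. q (x + y)) - (INF q\<in>C. q y) \<le> (INF q\<in>C. q x)"
    proof (intro cINF_greatest ne)
      fix q1 assume q1: "q1 \<in> C"
      have "(INF q\<in>C. q (x + y)) - q1 x \<le> (INF q\<in>C. q y)"
        using *[OF q1] by (intro cINF_greatest ne) (simp add: algebra_simps)
      then show "(INF q\<in>C. q (x + y)) - (INF q\<in>C. q y) \<le> q1 x" by linarith
    qed
    then show "(INF q\<in>C. q (x + y)) \<le> (INF q\<in>C. q x) + (INF q\<in>C. q y)" by linarith
  next
    fix x and r :: real assume x: "x \<in> V" and r: "0 \<le> r"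
    have h: "q (r *s x) = r * q x" if "q \<in> C" for q
      using sublinear.poshom[OF sl[OF that] x r] .
    show "(INF q\<in>C. q (r *s x)) = r * (INF q\<in>C. q x)"
    proof (cases "r = 0")
      case True
      have "(INF q\<in>C. q (r *s x)) = (INF q\<in>C. 0)" 
      proof (intro INF_cong refl)
        fix q assume "q \<in> C"
        from h[OF this] show "q (r *s x) = 0" using True by simp
      qed
      then show ?thesis using True ne by simp
    next
      case False
      with r have r: "0 < r" by simp
      have "r * (INF q\<in>C. q x) \<le> (INF q\<in>C. q (r *s x))"
      proof (rule cINF_greatest[OF ne])
        fix q assume q: "q \<in> C"
        show "r * (INF q\<in>C. q x) \<le> q (r *s x)"
          unfolding h[OF q] using l[OF q, of x] r by simp
      qed
      moreover have "(INF q\<in>C. q (r *s x)) / r \<le> (INF q\<in>C. q x)"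
      proof (rule cINF_greatest[OF ne])
        fix q assume q: "q \<in> C"
        show "(INF q\<in>C. q (r *s x)) / r \<le> q x"
          using l[OF q, of "r *s x"] r unfolding h[OF q] by (simp add: field_simps)
      qed
      ultimately show ?thesis using r by (simp add: field_simps)
    qed
  qed
  moreover have "(INF q\<in>C. q x) \<le> p x" if "x \<in> V" for x
  proof -
    obtain q where q: "q \<in> C" using ne by blast
    then have "q x \<le> p x" using C that by (auto simp: subs_def)
    then show ?thesis using l[OF q, of x] by linarith
  qed
  moreover have "(INF q\<in>C. q x) = 0" if "x \<notin> V" for x
  proof -
    have "(INF q\<in>C. q x) = (INF q\<in>C. 0)" by (intro INF_cong refl z that)
    then show ?thesis using ne by simp
  qed
  ultimately show "(\<lambda>x. INF q\<in>C. q x) \<in> subs scale V p" by (simp add: subs_def)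
qed

lemma (in sublinear) restrict_in_subs:
  assumes q: "sublinear scale V q" and le: "\<And>x. x \<in> V \<Longrightarrow> q x \<le> p x"
  shows "(\<lambda>x. if x \<in> V then q x else 0) \<in> subs scale V p"
proof -
  interpret q: sublinear scale V q by (rule q)
  have "sublinear scale V (\<lambda>x. if x \<in> V then q x else 0)"
    by unfold_locales (simp_all add: sub q.subadd q.poshom subspace_add[OF sub] subspace_scale[OF sub])
  then show ?thesis using le by (auto simp: subs_def)
qed

lemma (in sublinear) minimal_subs:
  obtains m where "m \<in> subs scale V p" "\<And>q. q \<in> subs scale V p \<Longrightarrow> (\<forall>x. q x \<le> m x) \<Longrightarrow> q = m"
proof -
  let ?A = "subs scale V p"
  \<comment> \<open>The order is reversed: Zorn's lemma yields a maximal element, which here is a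
    minimal functional.\<close>
  let ?P = "\<lambda>q q' :: 'b \<Rightarrow> real. \<forall>x. q' x \<le> q x"
  have "\<exists>m\<in>?A. \<forall>q\<in>?A. ?P m q \<longrightarrow> q = m"
  proof (rule predicate_Zorn)
    show "partial_order_on ?A (relation_of ?P ?A)"
      by (rule partial_order_on_relation_ofI) (auto intro: order_trans antisym simp: fun_eq_iff)
  next
    fix C assume C: "C \<in> Chains (relation_of ?P ?A)"
    show "\<exists>u\<in>?A. \<forall>q\<in>C. ?P q u"
    proof (cases "C = {}")
      case True
      have "(\<lambda>x. if x \<in> V then p x else 0) \<in> ?A"
        by (rule restrict_in_subs) (unfold_locales, auto)
      then show ?thesis using True by auto
    next
      case False
      have CA: "C \<subseteq> ?A" and ch: "\<And>q q'. q \<in> C \<Longrightarrow> q' \<in> C \<Longrightarrow> (\<forall>x. q x \<le> q' x) \<or> (\<forall>x. q' x \<le> q x)"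
        using C by (auto simp: Chains_def relation_of_def)
      show ?thesis
      proof (rule bexI)
        show "\<forall>q\<in>C. \<forall>x. (INF q\<in>C. q x) \<le> q x"
          using subs_chain_lower(2)[OF False CA ch] by blast
        show "(\<lambda>x. INF q\<in>C. q x) \<in> ?A" by (rule subs_chain_lower(1)[OF False CA ch])
      qed
    qed
  qed
  then show ?thesis using that by blast
qed

text \<open>A minimal sublinear functional is linear: it coincides with each of its own shifts.\<close>

theorem (in sublinear) hahn_banach:
  assumes x0: "x0 \<in> V"
  shows "\<exists>L. (\<forall>x\<in>V. \<forall>y\<in>V. L (x + y) = L x + L y) \<and> (\<forall>r. \<forall>x\<in>V. L (r *s x) = r * L x) \<and>
    (\<forall>x\<in>V. L x \<le> p x) \<and> L x0 = p x0"
proof -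
  \<comment> \<open>Minimality is sought below \<open>shift x0\<close> rather than below
    \<open>p\<close>: every linear minorant of \<open>shift x0\<close> takes the value
    \<open>p x0\<close> at \<open>x0\<close>.\<close>
  interpret s: sublinear scale V "shift x0" by (rule sublinear_shift[OF x0])
  obtain m where m: "m \<in> subs scale V (shift x0)"
    and min: "\<And>q. q \<in> subs scale V (shift x0) \<Longrightarrow> (\<forall>x. q x \<le> m x) \<Longrightarrow> q = m"
    by (rule s.minimal_subs) blast
  interpret m: sublinear scale V m using m by (simp add: subs_def)
  have m_le: "m x \<le> shift x0 x" if "x \<in> V" for x using m that by (auto simp: subs_def)
  have add: "m (x + y) = m x + m y" if xy: "x \<in> V" "y \<in> V" for x y
  proof -
    let ?q = "\<lambda>x. if x \<in> V then m.shift y x else 0"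
    have "?q \<in> subs scale V (shift x0)"
      by (rule s.restrict_in_subs[OF m.sublinear_shift[OF xy(2)]])
        (use m.shift_le_self[OF _ xy(2)] m_le order_trans in blast)
    moreover have "\<forall>x. ?q x \<le> m x" using m.shift_le_self[OF _ xy(2)] m by (auto simp: subs_def)
    ultimately have "?q = m" by (rule min)
    then have "m x = m.shift y x" using xy(1) by (simp add: fun_eq_iff split: if_splits)
    also have "\<dots> \<le> m (x + y) - m y" using m.shift_le[OF xy, of 1] by simp
    finally show ?thesis using m.subadd[OF xy] by simp
  qed
  have neg: "m (- x) = - m x" if "x \<in> V" for x
    using add[of x "- x"] that m.p_zero subspace_neg[OF sub] by simp
  have hom: "m (r *s x) = r * m x" if x: "x \<in> V" for r x
  proof (cases "0 \<le> r")
    case False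
    then have "m ((- r) *s x) = (- r) * m x" by (intro m.poshom x) auto
    then show ?thesis using neg[OF subspace_scale[OF sub x, of r]] by simp
  qed (simp add: m.poshom x)
  have "m x \<le> p x" if "x \<in> V" for x using m_le[OF that] shift_le_self[OF that x0] by simp
  moreover have "m x0 = p x0"
  proof -
    have nx: "- x0 \<in> V" using subspace_neg[OF sub x0] .
    have "shift x0 (- x0) \<le> p (- x0 + 1 *s x0) - 1 * p x0" by (rule shift_le[OF nx x0]) simp
    then have "- m x0 \<le> - p x0" using m_le[OF nx] neg[OF x0] p_zero by simp
    then show ?thesis using calculation[OF x0] by simp
  qed
  ultimately show ?thesis using add hom by (intro exI[of _ m]) simp
qed

text \<open>Sequences and functionals are scaled pointwise. With this scaling the Hahn-Banach
  theorem applies to \<open>fs\<close> and to dual spaces, which is why \<open>scale\<close> is a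
  parameter of \<open>sublinear\<close>.\<close>

lemma vector_space_fun: "vector_space (\<lambda>r (f :: 'a \<Rightarrow> real) z. r * f z)"
  by unfold_locales (auto simp: fun_eq_iff algebra_simps)

section \<open>Small convex combinations of pointwise null sequences\<close>

text \<open>If the convex combinations of a pointwise null sequence stayed large on a compact set, then
  passing to the points at which one of finitely many of the functions is at least \<open>\<eta>\<close> could be
  iterated, and a point in the intersection of the resulting sets would violate the convergence.\<close>

definition small_comb :: "(nat \<Rightarrow> 'a \<Rightarrow> real) \<Rightarrow> 'a set \<Rightarrow> real \<Rightarrow> nat set \<Rightarrow> bool"
  where "small_comb g K e B \<longleftrightarrow> (\<exists>J l. finite J \<and> J \<inter> B = {} \<and> (\<forall>j\<in>J. 0 \<le> l j) \<and> sum l J = 1 \<and>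
    (\<forall>x\<in>K. (\<Sum>j\<in>J. l j * g j x) \<le> e))"

lemma small_comb_step:
  fixes g :: "nat \<Rightarrow> 'a \<Rightarrow> real"
  assumes g01: "\<And>j x. x \<in> K \<Longrightarrow> 0 \<le> g j x \<and> g j x \<le> 1"
    and eta: "0 < \<eta>" "\<eta> \<le> e'" "e' < e"
    and nb: "\<not> small_comb g K e B"
  obtains A where "finite A" "A \<inter> B = {}" "\<not> small_comb g {x \<in> K. \<exists>m\<in>A. \<eta> \<le> g m x} e' (B \<union> A)"
proof (rule ccontr)
  assume contr: "\<not> thesis"
  note step = that
  have all: "small_comb g {x \<in> K. \<exists>m\<in>A. \<eta> \<le> g m x} e' (B \<union> A)" if "finite A" "A \<inter> B = {}" for A
    by (rule ccontr) (rule notE[OF contr step[OF that]])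
  define R where "R A Jl \<longleftrightarrow> finite (fst Jl) \<and> fst Jl \<inter> (B \<union> A) = {} \<and> (\<forall>j\<in>fst Jl. 0 \<le> snd Jl j) \<and>
     sum (snd Jl) (fst Jl) = 1 \<and> (\<forall>x\<in>{x \<in> K. \<exists>m\<in>A. \<eta> \<le> g m x}. (\<Sum>j\<in>fst Jl. snd Jl j * g j x) \<le> e')"
    for A and Jl :: "nat set \<times> (nat \<Rightarrow> real)"
  have "\<forall>A. \<exists>Jl. finite A \<and> A \<inter> B = {} \<longrightarrow> R A Jl"
  proof (intro allI)
    fix A
    show "\<exists>Jl. finite A \<and> A \<inter> B = {} \<longrightarrow> R A Jl"
    proof (cases "finite A \<and> A \<inter> B = {}")
      case True
      then obtain J l where "R A (J, l)"
        using all[of A] unfolding small_comb_def R_def fst_conv snd_conv by blast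
      then show ?thesis by blast
    qed blast
  qed
  then obtain F where F: "\<And>A. finite A \<Longrightarrow> A \<inter> B = {} \<Longrightarrow> R A (F A)" by metis
  define A where "A = rec_nat {} (\<lambda>i X. X \<union> fst (F X))"
  define J where "J i = fst (F (A i))" for i
  define l where "l i = snd (F (A i))" for i
  have A0: "A 0 = {}" and AS: "A (Suc i) = A i \<union> J i" for i by (auto simp: A_def J_def)
  have fA: "finite (A i) \<and> A i \<inter> B = {}" for i
  proof (induction i)
    case (Suc i)
    then show ?case using F[of "A i"] by (auto simp: AS R_def J_def)
  qed (simp add: A0)
  have R: "R (A i) (J i, l i)" for i using F[of "A i"] fA[of i] by (simp add: J_def l_def)
  have fJ: "finite (J i)" and JB: "J i \<inter> B = {}" and JA: "J i \<inter> A i = {}" 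
    and l0: "\<And>j. j \<in> J i \<Longrightarrow> 0 \<le> l i j" and l1: "sum (l i) (J i) = 1"
    and le: "\<And>x m. x \<in> K \<Longrightarrow> m \<in> A i \<Longrightarrow> \<eta> \<le> g m x \<Longrightarrow> (\<Sum>j\<in>J i. l i j * g j x) \<le> e'" for i
    using R[of i] by (auto simp: R_def)
  have AU: "A k = (\<Union>i<k. J i)" for k by (induction k) (auto simp: A0 AS lessThan_Suc)
  have disj: "J i \<inter> J i' = {}" if "i < i'" for i i'
  proof -
    have "J i \<subseteq> A i'" using that AU by blast
    then show ?thesis using JA[of i'] by blast
  qed
  obtain k :: nat where k: "0 < k" "1 / (e - e') < real k"
    using reals_Archimedean2[of "1 / (e - e')"] eta
    by (metis divide_less_0_1_iff gr_zeroI less_iff_diff_less_0 linorder_not_less of_nat_0 order_less_imp_le)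
  then have k': "1 < real k * (e - e')" using eta by (simp add: field_simps)
  define L where "L j = (\<Sum>i<k. if j \<in> J i then l i j else 0) / real k" for j
  have Lsum: "(\<Sum>j\<in>A k. L j * h j) = (\<Sum>i<k. \<Sum>j\<in>J i. l i j * h j) / real k" for h :: "nat \<Rightarrow> real"
  proof -
    have "(\<Sum>j\<in>A k. L j * h j) = (\<Sum>j\<in>A k. \<Sum>i<k. (if j \<in> J i then l i j * h j else 0)) / real k"
      unfolding L_def sum_divide_distrib
      by (auto simp: sum_distrib_right intro!: sum.cong)
    also have "(\<Sum>j\<in>A k. \<Sum>i<k. (if j \<in> J i then l i j * h j else 0)) =
        (\<Sum>i<k. \<Sum>j\<in>A k. (if j \<in> J i then l i j * h j else 0))"
      by (rule sum.swap)
    also have "\<dots> = (\<Sum>i<k. \<Sum>j\<in>J i. l i j * h j)"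
    proof (rule sum.cong[OF refl])
      fix i assume "i \<in> {..<k}"
      then have "A k \<inter> J i = J i" using AU by auto
      then show "(\<Sum>j\<in>A k. (if j \<in> J i then l i j * h j else 0)) = (\<Sum>j\<in>J i. l i j * h j)"
        using fA[of k] by (simp add: sum.If_cases)
    qed
    finally show ?thesis .
  qed
  have "small_comb g K e B"
    unfolding small_comb_def
  proof (intro exI conjI ballI)
    show "finite (A k)" "A k \<inter> B = {}" using fA by auto
    show "0 \<le> L j" for j unfolding L_def using l0 by (intro divide_nonneg_nonneg sum_nonneg) auto
    show "sum L (A k) = 1" using Lsum[of "\<lambda>_. 1"] l1 k by simp
    fix x assume x: "x \<in> K"
    define s where "s i = (\<Sum>j\<in>J i. l i j * g j x)" for i
    have s1: "s i \<le> 1" for i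
    proof -
      have "s i \<le> (\<Sum>j\<in>J i. l i j * 1)"
        unfolding s_def using l0 g01[OF x] by (intro sum_mono mult_left_mono) auto
      then show ?thesis using l1 by simp
    qed
    have s_eta: "s i \<le> e'" if "\<forall>m\<in>J i. g m x < \<eta>" for i
    proof -
      have "s i \<le> (\<Sum>j\<in>J i. l i j * \<eta>)"
        unfolding s_def using l0 that by (intro sum_mono mult_left_mono) (auto intro: less_imp_le)
      also have "\<dots> = \<eta>" using l1 by (simp add: sum_distrib_right[symmetric])
      finally show ?thesis using eta by simp
    qed
    have "(\<Sum>i<k. s i) \<le> real k * e' + 1"
    proof (cases "\<exists>i. \<exists>m\<in>J i. \<eta> \<le> g m x")
      case False
      then have "s i \<le> e'" for i using s_eta by (meson not_le)
      then have "(\<Sum>i<k. s i) \<le> (\<Sum>i<k. e')" by (intro sum_mono)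
      then show ?thesis by simp
    next
      case True
      define i0 where "i0 = (LEAST i. \<exists>m\<in>J i. \<eta> \<le> g m x)"
      obtain m where m: "m \<in> J i0" "\<eta> \<le> g m x" using LeastI_ex[OF True] by (auto simp: i0_def)
      have "s i \<le> e' + (if i = i0 then 1 else 0)" for i
      proof (cases i i0 rule: linorder_cases)
        case less
        then have "\<forall>m\<in>J i. g m x < \<eta>" using not_less_Least[of i "\<lambda>i. \<exists>m\<in>J i. \<eta> \<le> g m x"]
          by (auto simp: i0_def)
        then show ?thesis using s_eta less by simp
      next
        case equal
        then show ?thesis using s1[of i] eta by simp
      next
        case greater
        then have "m \<in> A i" using m AU by auto
        then show ?thesis using le[OF x _ m(2), of i] greater by (simp add: s_def)
      qed
      then have "(\<Sum>i<k. s i) \<le> (\<Sum>i<k. e' + (if i = i0 then 1 else 0))" by (intro sum_mono)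
      also have "\<dots> \<le> real k * e' + 1" by (simp add: sum.distrib)
      finally show ?thesis .
    qed
    then have "(\<Sum>i<k. s i) \<le> real k * e" using k' by (simp add: algebra_simps)
    then show "(\<Sum>j\<in>A k. L j * g j x) \<le> e"
      unfolding Lsum s_def[symmetric] using k by (simp add: field_simps)
  qed
  then show False using nb by simp
qed

theorem small_convex_combination:
  fixes g :: "nat \<Rightarrow> 'a::t2_space \<Rightarrow> real"
  assumes K: "compact K" and cont: "\<And>j. continuous_on K (g j)"
    and g01: "\<And>j x. x \<in> K \<Longrightarrow> 0 \<le> g j x \<and> g j x \<le> 1"
    and null: "\<And>x \<eta>. x \<in> K \<Longrightarrow> 0 < \<eta> \<Longrightarrow> finite {j. \<eta> \<le> g j x}"
    and e: "0 < e"
  obtains J l where "finite J" "\<And>j. j \<in> J \<Longrightarrow> 0 \<le> l j" "sum l J = 1"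
    "\<And>x. x \<in> K \<Longrightarrow> (\<Sum>j\<in>J. l j * g j x) \<le> e"
proof (rule ccontr)
  assume contr: "\<not> thesis"
  have nb0: "\<not> small_comb g K e {}"
    using contr that unfolding small_comb_def by blast
  define \<eta> where "\<eta> = e / 2"
  \<comment> \<open>The admissible bound starts at \<open>e\<close> and shrinks strictly at each
    iteration, yet stays above the fixed threshold \<eta>.\<close>
  define ee where "ee n = \<eta> + \<eta> * (1/2) ^ n" for n
  have eta: "0 < \<eta>" using e by (simp add: \<eta>_def)
  have ee: "ee 0 = e" "\<eta> \<le> ee (Suc n)" "ee (Suc n) < ee n" for n
    using eta by (auto simp: ee_def \<eta>_def)
  define P where "P n Q \<longleftrightarrow> snd Q \<subseteq> K \<and> compact (snd Q) \<and> finite (fst Q) \<and> \<not> small_comb g (snd Q) (ee n) (fst Q)"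
    for n and Q :: "nat set \<times> 'a set"
  define S where "S n Q Q' \<longleftrightarrow> snd Q' \<subseteq> snd Q \<and> fst Q \<subseteq> fst Q' \<and>
      (\<forall>x\<in>snd Q'. \<exists>m\<in>fst Q' - fst Q. \<eta> \<le> g m x)" for n :: nat and Q Q' :: "nat set \<times> 'a set"
  have "\<exists>f. \<forall>n. P n (f n) \<and> S n (f n) (f (Suc n))"
  proof (rule dependent_nat_choice)
    show "\<exists>Q. P 0 Q" using nb0 K by (intro exI[of _ "({}, K)"]) (simp add: P_def ee)
  next
    fix Q n assume Q: "P n Q"
    obtain A where A: "finite A" "A \<inter> fst Q = {}"
      "\<not> small_comb g {x \<in> snd Q. \<exists>m\<in>A. \<eta> \<le> g m x} (ee (Suc n)) (fst Q \<union> A)"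
    proof (rule small_comb_step)
      show "0 < \<eta>" "\<eta> \<le> ee (Suc n)" "ee (Suc n) < ee n" using eta ee by auto
      show "\<not> small_comb g (snd Q) (ee n) (fst Q)" using Q by (simp add: P_def)
      show "0 \<le> g j x \<and> g j x \<le> 1" if "x \<in> snd Q" for j x using g01 that Q by (auto simp: P_def)
    qed
    have "compact (\<Union>m\<in>A. snd Q \<inter> g m -` {\<eta>..})"
    proof (intro compact_UN A ballI)
      fix m
      have "closedin (top_of_set (snd Q)) (snd Q \<inter> g m -` {\<eta>..})"
        using Q cont by (intro continuous_closedin_preimage) (auto simp: P_def intro: continuous_on_subset)
      then show "compact (snd Q \<inter> g m -` {\<eta>..})"
        using Q by (auto simp: P_def intro: closedin_compact)
    qed
    also have "(\<Union>m\<in>A. snd Q \<inter> g m -` {\<eta>..}) = {x \<in> snd Q. \<exists>m\<in>A. \<eta> \<le> g m x}" by auto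
    finally show "\<exists>Q'. P (Suc n) Q' \<and> S n Q Q'"
      using Q A by (intro exI[of _ "(fst Q \<union> A, {x \<in> snd Q. \<exists>m\<in>A. \<eta> \<le> g m x})"]) (auto simp: P_def S_def)
  qed
  then obtain f where f: "\<And>n. P n (f n)" "\<And>n. S n (f n) (f (Suc n))" by blast
  \<comment> \<open>On an empty set any single fresh index would be a small combination, so the sets
    never become empty.\<close>
  have ne: "snd (f n) \<noteq> {}" for n
  proof
    assume "snd (f n) = {}"
    moreover obtain j where "j \<notin> fst (f n)"
      using f(1)[of n] ex_new_if_finite[OF infinite_UNIV_nat] by (auto simp: P_def)
    ultimately have "small_comb g (snd (f n)) (ee n) (fst (f n))"
      unfolding small_comb_def by (intro exI[of _ "{j}"] exI[of _ "\<lambda>_. 1"]) auto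
    then show False using f(1)[of n] by (simp add: P_def)
  qed
  have dec: "snd (f n) \<subseteq> snd (f m)" if "m \<le> n" for m n
    using that by (rule lift_Suc_antimono_le[of "\<lambda>n. snd (f n)", rotated]) (use f(2) in \<open>auto simp: S_def\<close>)
  have inc: "fst (f m) \<subseteq> fst (f n)" if "m \<le> n" for m n
    using that by (rule lift_Suc_mono_le[of "\<lambda>n. fst (f n)", rotated]) (use f(2) in \<open>auto simp: S_def\<close>)
  have "(\<Inter>n. snd (f n)) \<noteq> {}"
  proof -
    have "snd (f 0) \<inter> (\<Inter>n. snd (f n)) \<noteq> {}"
    proof (rule compact_imp_fip_image)
      show "compact (snd (f 0))" using f(1) by (auto simp: P_def)
      show "closed (snd (f n))" for n using f(1)[of n] by (auto simp: P_def compact_imp_closed)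
      fix I :: "nat set" assume I: "finite I"
      have "snd (f (Max (insert 0 I))) \<subseteq> snd (f 0) \<inter> (\<Inter>n\<in>I. snd (f n))"
        using I by (intro Int_greatest INT_greatest dec) auto
      then show "snd (f 0) \<inter> (\<Inter>n\<in>I. snd (f n)) \<noteq> {}" using ne by blast
    qed
    then show ?thesis by blast
  qed
  then obtain x where x: "\<And>n. x \<in> snd (f n)" by auto
  then have "\<forall>n. \<exists>m. m \<in> fst (f (Suc n)) - fst (f n) \<and> \<eta> \<le> g m x"
    using f(2) unfolding S_def by blast
  \<comment> \<open>Each iteration contributes a new index whose function is large at
    \<open>x\<close>, against \<open>null\<close>.\<close>
  then obtain m where m: "\<And>n. m n \<in> fst (f (Suc n)) - fst (f n)" "\<And>n. \<eta> \<le> g (m n) x" by metis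
  have "inj m"
  proof (rule linorder_injI)
    fix i j :: nat assume "i < j"
    then have "fst (f (Suc i)) \<subseteq> fst (f j)" by (intro inc) simp
    then show "m i \<noteq> m j" using m(1)[of i] m(1)[of j] by auto
  qed
  then have "infinite (range m)" by (simp add: finite_image_iff)
  moreover have "range m \<subseteq> {j. \<eta> \<le> g j x}" using m by auto
  moreover have "x \<in> K" using x f(1)[of 0] by (auto simp: P_def)
  ultimately show False using null[OF _ eta, of x] finite_subset by blast
qed

section \<open>Amalgamation by a Calderon product\<close>

definition supp :: "(nat \<Rightarrow> real) \<Rightarrow> nat set"
  where "supp a = {n. a n \<noteq> 0}"

definition fs :: "(nat \<Rightarrow> real) set"
  where "fs = {a. finite (supp a)}"

text \<open>Summing over the support of the first argument allows the second to be an arbitrary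
  sequence, such as a functional with infinite support.\<close>

definition dot :: "(nat \<Rightarrow> real) \<Rightarrow> (nat \<Rightarrow> real) \<Rightarrow> real"
  where "dot a b = (\<Sum>n\<in>supp a. a n * b n)"

definition restr :: "nat set \<Rightarrow> (nat \<Rightarrow> real) \<Rightarrow> nat \<Rightarrow> real"
  where "restr S a = (\<lambda>n. if n \<in> S then a n else 0)"

definition disj_seq :: "(nat \<Rightarrow> nat \<Rightarrow> real) \<Rightarrow> bool"
  where "disj_seq f \<longleftrightarrow> (\<forall>j k n. j \<noteq> k \<longrightarrow> f j n = 0 \<or> f k n = 0)"

lemma fsD: "a \<in> fs \<Longrightarrow> finite (supp a)"
  by (simp add: fs_def)

lemma dot_eq: "finite S \<Longrightarrow> supp a \<subseteq> S \<Longrightarrow> dot a b = (\<Sum>n\<in>S. a n * b n)"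
  unfolding dot_def by (rule sum.mono_neutral_left) (auto simp: supp_def)

lemma fs_mono: "a \<in> fs \<Longrightarrow> (\<And>n. a n = 0 \<Longrightarrow> b n = 0) \<Longrightarrow> b \<in> fs"
  by (auto simp: fs_def supp_def elim: rev_finite_subset)

lemma supp_restr: "supp (restr S a) \<subseteq> S"
  by (auto simp: supp_def restr_def)

lemma restr_fs [simp]: "finite S \<Longrightarrow> restr S a \<in> fs"
  using supp_restr[of S a] by (auto simp: fs_def intro: finite_subset)

lemma dot_restr: "finite S \<Longrightarrow> dot (restr S a) b = (\<Sum>n\<in>S. a n * b n)"
  unfolding dot_eq[OF _ supp_restr] by (intro sum.cong) (auto simp: restr_def)

lemma fs_zero [simp]: "(\<lambda>n. 0) \<in> fs"
  by (simp add: fs_def supp_def)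

lemma fs_add: "a \<in> fs \<Longrightarrow> b \<in> fs \<Longrightarrow> (\<lambda>n. a n + b n) \<in> fs"
  unfolding fs_def by (auto simp: supp_def intro: finite_subset[of _ "supp a \<union> supp b"])

lemma fs_scale: "a \<in> fs \<Longrightarrow> (\<lambda>n. r * a n) \<in> fs"
  by (rule fs_mono) auto

lemma fs_divide: "a \<in> fs \<Longrightarrow> (\<lambda>n. a n / r) \<in> fs"
  by (rule fs_mono) auto

lemma fs_sum: "(\<And>j. j \<in> J \<Longrightarrow> f j \<in> fs) \<Longrightarrow> (\<lambda>n. \<Sum>j\<in>J. l j * f j n) \<in> fs"
proof (induction J rule: infinite_finite_induct)
  case (insert j J)
  then have "(\<lambda>n. l j * f j n + (\<Sum>j\<in>J. l j * f j n)) \<in> fs" by (intro fs_add fs_scale) auto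
  then show ?case using insert by simp
qed auto

lemma dot_add: "a \<in> fs \<Longrightarrow> a' \<in> fs \<Longrightarrow> dot (\<lambda>n. a n + a' n) b = dot a b + dot a' b"
  by (subst (1 2 3) dot_eq[of "supp a \<union> supp a'"])
    (auto simp: fs_def supp_def algebra_simps sum.distrib)

lemma dot_scale: "a \<in> fs \<Longrightarrow> dot (\<lambda>n. r * a n) b = r * dot a b"
  by (subst (1 2) dot_eq[of "supp a"]) (auto simp: fs_def supp_def algebra_simps sum_distrib_left)

lemma dot_divide: "a \<in> fs \<Longrightarrow> dot (\<lambda>n. a n / r) b = dot a b / r"
  using dot_scale[of a "1 / r" b] by simp

lemma dot_sum: "(\<And>j. j \<in> J \<Longrightarrow> f j \<in> fs) \<Longrightarrow> dot (\<lambda>n. \<Sum>j\<in>J. l j * f j n) b = (\<Sum>j\<in>J. l j * dot (f j) b)"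
proof (induction J rule: infinite_finite_induct)
  case (insert j J)
  have "dot (\<lambda>n. l j * f j n + (\<Sum>j\<in>J. l j * f j n)) b = l j * dot (f j) b + (\<Sum>j\<in>J. l j * dot (f j) b)"
    using insert by (subst dot_add) (auto intro!: fs_scale fs_sum simp: dot_scale)
  then show ?case using insert by simp
qed (auto simp: dot_def supp_def)

lemma dot_mono:
  assumes "a' \<in> fs" "\<And>n. 0 \<le> a n" "\<And>n. a n \<le> a' n" "\<And>n. 0 \<le> b n"
  shows "dot a b \<le> dot a' b"
proof -
  have *: "supp a \<subseteq> supp a'" using assms(2,3) by (auto simp: supp_def) (metis antisym)
  then show ?thesis using assms fsD[OF assms(1)]
    by (subst (1 2) dot_eq[of "supp a'"]) (auto intro!: sum_mono mult_right_mono)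
qed

lemma dot_nonneg: "(\<And>n. 0 \<le> a n) \<Longrightarrow> (\<And>n. 0 \<le> b n) \<Longrightarrow> 0 \<le> dot a b"
  by (simp add: dot_def sum_nonneg)

lemma dot_term_le:
  assumes "a \<in> fs" "\<And>n. 0 \<le> a n" "\<And>n. 0 \<le> b n"
  shows "a n * b n \<le> dot a b"
proof (cases "n \<in> supp a")
  case True
  then show ?thesis using assms unfolding dot_def by (intro member_le_sum) (auto simp: fs_def)
next
  case False
  then show ?thesis using dot_nonneg[of a b] assms by (simp add: supp_def)
qed

lemma disj_reindex: "disj_seq f \<Longrightarrow> inj r \<Longrightarrow> disj_seq (\<lambda>j. f (r j))"
  by (auto simp: disj_seq_def inj_def)

lemma disj_smaller: "disj_seq f \<Longrightarrow> (\<And>j n. f j n = 0 \<Longrightarrow> g j n = 0) \<Longrightarrow> disj_seq g"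
  unfolding disj_seq_def by blast

text \<open>For nonnegative \<open>K\<close>, the positive part of the unit ball of the norm whose
  value at \<open>f\<close> is the supremum over \<open>b\<close> in \<open>K\<close> of the pairing
  of \<open>|f|\<close> with \<open>b\<close>. The norms in play ignore signs, so positive parts of
  balls carry all the information.\<close>

definition fpolar :: "(nat \<Rightarrow> real) set \<Rightarrow> (nat \<Rightarrow> real) set"
  where "fpolar K = {f \<in> fs. (\<forall>n. 0 \<le> f n) \<and> (\<forall>b\<in>K. dot f b \<le> 1)}"

lemma fpolarD: "f \<in> fpolar K \<Longrightarrow> f \<in> fs" "f \<in> fpolar K \<Longrightarrow> 0 \<le> f n" "f \<in> fpolar K \<Longrightarrow> b \<in> K \<Longrightarrow> dot f b \<le> 1"
  by (auto simp: fpolar_def)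

text \<open>Excluding a uniform positive lower bound amounts to convergence to 0, since subsequences
  of a disjoint sequence in the ball are again of this kind.\<close>

definition null_on :: "(nat \<Rightarrow> real) set \<Rightarrow> bool"
  where "null_on K \<longleftrightarrow> (\<forall>b\<in>K. \<forall>f \<epsilon>. disj_seq f \<longrightarrow> (\<forall>j. f j \<in> fpolar K) \<longrightarrow> 0 < \<epsilon> \<longrightarrow> \<not> (\<forall>j. \<epsilon> \<le> dot (f j) b))"

definition nneg :: "(nat \<Rightarrow> real) set \<Rightarrow> bool"
  where "nneg K \<longleftrightarrow> (\<forall>b\<in>K. \<forall>n. 0 \<le> b n)"

lemma nnegD: "nneg K \<Longrightarrow> b \<in> K \<Longrightarrow> 0 \<le> b n"
  by (simp add: nneg_def)

definition unit :: "nat \<Rightarrow> real \<Rightarrow> nat \<Rightarrow> real"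
  where "unit n r = (\<lambda>m. if m = n then r else 0)"

lemma unit_fs [simp]: "unit n r \<in> fs"
  by (rule fs_mono[OF restr_fs[of "{n}" "\<lambda>_. 1"]]) (auto simp: unit_def restr_def split: if_splits)

lemma dot_unit [simp]: "dot (unit n r) b = r * b n"
  by (subst dot_eq[of "{n}"]) (auto simp: supp_def unit_def)

lemma fpolar_solid:
  assumes K: "nneg K"
    and f: "f \<in> fpolar K" and g: "\<And>n. 0 \<le> g n" "\<And>n. g n \<le> f n"
  shows "g \<in> fpolar K"
proof -
  have "g \<in> fs" using fpolarD(1)[OF f] g by (intro fs_mono[of f g]) (metis antisym)+
  moreover have "dot g b \<le> 1" if "b \<in> K" for b
    using dot_mono[of f g b] f g nnegD[OF K that] fpolarD[OF f] that by (meson order_trans)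
  ultimately show ?thesis using g by (auto simp: fpolar_def)
qed

lemma fpolar_comb:
  assumes K: "nneg K"
    and f: "\<And>j. j \<in> J \<Longrightarrow> f j \<in> fpolar K" and l: "\<And>j. j \<in> J \<Longrightarrow> 0 \<le> l j" "sum l J \<le> 1"
  shows "(\<lambda>n. \<Sum>j\<in>J. l j * f j n) \<in> fpolar K"
proof -
  have "dot (\<lambda>n. \<Sum>j\<in>J. l j * f j n) b \<le> 1" if b: "b \<in> K" for b
  proof -
    have "(\<Sum>j\<in>J. l j * dot (f j) b) \<le> (\<Sum>j\<in>J. l j * 1)"
      using f l b by (intro sum_mono mult_left_mono) (auto simp: fpolar_def)
    then show ?thesis using l f by (subst dot_sum) (auto simp: fpolar_def)
  qed
  then show ?thesis using f l by (auto simp: fpolar_def intro!: fs_sum sum_nonneg)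
qed

lemma fpolar_convex:
  assumes K: "nneg K"
    and "f \<in> fpolar K" "g \<in> fpolar K" "0 \<le> s" "s \<le> 1"
  shows "(\<lambda>n. s * f n + (1 - s) * g n) \<in> fpolar K"
  using fpolar_comb[OF K, where J = "{True, False}" and f = "\<lambda>b. if b then f else g" and l = "\<lambda>b. if b then s else 1 - s"]
    assms(2-) by simp

lemma fpolar_coord_bound:
  assumes K: "nneg K" and ex: "\<exists>b\<in>K. 0 < b n"
  obtains M where "0 < M" "\<And>f. f \<in> fpolar K \<Longrightarrow> f n \<le> M"
proof -
  obtain b where b: "b \<in> K" "0 < b n" using ex by blast
  have "f n \<le> 1 / b n" if "f \<in> fpolar K" for f
  proof -
    have "f n * b n \<le> dot f b" using that nnegD[OF K b(1)] by (intro dot_term_le) (auto simp: fpolar_def)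
    also have "\<dots> \<le> 1" using that b by (auto simp: fpolar_def)
    finally show ?thesis using b by (simp add: field_simps)
  qed
  then show ?thesis using that[of "1 / b n"] b by simp
qed

lemma fpolar_unit:
  assumes M: "\<And>b. b \<in> K \<Longrightarrow> b n \<le> M"
  obtains r where "0 < r" "unit n r \<in> fpolar K"
proof -
  define r where "r = 1 / (\<bar>M\<bar> + 1)"
  have "0 < r" by (simp add: r_def)
  moreover have "r * b n \<le> 1" if "b \<in> K" for b
    using M[OF that] by (simp add: r_def field_simps)
  ultimately show ?thesis using that[of r] by (auto simp: fpolar_def) (auto simp: unit_def)
qed

text \<open>Finitely supported sequences are continuous functions on \<open>K\<close> for the
  product topology, with values in [0, 1], so \<open>small_convex_combination\<close> applies; a
  combination that is at most \<delta> on \<open>K\<close> has norm at most \<delta>.\<close>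

lemma fpolar_small_comb:
  assumes K: "compact K" "nneg K" and null: "null_on K"
    and f: "disj_seq f" "\<And>j. f j \<in> fpolar K" and \<delta>: "0 < \<delta>"
  obtains J l where "finite J" "\<And>j. j \<in> J \<Longrightarrow> 0 \<le> l j" "sum l J = 1"
    "(\<lambda>n. (\<Sum>j\<in>J. l j * f j n) / \<delta>) \<in> fpolar K"
proof -
  obtain J l where J: "finite J" "\<And>j. j \<in> J \<Longrightarrow> 0 \<le> l j" "sum l J = 1"
    "\<And>b. b \<in> K \<Longrightarrow> (\<Sum>j\<in>J. l j * dot (f j) b) \<le> \<delta>"
  proof (rule small_convex_combination[OF K(1), where g = "\<lambda>j b. dot (f j) b" and e = \<delta>])
    show "continuous_on K (dot (f j))" for j
      unfolding dot_def by (intro continuous_intros continuous_on_subset[OF continuous_on_product_coordinates]) auto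
    show "0 \<le> dot (f j) b \<and> dot (f j) b \<le> 1" if "b \<in> K" for j b
      using f(2)[of j] nnegD[OF K(2) that] that by (auto simp: fpolar_def intro!: dot_nonneg)
    show "finite {j. \<eta> \<le> dot (f j) b}" if "b \<in> K" "0 < \<eta>" for b \<eta>
    proof (rule ccontr)
      let ?S = "{j. \<eta> \<le> dot (f j) b}"
      assume inf: "infinite ?S"
      have "disj_seq (\<lambda>j. f (enumerate ?S j))"
        using f(1) strict_mono_imp_inj_on[OF strict_mono_enumerate[OF inf]] by (rule disj_reindex)
      moreover have "\<forall>j. \<eta> \<le> dot (f (enumerate ?S j)) b"
        using enumerate_in_set[OF inf] by blast
      ultimately show False using null that f(2) unfolding null_on_def by blast
    qed
  qed (use \<delta> in auto)
  have "dot (\<lambda>n. (\<Sum>j\<in>J. l j * f j n) / \<delta>) b \<le> 1" if "b \<in> K" for b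
    using J(4)[OF that] \<delta> fpolarD(1)[OF f(2)] by (simp add: dot_divide fs_sum dot_sum)
  moreover have "(\<lambda>n. (\<Sum>j\<in>J. l j * f j n) / \<delta>) \<in> fs"
    using fpolarD(1)[OF f(2)] by (intro fs_divide fs_sum)
  ultimately have "(\<lambda>n. (\<Sum>j\<in>J. l j * f j n) / \<delta>) \<in> fpolar K"
    using J f(2) \<delta> by (auto simp: fpolar_def intro!: sum_nonneg divide_nonneg_nonneg)
  with J show ?thesis using that by blast
qed

lemma compact_box: "compact {g :: 'i \<Rightarrow> real. \<forall>n. lo n \<le> g n \<and> g n \<le> hi n}"
proof -
  have "compactin (product_topology (\<lambda>_. euclidean) UNIV) (PiE UNIV (\<lambda>n :: 'i. {lo n..hi n}))"
    by (subst compactin_PiE) auto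
  moreover have "PiE UNIV (\<lambda>n :: 'i. {lo n..hi n}) = {g. \<forall>n. lo n \<le> g n \<and> g n \<le> hi n}"
    by (auto simp: PiE_def Pi_def)
  ultimately show ?thesis by (simp add: euclidean_product_topology)
qed

lemma tendsto_coordinate:
  fixes f :: "'x \<Rightarrow> 'i \<Rightarrow> 'b::topological_space"
  assumes "(f \<longlongrightarrow> g) F" shows "((\<lambda>x. f x n) \<longlongrightarrow> g n) F"
  using continuous_on_tendsto_compose[OF continuous_on_product_coordinates assms] by simp

text \<open>The last two axioms are the two halves of James's criterion for the reflexivity of a
  space with an unconditional basis, phrased with disjoint blocks: the basis is shrinking and
  boundedly complete. As in \<open>null_on\<close>, subsequences turn the negated lower bounds into
  convergence.\<close>

locale solid_norm =
  fixes q :: "(nat \<Rightarrow> real) \<Rightarrow> real"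
  assumes q_add: "a \<in> fs \<Longrightarrow> b \<in> fs \<Longrightarrow> q (\<lambda>n. a n + b n) \<le> q a + q b"
    and q_scale: "a \<in> fs \<Longrightarrow> q (\<lambda>n. r * a n) = \<bar>r\<bar> * q a"
    and q_mono: "a \<in> fs \<Longrightarrow> (\<And>n. \<bar>b n\<bar> \<le> \<bar>a n\<bar>) \<Longrightarrow> q b \<le> q a"
    and q_pos: "a \<in> fs \<Longrightarrow> a n \<noteq> 0 \<Longrightarrow> 0 < q a"
    and shrinking: "(\<And>a. a \<in> fs \<Longrightarrow> dot a b \<le> q a) \<Longrightarrow> disj_seq y \<Longrightarrow> (\<And>j. y j \<in> fs) \<Longrightarrow> (\<And>j. q (y j) \<le> 1) \<Longrightarrow>
      0 < \<epsilon> \<Longrightarrow> \<not> (\<forall>j. \<epsilon> \<le> dot (y j) b)"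
    and boundedly_complete: "(\<And>S. finite S \<Longrightarrow> q (restr S a) \<le> 1) \<Longrightarrow> (\<And>j. finite ((S :: nat \<Rightarrow> nat set) j)) \<Longrightarrow>
      (\<And>j k. j \<noteq> k \<Longrightarrow> S j \<inter> S k = {}) \<Longrightarrow> 0 < \<epsilon> \<Longrightarrow> \<not> (\<forall>j. \<epsilon> \<le> q (restr (S j) a))"

text \<open>\<open>K1\<close> norms the shrinking factor of the product; \<open>K2\<close> norms the
  space with positive ball \<open>BG\<close>, whose dual is the boundedly complete factor.\<close>

locale null_pair =
  fixes K1 K2 :: "(nat \<Rightarrow> real) set"
  assumes compact1: "compact K1" and compact2: "compact K2"
    and nonneg1: "nneg K1" and nonneg2: "nneg K2"
    and pos1: "\<exists>b\<in>K1. 0 < b n" and pos2: "\<exists>b\<in>K2. 0 < b n"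
    and null1: "null_on K1" and null2: "null_on K2"
begin

abbreviation "BF \<equiv> fpolar K1"
abbreviation "BG \<equiv> fpolar K2"
abbreviation "BE \<equiv> fpolar BG"

text \<open>The ball of the Calderon product of the norms with unit balls \<open>BE\<close> and \<open>BF\<close>. The first norm
  is boundedly complete, the second one shrinking, and their product inherits both properties.\<close>

definition U :: "(nat \<Rightarrow> real) set"
  where "U = {y \<in> fs. \<exists>e\<in>BE. \<exists>f\<in>BF. \<forall>n. (y n)\<^sup>2 \<le> e n * f n}"

definition q :: "(nat \<Rightarrow> real) \<Rightarrow> real"
  where "q a = Inf {r. 0 < r \<and> (\<lambda>n. a n / r) \<in> U}"

lemma coord_bound:
  assumes "compact K" obtains M where "\<And>b :: nat \<Rightarrow> real. b \<in> K \<Longrightarrow> b n \<le> M"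
proof -
  have "compact ((\<lambda>b. b n) ` K)"
    by (intro compact_continuous_image assms continuous_on_subset[OF continuous_on_product_coordinates]) auto
  then have "bdd_above ((\<lambda>b. b n) ` K)" by (intro bounded_imp_bdd_above compact_imp_bounded)
  then show ?thesis using that by (auto simp: bdd_above_def)
qed

lemma unitF: obtains r where "0 < r" "unit n r \<in> BF"
proof -
  obtain M where "\<And>b. b \<in> K1 \<Longrightarrow> b n \<le> M" using coord_bound[OF compact1] by blast
  then show ?thesis using fpolar_unit that by blast
qed

lemma unitG: obtains r where "0 < r" "unit n r \<in> BG"
proof -
  obtain M where "\<And>b. b \<in> K2 \<Longrightarrow> b n \<le> M" using coord_bound[OF compact2] by blast
  then show ?thesis using fpolar_unit that by blast
qed

lemma unitE: obtains r where "0 < r" "unit n r \<in> BE"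
proof -
  obtain M where "\<And>b. b \<in> BG \<Longrightarrow> b n \<le> M" using fpolar_coord_bound[OF nonneg2 pos2] by metis
  then show ?thesis using fpolar_unit that by blast
qed

lemma nonnegG: "nneg BG" by (simp add: nneg_def fpolar_def)

lemma posG: "\<exists>b\<in>BG. 0 < b n"
proof -
  obtain r where "0 < r" "unit n r \<in> BG" by (rule unitG)
  then show ?thesis by (intro bexI[of _ "unit n r"]) (simp_all add: unit_def)
qed

lemma U_I: "y \<in> fs \<Longrightarrow> e \<in> BE \<Longrightarrow> f \<in> BF \<Longrightarrow> (\<And>n. (y n)\<^sup>2 \<le> e n * f n) \<Longrightarrow> y \<in> U"
  unfolding U_def by blast

lemma U_E:
  assumes "y \<in> U"
  obtains e f where "y \<in> fs" "e \<in> BE" "f \<in> BF" "\<And>n. (y n)\<^sup>2 \<le> e n * f n"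
    "\<And>n. 0 \<le> e n" "\<And>n. 0 \<le> f n"
  using assms fpolarD(2) unfolding U_def by blast

lemma U_solid:
  assumes "y \<in> U" "\<And>n. \<bar>z n\<bar> \<le> \<bar>y n\<bar>" shows "z \<in> U"
proof -
  obtain e f where ef: "y \<in> fs" "e \<in> BE" "f \<in> BF" "\<And>n. (y n)\<^sup>2 \<le> e n * f n"
    by (rule U_E[OF assms(1)]) (rule that)
  show ?thesis
  proof (rule U_I[OF _ ef(2,3)])
    show "z \<in> fs"
    proof (rule fs_mono[OF ef(1)])
      show "z n = 0" if "y n = 0" for n using assms(2)[of n] that by simp
    qed
    show "(z n)\<^sup>2 \<le> e n * f n" for n
      using assms(2)[of n] ef(4)[of n] by (meson abs_le_square_iff order_trans)
  qed
qed

text \<open>A Cauchy-Schwarz inequality: from \<open>a^2 <= e f\<close> and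
  \<open>b^2 <= e' f'\<close> the arithmetic-geometric mean inequality gives
  \<open>2 a b <= e f' + e' f\<close>, so convex combinations may be formed in both factors with the
  same weights.\<close>

lemma U_convex:
  assumes y: "y \<in> U" "y' \<in> U" and s: "0 \<le> s" "s \<le> 1"
  shows "(\<lambda>n. s * y n + (1 - s) * y' n) \<in> U"
proof -
  obtain e f where ef: "e \<in> BE" "f \<in> BF" "\<And>n. (y n)\<^sup>2 \<le> e n * f n" using y by (auto simp: U_def)
  obtain e' f' where ef': "e' \<in> BE" "f' \<in> BF" "\<And>n. (y' n)\<^sup>2 \<le> e' n * f' n" using y by (auto simp: U_def)
  have CS: "(s * a + t * b)\<^sup>2 \<le> (s * e + t * e') * (s * f + t * f')"
    if "a\<^sup>2 \<le> e * f" "b\<^sup>2 \<le> e' * f'" "0 \<le> e" "0 \<le> f" "0 \<le> e'" "0 \<le> f'" "0 \<le> s" "0 \<le> t"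
    for a b e f e' f' s t :: real
  proof -
    have 1: "a\<^sup>2 * b\<^sup>2 \<le> (e * f) * (e' * f')" using that by (intro mult_mono) auto
    have "(2 * (a * b))\<^sup>2 = 4 * (a\<^sup>2 * b\<^sup>2)" by (simp add: power2_eq_square)
    also have "\<dots> \<le> 4 * ((e * f') * (e' * f))" using 1 by (simp add: algebra_simps)
    also have "\<dots> \<le> (e * f' + e' * f)\<^sup>2" using zero_le_power2[of "e * f' - e' * f"]
      by (simp add: power2_eq_square algebra_simps)
    finally have 2: "2 * (a * b) \<le> e * f' + e' * f" by (rule power2_le_imp_le) (use that in auto)
    have "(s * a + t * b)\<^sup>2 = s\<^sup>2 * a\<^sup>2 + t\<^sup>2 * b\<^sup>2 + (s * t) * (2 * (a * b))"
      by (simp add: power2_eq_square algebra_simps)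
    also have "\<dots> \<le> s\<^sup>2 * (e * f) + t\<^sup>2 * (e' * f') + (s * t) * (e * f' + e' * f)"
      using that 2 by (intro add_mono mult_left_mono) auto
    also have "\<dots> = (s * e + t * e') * (s * f + t * f')" by (simp add: power2_eq_square algebra_simps)
    finally show ?thesis .
  qed
  have "(s * y n + (1 - s) * y' n)\<^sup>2 \<le> (s * e n + (1 - s) * e' n) * (s * f n + (1 - s) * f' n)" for n
    using s ef ef' fpolarD(2)[OF ef(1)] fpolarD(2)[OF ef(2)] fpolarD(2)[OF ef'(1)] fpolarD(2)[OF ef'(2)]
    by (intro CS) auto
  moreover have "(\<lambda>n. s * e n + (1 - s) * e' n) \<in> BE"
    by (rule fpolar_convex[OF nonnegG ef(1) ef'(1) s])
  moreover have "(\<lambda>n. s * f n + (1 - s) * f' n) \<in> BF"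
    by (rule fpolar_convex[OF nonneg1 ef(2) ef'(2) s])
  moreover have "(\<lambda>n. s * y n + (1 - s) * y' n) \<in> fs" using y by (intro fs_add fs_scale) (auto simp: U_def)
  ultimately show ?thesis by (intro U_I)
qed

lemma U_absorbing:
  assumes a: "a \<in> fs" obtains r where "0 < r" "(\<lambda>n. a n / r) \<in> U"
proof -
  have "\<forall>n. \<exists>r. 0 < r \<and> unit n r \<in> BE" using unitE by blast
  then obtain re where re: "\<And>n. 0 < re n" "\<And>n. unit n (re n) \<in> BE" by metis
  have "\<forall>n. \<exists>r. 0 < r \<and> unit n r \<in> BF" using unitF by blast
  then obtain rf where rf: "\<And>n. 0 < rf n" "\<And>n. unit n (rf n) \<in> BF" by metis
  \<comment> \<open>The added 1 keeps \<open>N\<close> positive for an empty support; weights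
    \<open>1 / N\<close> over the support sum to at most 1.\<close>
  define N :: real where "N = card (supp a) + 1"
  have N: "0 < N" by (simp add: N_def)
  have fin: "finite (supp a)" using a by (simp add: fs_def)
  have comb: "(\<Sum>m\<in>supp a. (1 / N) * unit m (c m) n) = (if n \<in> supp a then c n / N else 0)" for c n
    using fin by (simp add: unit_def if_distrib[of "\<lambda>x. _ * x"] cong: if_cong)
  have s1: "(\<Sum>m\<in>supp a. 1 / N) \<le> 1" by (simp add: N_def)
  \<comment> \<open>The summand 1 ensures \<open>r <= r^2\<close>, so that a bound by
    \<open>r\<close> yields the bound by \<open>r^2\<close> that the squared inequality asks
    for.\<close>
  define r where "r = 1 + (\<Sum>n\<in>supp a. (a n)\<^sup>2 * N\<^sup>2 / (re n * rf n))"
  have r1: "1 \<le> r" unfolding r_def using re(1) rf(1) by (simp add: sum_nonneg less_imp_le)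
  have "(\<lambda>n. \<Sum>m\<in>supp a. (1 / N) * unit m (re m) n) \<in> BE"
    using N s1 by (intro fpolar_comb nonnegG re) auto
  moreover have "(\<lambda>n. \<Sum>m\<in>supp a. (1 / N) * unit m (rf m) n) \<in> BF"
    using N s1 by (intro fpolar_comb nonneg1 rf) auto
  moreover have "(a n / r)\<^sup>2 \<le> (\<Sum>m\<in>supp a. (1 / N) * unit m (re m) n) * (\<Sum>m\<in>supp a. (1 / N) * unit m (rf m) n)" for n
  proof (cases "n \<in> supp a")
    case True
    have "(a n)\<^sup>2 * N\<^sup>2 / (re n * rf n) \<le> (\<Sum>n\<in>supp a. (a n)\<^sup>2 * N\<^sup>2 / (re n * rf n))"
      using True fin re(1) rf(1) by (intro member_le_sum) (auto simp: less_imp_le)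
    also have "\<dots> \<le> r" by (simp add: r_def)
    also have "r \<le> r\<^sup>2" using r1 by (simp add: power2_eq_square)
    finally have "(a n)\<^sup>2 * N\<^sup>2 \<le> r\<^sup>2 * (re n * rf n)" using re(1)[of n] rf(1)[of n] by (simp add: divide_le_eq)
    then have "(a n)\<^sup>2 / r\<^sup>2 \<le> (re n * rf n) / N\<^sup>2" using r1 N by (simp add: field_simps)
    then show ?thesis unfolding comb using True by (simp add: power2_eq_square)
  next
    case False
    then show ?thesis unfolding comb by (simp add: supp_def)
  qed
  moreover have "(\<lambda>n. a n / r) \<in> fs" by (rule fs_divide[OF a])
  ultimately have "(\<lambda>n. a n / r) \<in> U" by (intro U_I)
  then show ?thesis using r1 by (intro that[of r]) auto
qed

lemma U_bounded: obtains M where "0 < M" "\<And>y. y \<in> U \<Longrightarrow> \<bar>y n\<bar> \<le> M"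
proof -
  obtain M1 where M1: "0 < M1" "\<And>f. f \<in> BE \<Longrightarrow> f n \<le> M1" using fpolar_coord_bound[OF nonnegG posG] by metis
  obtain M2 where M2: "0 < M2" "\<And>f. f \<in> BF \<Longrightarrow> f n \<le> M2" using fpolar_coord_bound[OF nonneg1 pos1] by metis
  have "\<bar>y n\<bar> \<le> sqrt (M1 * M2)" if y: "y \<in> U" for y
  proof -
    obtain e f where ef: "e \<in> BE" "f \<in> BF" "(y n)\<^sup>2 \<le> e n * f n" using y by (auto simp: U_def)
    then have "(y n)\<^sup>2 \<le> M1 * M2"
      using M1 M2 fpolarD(2)[OF ef(2)] by (intro order_trans[OF ef(3)] mult_mono) auto
    then show ?thesis using real_le_rsqrt by fastforce
  qed
  then show ?thesis using that[of "sqrt (M1 * M2)"] M1 M2 by simp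
qed

lemma q_bdd: "bdd_below {r. 0 < r \<and> (\<lambda>n. a n / r) \<in> U}"
  by (rule bdd_belowI[of _ 0]) auto

lemma q_le: "0 < r \<Longrightarrow> (\<lambda>n. a n / r) \<in> U \<Longrightarrow> q a \<le> r"
  unfolding q_def by (intro cInf_lower q_bdd) auto

lemma q_ne: "a \<in> fs \<Longrightarrow> {r. 0 < r \<and> (\<lambda>n. a n / r) \<in> U} \<noteq> {}"
  using U_absorbing by blast

lemma q_nonneg: "a \<in> fs \<Longrightarrow> 0 \<le> q a"
  unfolding q_def by (intro cInf_greatest q_ne) auto

lemma q_less: assumes a: "a \<in> fs" and r: "q a < r" shows "(\<lambda>n. a n / r) \<in> U"
proof -
  obtain s where s: "0 < s" "(\<lambda>n. a n / s) \<in> U" "s < r"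
    using cInf_lessD[OF q_ne[OF a]] r unfolding q_def by blast
  then show ?thesis by (intro U_solid[OF s(2)]) (auto simp: frac_le)
qed

lemma q_mono': assumes a: "a \<in> fs" and b: "\<And>n. \<bar>b n\<bar> \<le> \<bar>a n\<bar>" shows "q b \<le> q a"
proof (rule dense_ge)
  fix r assume r: "q a < r"
  then have "0 < r" using q_nonneg[OF a] by simp
  moreover have "(\<lambda>n. b n / r) \<in> U"
    using calculation b by (intro U_solid[OF q_less[OF a r]]) (auto simp: divide_right_mono)
  ultimately show "q b \<le> r" by (rule q_le)
qed

lemma q_add': assumes a: "a \<in> fs" "b \<in> fs" shows "q (\<lambda>n. a n + b n) \<le> q a + q b"
proof (rule field_le_epsilon)
  fix e :: real assume e: "0 < e"
  define r s where "r = q a + e/2" and "s = q b + e/2"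
  have rs: "0 < r" "0 < s" using q_nonneg[OF a(1)] q_nonneg[OF a(2)] e by (auto simp: r_def s_def)
  have "(\<lambda>n. (r / (r + s)) * (a n / r) + (1 - r / (r + s)) * (b n / s)) \<in> U"
    using rs e by (intro U_convex q_less a) (auto simp: r_def s_def)
  also have "(\<lambda>n. (r / (r + s)) * (a n / r) + (1 - r / (r + s)) * (b n / s)) = (\<lambda>n. (a n + b n) / (r + s))"
  proof
    fix n
    have "1 - r / (r + s) = s / (r + s)" using rs by (simp add: field_simps)
    then show "(r / (r + s)) * (a n / r) + (1 - r / (r + s)) * (b n / s) = (a n + b n) / (r + s)"
      using rs by (simp add: add_divide_distrib)
  qed
  finally show "q (\<lambda>n. a n + b n) \<le> q a + q b + e" using rs q_le[of "r + s" "\<lambda>n. a n + b n"] by (simp add: r_def s_def)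
qed

lemma q_scale': assumes a: "a \<in> fs" shows "q (\<lambda>n. r * a n) = \<bar>r\<bar> * q a"
proof -
  have le: "q (\<lambda>n. r * a n) \<le> \<bar>r\<bar> * q a" if a: "a \<in> fs" and r: "r \<noteq> 0" for a r
  proof (rule field_le_epsilon)
    fix e :: real assume e: "0 < e"
    define s where "s = q a + e / \<bar>r\<bar>"
    have s: "q a < s" "0 < s" using e r q_nonneg[OF a] by (auto simp: s_def intro: add_nonneg_pos)
    have "(\<lambda>n. (r * a n) / (\<bar>r\<bar> * s)) \<in> U"
      using r s by (intro U_solid[OF q_less[OF a s(1)]]) (auto simp: abs_mult)
    then have "q (\<lambda>n. r * a n) \<le> \<bar>r\<bar> * s" using r s by (intro q_le) auto
    also have "\<dots> = \<bar>r\<bar> * q a + e" using r by (simp add: s_def algebra_simps)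
    finally show "q (\<lambda>n. r * a n) \<le> \<bar>r\<bar> * q a + e" .
  qed
  show ?thesis
  proof (cases "r = 0")
    case True
    have "q (\<lambda>n. 0) \<le> 0"
    proof (rule dense_ge)
      fix r :: real assume "0 < r"
      moreover have "(\<lambda>n. 0 / r) \<in> U" using U_absorbing[of "\<lambda>_. 0"] by auto
      ultimately show "q (\<lambda>n. 0) \<le> r" using q_le[of r "\<lambda>_. 0"] by simp
    qed
    then show ?thesis using True q_nonneg[of "\<lambda>_. 0"] by simp
  next
    case False
    have "q (\<lambda>n. inverse r * (r * a n)) \<le> \<bar>inverse r\<bar> * q (\<lambda>n. r * a n)"
      using False by (intro le fs_scale a) auto
    moreover have "(\<lambda>n. inverse r * (r * a n)) = a" using False by auto
    ultimately have "\<bar>r\<bar> * q a \<le> q (\<lambda>n. r * a n)" using False by (simp add: field_simps)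
    then show ?thesis using le[OF a False] by simp
  qed
qed

lemma q_pos': assumes a: "a \<in> fs" "a n \<noteq> 0" shows "0 < q a"
proof -
  obtain M where M: "0 < M" "\<And>y. y \<in> U \<Longrightarrow> \<bar>y n\<bar> \<le> M" using U_bounded by blast
  have "\<bar>a n\<bar> / M \<le> r" if "q a < r" for r
  proof -
    have "0 < r" using that q_nonneg[OF a(1)] by simp
    then show ?thesis using M(2)[OF q_less[OF a(1) that]] M(1) by (simp add: field_simps)
  qed
  then have "\<bar>a n\<bar> / M \<le> q a" by (rule dense_ge)
  moreover have "0 < \<bar>a n\<bar> / M" using a M by simp
  ultimately show ?thesis by linarith
qed


text \<open>Factor each \<open>y j\<close> through the two balls. Some convex combination of the
  second factors has norm at most \<delta> in \<open>F\<close>, and the same combination of the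
  first factors stays in the ball of \<open>E\<close>. So this combination of the \<open>y j\<close>
  has norm at most a multiple of \<open>sqrt \<delta>\<close>, while its pairing with
  \<open>b\<close> stays bounded below.\<close>

lemma shrinking':
  assumes b: "\<And>a. a \<in> fs \<Longrightarrow> dot a b \<le> q a" and y: "disj_seq y" "\<And>j. y j \<in> fs" "\<And>j. q (y j) \<le> 1"
    and \<epsilon>: "0 < \<epsilon>" and all: "\<forall>j. \<epsilon> \<le> dot (y j) b"
  shows False
proof -
  \<comment> \<open>Halving makes the norm strictly smaller than 1, which \<open>q_less\<close>
    needs for membership in \<open>U\<close>.\<close>
  define z where "z j n = y j n / 2" for j n
  have zU: "z j \<in> U" for j
    unfolding z_def[abs_def] using y(3)[of j] by (intro q_less y) auto
  have zfs: "z j \<in> fs" for j unfolding z_def[abs_def] by (intro fs_divide y)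
  have "\<forall>j. \<exists>e f. e \<in> BE \<and> f \<in> BF \<and> (\<forall>n. (z j n)\<^sup>2 \<le> e n * f n)"
    using zU unfolding U_def by blast
  then obtain e0 f0 where ef0: "\<And>j. e0 j \<in> BE" "\<And>j. f0 j \<in> BF" "\<And>j n. (z j n)\<^sup>2 \<le> e0 j n * f0 j n" by metis
  define e where "e j = restr (supp (y j)) (e0 j)" for j
  define f where "f j = restr (supp (y j)) (f0 j)" for j
  have e: "e j \<in> BE" for j
    using ef0(1)[of j] fpolarD(2)[OF ef0(1)]
    by (intro fpolar_solid[OF nonnegG ef0(1)]) (auto simp: e_def restr_def)
  have f: "f j \<in> BF" for j
    using ef0(2)[of j] fpolarD(2)[OF ef0(2)]
    by (intro fpolar_solid[OF nonneg1 ef0(2)]) (auto simp: f_def restr_def)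
  have ef: "(z j n)\<^sup>2 \<le> e j n * f j n" for j n
    using ef0(3)[of j n] by (auto simp: e_def f_def restr_def supp_def z_def)
  have zero: "e j n = 0 \<and> f j n = 0 \<and> z j n = 0" if "y j n = 0" for j n
    using that by (auto simp: e_def f_def restr_def supp_def z_def)
  have "disj_seq f" by (rule disj_smaller[OF y(1)]) (simp add: zero)
  \<comment> \<open>The combination will have norm at most
    \<open>sqrt \<delta> = \<epsilon> / 4\<close>, below its pairing with \<open>b\<close>, which is
    at least \<open>\<epsilon> / 2\<close>.\<close>
  define \<delta> where "\<delta> = (\<epsilon> / 4)\<^sup>2"
  have \<delta>: "0 < \<delta>" "sqrt \<delta> = \<epsilon> / 4" using \<epsilon> by (auto simp: \<delta>_def)
  obtain J l where J: "finite J" "\<And>j. j \<in> J \<Longrightarrow> 0 \<le> l j" "sum l J = 1"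
    and h: "(\<lambda>n. (\<Sum>j\<in>J. l j * f j n) / \<delta>) \<in> BF"
    using fpolar_small_comb[OF compact1 nonneg1 null1 \<open>disj_seq f\<close> f \<delta>(1)] by metis
  define Y where "Y n = (\<Sum>j\<in>J. l j * z j n)" for n
  have Yfs: "Y \<in> fs" unfolding Y_def[abs_def] by (intro fs_sum zfs)
  have "(\<lambda>n. Y n / sqrt \<delta>) \<in> U"
  proof (rule U_I[OF fs_divide[OF Yfs] _ h])
    show "(\<lambda>n. \<Sum>j\<in>J. l j * e j n) \<in> BE" using J e by (intro fpolar_comb nonnegG) auto
    fix n
    \<comment> \<open>At each coordinate at most one of the sequences is nonzero. The combinations
      thus reduce to one term there, and the square of \<open>l j0\<close> splits evenly between the
      two factors.\<close>
    obtain j0 where j0: "\<And>j. j \<noteq> j0 \<Longrightarrow> y j n = 0" using y(1) unfolding disj_seq_def by metis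
    have single: "(\<Sum>j\<in>J. l j * g j) = (if j0 \<in> J then l j0 * g j0 else 0)"
      if "\<And>j. y j n = 0 \<Longrightarrow> g j = 0" for g
    proof -
      have "(\<Sum>j\<in>J. l j * g j) = (\<Sum>j\<in>J. if j = j0 then l j0 * g j0 else 0)"
        using j0 that by (intro sum.cong) auto
      then show ?thesis using J(1) by simp
    qed
    have 1: "Y n = (if j0 \<in> J then l j0 * z j0 n else 0)" unfolding Y_def using zero by (intro single) auto
    have 2: "(\<Sum>j\<in>J. l j * e j n) = (if j0 \<in> J then l j0 * e j0 n else 0)" using zero by (intro single) auto
    have 3: "(\<Sum>j\<in>J. l j * f j n) = (if j0 \<in> J then l j0 * f j0 n else 0)" using zero by (intro single) auto
    have "(l j0)\<^sup>2 * (z j0 n)\<^sup>2 \<le> (l j0)\<^sup>2 * (e j0 n * f j0 n)" by (intro mult_left_mono ef) auto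
    then have "(Y n)\<^sup>2 \<le> (\<Sum>j\<in>J. l j * e j n) * (\<Sum>j\<in>J. l j * f j n)"
      unfolding 1 2 3 by (auto simp: power2_eq_square algebra_simps)
    then have "(Y n)\<^sup>2 / \<delta> \<le> (\<Sum>j\<in>J. l j * e j n) * (\<Sum>j\<in>J. l j * f j n) / \<delta>"
      using \<delta> by (intro divide_right_mono) auto
    then show "(Y n / sqrt \<delta>)\<^sup>2 \<le> (\<Sum>j\<in>J. l j * e j n) * ((\<Sum>j\<in>J. l j * f j n) / \<delta>)"
      using \<delta>(1) by (simp add: power_divide)
  qed
  then have "q Y \<le> \<epsilon> / 4" using q_le[of "sqrt \<delta>" Y] \<delta> \<epsilon> by simp
  moreover have "\<epsilon> / 2 \<le> dot Y b"
  proof -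
    have "(\<Sum>j\<in>J. l j * (\<epsilon> / 2)) \<le> (\<Sum>j\<in>J. l j * dot (z j) b)"
      using J all y(2) unfolding z_def[abs_def]
      by (intro sum_mono mult_left_mono) (auto simp: dot_divide)
    also have "\<dots> = dot Y b" unfolding Y_def[abs_def] by (rule dot_sum[symmetric]) (rule zfs)
    finally show ?thesis unfolding sum_distrib_right[symmetric] J(3) by simp
  qed
  ultimately show False using b[OF Yfs] \<epsilon> by linarith
qed

text \<open>By compactness of boxes the factorizations of the truncations of \<open>a\<close>
  converge along a subsequence to a pair \<open>e'\<close>, \<open>f'\<close> that factors
  \<open>a / 2\<close> itself. Some block of \<open>e'\<close> is small in \<open>E\<close>, because
  disjoint norming functionals in \<open>BG\<close> have small convex combinations; the blocks of
  \<open>f'\<close> stay in the ball of \<open>F\<close>, so the block of \<open>a\<close> is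
  small.\<close>

lemma boundedly_complete':
  fixes S :: "nat \<Rightarrow> nat set"
  assumes fin: "\<And>S. finite S \<Longrightarrow> q (restr S a) \<le> 1" and S: "\<And>j. finite (S j)"
    and disjS: "\<And>j k. j \<noteq> k \<Longrightarrow> S j \<inter> S k = {}"
    and \<epsilon>: "0 < \<epsilon>" and all: "\<forall>j. \<epsilon> \<le> q (restr (S j) a)"
  shows False
proof -
  have "(\<lambda>n. restr {..<m} a n / 2) \<in> U" for m
    using fin[of "{..<m}"] by (intro q_less) auto
  then have "\<forall>m. \<exists>e f. e \<in> BE \<and> f \<in> BF \<and> (\<forall>n. (restr {..<m} a n / 2)\<^sup>2 \<le> e n * f n)"
    unfolding U_def by blast
  then obtain e f where e: "\<And>m. e m \<in> BE" and f: "\<And>m. f m \<in> BF"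
    and ef: "\<And>m n. (restr {..<m} a n / 2)\<^sup>2 \<le> e m n * f m n" by metis
  have "\<forall>n. \<exists>M>0. \<forall>g\<in>BE. g n \<le> M" using fpolar_coord_bound[OF nonnegG posG] by metis
  then obtain M1 where M1: "\<And>n g. g \<in> BE \<Longrightarrow> g n \<le> M1 n" by metis
  have "\<forall>n. \<exists>M>0. \<forall>g\<in>BF. g n \<le> M" using fpolar_coord_bound[OF nonneg1 pos1] by metis
  then obtain M2 where M2: "\<And>n g. g \<in> BF \<Longrightarrow> g n \<le> M2 n" by metis
  have "seq_compact {g :: nat \<Rightarrow> real. \<forall>n. 0 \<le> g n \<and> g n \<le> M1 n}"
    by (intro compact_imp_seq_compact compact_box)
  then obtain e' r1 where r1: "strict_mono r1" and e1: "(\<lambda>m. e (r1 m)) \<longlonglongrightarrow> e'"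
    using M1[OF e] fpolarD(2)[OF e] unfolding seq_compact_def o_def
    by (elim allE[of _ e]) auto
  have "seq_compact {g :: nat \<Rightarrow> real. \<forall>n. 0 \<le> g n \<and> g n \<le> M2 n}"
    by (intro compact_imp_seq_compact compact_box)
  then obtain f' r2 where r2: "strict_mono r2" and f1: "(\<lambda>m. f (r1 (r2 m))) \<longlonglongrightarrow> f'"
    using M2[OF f] fpolarD(2)[OF f] unfolding seq_compact_def o_def
    by (elim allE[of _ "\<lambda>m. f (r1 m)"]) auto
  define r where "r m = r1 (r2 m)" for m
  have r: "strict_mono r" using r1 r2 by (auto simp: r_def strict_mono_def)
  have elim: "(\<lambda>m. e (r m) n) \<longlonglongrightarrow> e' n" for n
    using LIMSEQ_subseq_LIMSEQ[OF tendsto_coordinate[OF e1] r2, of n] by (simp add: o_def r_def)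
  have flim: "(\<lambda>m. f (r m) n) \<longlonglongrightarrow> f' n" for n
    using tendsto_coordinate[OF f1, of n] by (simp add: r_def)
  \<comment> \<open>A coordinatewise limit may have infinite support, so only its finite
    restrictions can be claimed to lie in the ball.\<close>
  have polar_lim: "restr T g' \<in> fpolar K"
    if K: "nneg K" and g: "\<And>m. g m \<in> fpolar K" "\<And>n. (\<lambda>m. g m n) \<longlonglongrightarrow> g' n" and T: "finite T" for g g' K T
  proof -
    have "0 \<le> g' n" for n using g(2)[of n] fpolarD(2)[OF g(1)] by (intro LIMSEQ_le_const) auto
    moreover have "dot (restr T g') b \<le> 1" if b: "b \<in> K" for b
    proof -
      have lim: "(\<lambda>m. \<Sum>n\<in>T. g m n * b n) \<longlonglongrightarrow> (\<Sum>n\<in>T. g' n * b n)" by (intro tendsto_intros g)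
      have "(\<Sum>n\<in>T. g m n * b n) \<le> 1" for m
      proof -
        have "dot (restr T (g m)) b \<le> dot (g m) b"
          using fpolarD(1,2)[OF g(1)[of m]] nnegD[OF K b]
          by (intro dot_mono) (auto simp: restr_def)
        also have "\<dots> \<le> 1" using fpolarD(3)[OF g(1) b] .
        finally show ?thesis using T by (simp add: dot_restr)
      qed
      then have "(\<Sum>n\<in>T. g' n * b n) \<le> 1" by (intro LIMSEQ_le_const2[OF lim]) auto
      then show ?thesis using T by (simp add: dot_restr)
    qed
    ultimately show ?thesis using restr_fs[OF T, of g'] by (auto simp: fpolar_def) (simp add: restr_def)
  qed
  have e'B: "restr T e' \<in> BE" if "finite T" for T
    by (rule polar_lim[OF nonnegG e elim that])
  have f'B: "restr T f' \<in> BF" if "finite T" for T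
    by (rule polar_lim[OF nonneg1 f flim that])
  have a_le: "(a n / 2)\<^sup>2 \<le> e' n * f' n" for n
  proof (rule LIMSEQ_le_const)
    show "(\<lambda>m. e (r m) n * f (r m) n) \<longlonglongrightarrow> e' n * f' n" by (intro tendsto_intros elim flim)
    show "\<exists>N. \<forall>m\<ge>N. (a n / 2)\<^sup>2 \<le> e (r m) n * f (r m) n"
    proof (intro exI allI impI)
      fix m assume "m \<ge> Suc n"
      then have "n < r m" using strict_mono_imp_increasing[OF r, of m] by simp
      then show "(a n / 2)\<^sup>2 \<le> e (r m) n * f (r m) n" using ef[where m = "r m" and n = n] by (simp add: restr_def)
    qed
  qed
  have e'0: "0 \<le> e' n" for n using fpolarD(2)[OF e'B[of "{n}"], of n] by (simp add: restr_def)
  define \<delta> where "\<delta> = (\<epsilon> / 4)\<^sup>2"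
  have \<delta>: "0 < \<delta>" "sqrt \<delta> = \<epsilon> / 4" using \<epsilon> by (auto simp: \<delta>_def)
  \<comment> \<open>Otherwise every block of \<open>e'\<close> pairs to more than \<delta> with some
    member of \<open>BG\<close>. Cut down to the blocks, these members have a convex combination of
    norm at most \<open>\<delta> / 2\<close>, yet its pairing with \<open>e'\<close> is at least
    \<delta>.\<close>
  have "\<exists>j. \<forall>b\<in>BG. dot (restr (S j) e') b \<le> \<delta>"
  proof (rule ccontr)
    assume "\<not> ?thesis"
    then have "\<forall>j. \<exists>b\<in>BG. \<delta> < dot (restr (S j) e') b" by (meson not_le)
    then obtain b0 where b0: "\<And>j. b0 j \<in> BG" "\<And>j. \<delta> < dot (restr (S j) e') (b0 j)" by metis
    define b where "b j = restr (S j) (b0 j)" for j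
    have b: "b j \<in> BG" for j
      using fpolarD(2)[OF b0(1)] by (intro fpolar_solid[OF nonneg2 b0(1)]) (auto simp: b_def restr_def)
    have "disj_seq b" unfolding disj_seq_def b_def restr_def using disjS by (auto simp: disjoint_iff)
    from fpolar_small_comb[OF compact2 nonneg2 null2 this b half_gt_zero[OF \<delta>(1)]]
    obtain J l where J: "finite J" "\<And>j. j \<in> J \<Longrightarrow> 0 \<le> l j" "sum l J = 1"
      and h: "(\<lambda>n. (\<Sum>j\<in>J. l j * b j n) / (\<delta> / 2)) \<in> BG"
      by blast
    define T where "T = (\<Union>j\<in>J. S j)"
    have T: "finite T" using J S by (auto simp: T_def)
    have "1 \<ge> dot (restr T e') (\<lambda>n. (\<Sum>j\<in>J. l j * b j n) / (\<delta> / 2))"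
      using fpolarD(3)[OF e'B[OF T] h] .
    also have "dot (restr T e') (\<lambda>n. (\<Sum>j\<in>J. l j * b j n) / (\<delta> / 2)) = (\<Sum>n\<in>T. \<Sum>j\<in>J. l j * (e' n * b j n)) / (\<delta> / 2)"
      unfolding dot_restr[OF T] sum_divide_distrib[symmetric] times_divide_eq_right
      by (simp add: sum_distrib_left sum_divide_distrib algebra_simps)
    also have "(\<Sum>n\<in>T. \<Sum>j\<in>J. l j * (e' n * b j n)) = (\<Sum>j\<in>J. l j * (\<Sum>n\<in>T. e' n * b j n))"
      unfolding sum_distrib_left by (rule sum.swap)
    also have "\<dots> = (\<Sum>j\<in>J. l j * dot (restr (S j) e') (b0 j))"
    proof (rule sum.cong[OF refl])
      fix j assume j: "j \<in> J"
      have "(\<Sum>n\<in>T. e' n * b j n) = (\<Sum>n\<in>S j. e' n * b0 j n)"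
        using T j by (intro sum.mono_neutral_cong_right) (auto simp: T_def b_def restr_def)
      then show "l j * (\<Sum>n\<in>T. e' n * b j n) = l j * dot (restr (S j) e') (b0 j)"
        using S by (simp add: dot_restr)
    qed
    finally have "(\<Sum>j\<in>J. l j * dot (restr (S j) e') (b0 j)) \<le> \<delta> / 2" using \<delta> by (simp add: field_simps)
    moreover have "(\<Sum>j\<in>J. l j * \<delta>) \<le> (\<Sum>j\<in>J. l j * dot (restr (S j) e') (b0 j))"
      using J(2) b0(2) by (intro sum_mono mult_left_mono) (auto intro: less_imp_le)
    ultimately show False using J(3) \<delta> by (simp add: sum_distrib_right[symmetric])
  qed
  then obtain j where j: "\<And>b. b \<in> BG \<Longrightarrow> dot (restr (S j) e') b \<le> \<delta>" by blast
  have eB: "(\<lambda>n. restr (S j) e' n / \<delta>) \<in> BE"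
  proof -
    have "dot (\<lambda>n. restr (S j) e' n / \<delta>) b \<le> 1" if "b \<in> BG" for b
      using j[OF that] S \<delta> by (subst dot_divide) auto
    moreover have "0 \<le> restr (S j) e' n / \<delta>" for n using e'0 \<delta> by (simp add: restr_def)
    ultimately show ?thesis using fs_divide[OF restr_fs[OF S]] by (simp add: fpolar_def)
  qed
  have "(\<lambda>n. restr (S j) a n / (2 * sqrt \<delta>)) \<in> U"
  proof (rule U_I[OF fs_divide[OF restr_fs[OF S]] eB f'B[OF S]])
    fix n
    have "(a n / 2)\<^sup>2 / \<delta> \<le> e' n * f' n / \<delta>" using a_le[of n] \<delta> by (intro divide_right_mono) auto
    moreover have "(a n / (2 * sqrt \<delta>))\<^sup>2 = (a n / 2)\<^sup>2 / \<delta>"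
      using \<delta>(1) by (simp add: power_divide power_mult_distrib)
    ultimately show "(restr (S j) a n / (2 * sqrt \<delta>))\<^sup>2 \<le> restr (S j) e' n / \<delta> * restr (S j) f' n"
      by (simp add: restr_def)
  qed
  then have "q (restr (S j) a) \<le> 2 * sqrt \<delta>" using \<delta> by (intro q_le) auto
  then show False using all[rule_format, of j] \<delta>(2) \<epsilon> by simp
qed

sublocale solid_norm q
proof
  show "q (\<lambda>n. a n + b n) \<le> q a + q b" if "a \<in> fs" "b \<in> fs" for a b by (rule q_add'[OF that])
  show "q (\<lambda>n. r * a n) = \<bar>r\<bar> * q a" if "a \<in> fs" for a r by (rule q_scale'[OF that])
  show "q b \<le> q a" if "a \<in> fs" "\<And>n. \<bar>b n\<bar> \<le> \<bar>a n\<bar>" for a b by (rule q_mono'[OF that])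
  show "0 < q a" if "a \<in> fs" "a n \<noteq> 0" for a n by (rule q_pos'[OF that])
  show "\<not> (\<forall>j. \<epsilon> \<le> dot (y j) b)"
    if "\<And>a. a \<in> fs \<Longrightarrow> dot a b \<le> q a" "disj_seq y" "\<And>j. y j \<in> fs" "\<And>j. q (y j) \<le> 1" "0 < \<epsilon>" for b y \<epsilon>
    by (rule notI) (rule shrinking'[OF that])
  show "\<not> (\<forall>j. \<epsilon> \<le> q (restr (S j) a))"
    if "\<And>S. finite S \<Longrightarrow> q (restr S a) \<le> 1" "\<And>j. finite (S j)" "\<And>j k. j \<noteq> k \<Longrightarrow> S j \<inter> S k = {}" "0 < \<epsilon>"
    for a \<epsilon> and S :: "nat \<Rightarrow> nat set"
    by (rule notI) (rule boundedly_complete'[OF that])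
qed

end

section \<open>Families of norms on cliques\<close>

lemma dot_commute: "a \<in> fs \<Longrightarrow> b \<in> fs \<Longrightarrow> dot a b = dot b a"
  by (subst (1 2) dot_eq[of "supp a \<union> supp b"]) (auto simp: fs_def mult.commute)

text \<open>Otherwise every term is nonzero somewhere in \<open>C\<close>, and by disjointness
  different terms at different points.\<close>

lemma disj_seq_avoids_finite:
  assumes f: "disj_seq f" and C: "finite C"
  obtains j where "\<And>n. n \<in> C \<Longrightarrow> f j n = 0"
proof -
  have "\<exists>j. \<forall>n\<in>C. f j n = 0"
  proof (rule ccontr)
    assume "\<not> ?thesis"
    then obtain n where n: "\<And>j. n j \<in> C" "\<And>j. f j (n j) \<noteq> 0" by metis
    have "inj n" using n(2) f unfolding disj_seq_def inj_def by metis
    then show False using finite_subset[of "range n" C] n(1) C finite_imageD by blast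
  qed
  then show ?thesis using that by blast
qed

definition clique :: "(nat \<Rightarrow> nat \<Rightarrow> bool) \<Rightarrow> nat set \<Rightarrow> bool"
  where "clique cmp C \<longleftrightarrow> (\<forall>m\<in>C. \<forall>n\<in>C. cmp m n)"

text \<open>The positive part of the ball of the norm that takes the supremum over \<open>p\<close>
  of the sums of \<open>|a n| * u n p\<close>: the points of the Cantor set act as positive
  functionals.\<close>

definition weight_ball :: "(nat \<Rightarrow> C2N) \<Rightarrow> (nat \<Rightarrow> real) set"
  where "weight_ball u = fpolar (range (\<lambda>p n. u n p))"

text \<open>The last two assumptions say that on each infinite clique the weight norm is boundedly
  complete and shrinking. A finite clique is avoided by some term of every disjoint
  sequence.\<close>

locale clique_family =
  fixes u :: "nat \<Rightarrow> C2N" and cmp :: "nat \<Rightarrow> nat \<Rightarrow> bool"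
  assumes u_nonneg: "0 \<le> u n p" and u_nonzero: "u n \<noteq> 0" and cmp_refl: "cmp n n"
    and clique_bc: "\<lbrakk>infinite C; clique cmp C; \<And>n. 0 \<le> a n; supp a \<subseteq> C; \<And>S. finite S \<Longrightarrow> restr S a \<in> weight_ball u;
      \<And>j :: nat. finite (S j); \<And>j k. j \<noteq> k \<Longrightarrow> S j \<inter> S k = {}; 0 < \<epsilon>\<rbrakk>
      \<Longrightarrow> \<exists>j. \<forall>p. (\<Sum>n\<in>S j. a n * u n p) \<le> \<epsilon>"
    and clique_sh: "\<lbrakk>infinite C; clique cmp C; \<And>n. 0 \<le> b n; supp b \<subseteq> C; \<And>a. a \<in> weight_ball u \<Longrightarrow> dot a b \<le> 1;
      disj_seq f; \<And>j. f j \<in> weight_ball u; \<And>j. supp (f j) \<subseteq> C; 0 < \<epsilon>\<rbrakk>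
      \<Longrightarrow> \<exists>j. dot (f j) b < \<epsilon>"
begin

lemma u_le: "u n p \<le> norm (u n)"
  using norm_bounded[of "u n" p] u_nonneg[of n p] by simp

lemma u_pos: "\<exists>p. 0 < u n p"
proof (rule ccontr)
  assume "\<not> ?thesis"
  then have "u n p = 0" for p using u_nonneg[of n p] by (simp add: order.antisym not_less)
  then have "u n = 0" by (intro bcontfun_eqI) simp
  then show False using u_nonzero by simp
qed

text \<open>The nonnegative elements of the unit balls of the biduals (\<open>K2\<close>) and of the duals (\<open>K1\<close>) of the
  clique norms.\<close>

definition K2 :: "(nat \<Rightarrow> real) set"
  where "K2 = {a. (\<forall>n. 0 \<le> a n) \<and> clique cmp (supp a) \<and> (\<forall>S. finite S \<longrightarrow> restr S a \<in> weight_ball u)}"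

definition K1 :: "(nat \<Rightarrow> real) set"
  where "K1 = {b. (\<forall>n. 0 \<le> b n) \<and> clique cmp (supp b) \<and> (\<forall>a\<in>weight_ball u. dot a b \<le> 1)}"

lemma nneg_u: "nneg (range (\<lambda>p n. u n p))"
  using u_nonneg by (auto simp: nneg_def)

lemma weight_ball_iff: "a \<in> weight_ball u \<longleftrightarrow> a \<in> fs \<and> (\<forall>n. 0 \<le> a n) \<and> (\<forall>p. dot a (\<lambda>n. u n p) \<le> 1)"
  by (auto simp: weight_ball_def fpolar_def)

lemma weight_ball_solid: "a \<in> weight_ball u \<Longrightarrow> (\<And>n. 0 \<le> b n) \<Longrightarrow> (\<And>n. b n \<le> a n) \<Longrightarrow> b \<in> weight_ball u"
  unfolding weight_ball_def by (rule fpolar_solid[OF nneg_u])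

lemma restr_weight_ball_iff:
  "finite S \<Longrightarrow> (\<And>n. 0 \<le> a n) \<Longrightarrow> restr S a \<in> weight_ball u \<longleftrightarrow> (\<forall>p. (\<Sum>n\<in>S. a n * u n p) \<le> 1)"
  by (simp add: weight_ball_iff dot_restr) (simp add: restr_def)

lemma unit_weight_ball: "unit n (1 / norm (u n)) \<in> weight_ball u"
  using u_le[of n] u_nonzero by (simp add: weight_ball_iff field_simps) (simp add: unit_def)

lemma continuous_coordinate: "continuous_on A (\<lambda>a :: nat \<Rightarrow> real. a n)"
  by (rule continuous_on_subset[OF continuous_on_product_coordinates]) simp

lemma closed_nonneg: "closed {a :: nat \<Rightarrow> real. \<forall>n. 0 \<le> a n}"
  by (intro closed_Collect_all closed_Collect_le continuous_on_const continuous_coordinate)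

lemma clique_closed: "closed {a. clique cmp (supp a)}"
proof -
  \<comment> \<open>Having a clique as support is a condition on pairs of coordinates, hence closed;
    this is what makes \<open>K1\<close> and \<open>K2\<close> compact.\<close>
  have "{a. clique cmp (supp a)} = {a. \<forall>m n. cmp m n \<or> a m * a n = (0::real)}"
    by (auto simp: clique_def supp_def)
  moreover have "closed \<dots>"
    by (intro closed_Collect_all closed_Collect_disj closed_Collect_const closed_Collect_eq continuous_on_mult
        continuous_on_const continuous_coordinate)
  ultimately show ?thesis by simp
qed

text \<open>A point where \<open>u n\<close> is positive bounds coordinate \<open>n\<close>; what
  remains are closed conditions on finitely many coordinates inside a box.\<close>

lemma compact_K2: "compact K2"
proof -
  have "\<forall>n. \<exists>p. 0 < u n p" using u_pos by blast
  then obtain p where p: "\<And>n. 0 < u n (p n)" by metis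
  have "K2 = {a. \<forall>n. 0 \<le> a n \<and> a n \<le> 1 / u n (p n)} \<inter>
      ({a. \<forall>n. 0 \<le> a n} \<inter> {a. clique cmp (supp a)} \<inter> {a. \<forall>S p. finite S \<longrightarrow> (\<Sum>n\<in>S. a n * u n p) \<le> 1})" (is "_ = ?B \<inter> ?C")
  proof (intro equalityI subsetI)
    fix a assume a: "a \<in> K2"
    then have le: "(\<Sum>n\<in>S. a n * u n p) \<le> 1" if "finite S" for S p
      using restr_weight_ball_iff[OF that] that by (auto simp: K2_def)
    have "a n \<le> 1 / u n (p n)" for n using le[of "{n}" "p n"] p[of n] by (simp add: field_simps)
    then show "a \<in> ?B \<inter> ?C" using a le by (auto simp: K2_def)
  next
    fix a assume "a \<in> ?B \<inter> ?C"
    then show "a \<in> K2" by (auto simp: K2_def restr_weight_ball_iff)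
  qed
  moreover have "closed ?C"
    by (intro closed_Int closed_nonneg clique_closed closed_Collect_all closed_Collect_imp closed_Collect_le
        open_Collect_const continuous_on_sum continuous_on_mult continuous_on_const continuous_coordinate)
  ultimately show ?thesis by (simp only: compact_Int_closed[OF compact_box])
qed

lemma compact_K1: "compact K1"
proof -
  have "K1 = {b. \<forall>n. 0 \<le> b n \<and> b n \<le> norm (u n)} \<inter>
      ({b. \<forall>n. 0 \<le> b n} \<inter> {b. clique cmp (supp b)} \<inter> {b. \<forall>a. a \<in> weight_ball u \<longrightarrow> dot a b \<le> 1})" (is "_ = ?B \<inter> ?C")
  proof (intro equalityI subsetI)
    fix b assume b: "b \<in> K1"
    have "b n \<le> norm (u n)" for n
      using b unit_weight_ball[of n] u_nonzero[of n] by (fastforce simp: K1_def field_simps)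
    then show "b \<in> ?B \<inter> ?C" using b by (auto simp: K1_def)
  qed (auto simp: K1_def)
  moreover have "closed ?C"
    unfolding dot_def
    by (intro closed_Int closed_nonneg clique_closed closed_Collect_all closed_Collect_imp closed_Collect_le
        open_Collect_const continuous_on_sum continuous_on_mult continuous_on_const continuous_coordinate)
  ultimately show ?thesis by (simp only: compact_Int_closed[OF compact_box])
qed

lemma clique_supp_unit: "clique cmp (supp (unit n r))"
  by (auto simp: clique_def supp_def unit_def cmp_refl split: if_splits)

lemma unit_K2: "unit n (1 / norm (u n)) \<in> K2"
proof -
  have "restr S (unit n (1 / norm (u n))) \<in> weight_ball u" for S
    by (rule weight_ball_solid[OF unit_weight_ball[of n]]) (auto simp: restr_def unit_def)
  then show ?thesis using clique_supp_unit by (auto simp: K2_def) (auto simp: unit_def)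
qed

text \<open>The source of lower bounds: a test against all of \<open>K1\<close> includes evaluation
  at each point along each clique.\<close>

lemma eval_K1:
  assumes C: "clique cmp C"
  shows "restr C (\<lambda>n. u n p) \<in> K1"
proof -
  have "dot a (restr C (\<lambda>n. u n p)) \<le> 1" if a: "a \<in> weight_ball u" for a
  proof -
    have "dot a (restr C (\<lambda>n. u n p)) \<le> dot a (\<lambda>n. u n p)"
      unfolding dot_def using a u_nonneg by (intro sum_mono mult_left_mono) (auto simp: restr_def weight_ball_iff)
    also have "\<dots> \<le> 1" using a by (auto simp: weight_ball_iff)
    finally show ?thesis .
  qed
  moreover have "clique cmp (supp (restr C (\<lambda>n. u n p)))"
    using C supp_restr unfolding clique_def by blast
  ultimately show ?thesis using u_nonneg by (auto simp: K1_def) (auto simp: restr_def)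
qed

text \<open>By bounded completeness on the clique \<open>supp a\<close>, the part of
  \<open>a\<close> under some \<open>f j\<close> has norm at most \<open>\<epsilon> / 2\<close>.
  Blown up by \<open>2 / \<epsilon>\<close> it still belongs to \<open>K2\<close>, on which
  \<open>f j\<close> is at most 1.\<close>

lemma null_K2: "null_on K2"
  unfolding null_on_def
proof (intro ballI allI impI notI)
  fix a f and \<epsilon> :: real
  assume a: "a \<in> K2" and f: "disj_seq f" "\<forall>j. f j \<in> fpolar K2" and \<epsilon>: "0 < \<epsilon>" and all: "\<forall>j. \<epsilon> \<le> dot (f j) a"
  show False
  proof (cases "finite (supp a)")
    case True
    then obtain j where "\<And>n. n \<in> supp a \<Longrightarrow> f j n = 0" using disj_seq_avoids_finite[OF f(1)] by blast
    then have "dot (f j) a = 0" unfolding dot_def by (intro sum.neutral) (auto simp: supp_def)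
    then show False using all \<epsilon> by (metis not_le)
  next
    case False
    define S where "S j = supp (f j) \<inter> supp a" for j
    have fS: "finite (S j)" for j using f(2) by (auto simp: S_def fpolar_def fs_def)
    have dS: "S j \<inter> S k = {}" if "j \<noteq> k" for j k
      using f(1) that by (auto simp: S_def disj_seq_def supp_def)
    have a': "0 \<le> a n" "clique cmp (supp a)" "finite T \<Longrightarrow> restr T a \<in> weight_ball u" for n T
      using a by (auto simp: K2_def)
    obtain j where j: "\<And>p. (\<Sum>n\<in>S j. a n * u n p) \<le> \<epsilon> / 2"
      using clique_bc[where S = S, OF False a'(2) a'(1) order_refl a'(3) fS dS half_gt_zero[OF \<epsilon>]] by auto
    define b where "b = (\<lambda>n. (2 / \<epsilon>) * restr (S j) a n)"
    have b0: "0 \<le> b n" for n using a'(1) \<epsilon> by (auto simp: b_def restr_def)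
    have "b \<in> K2"
      unfolding K2_def
    proof (intro CollectI conjI allI impI)
      show "0 \<le> b n" for n by (rule b0)
      have "supp b \<subseteq> supp a" using \<epsilon> by (auto simp: b_def restr_def supp_def split: if_splits)
      then show "clique cmp (supp b)" using a'(2) unfolding clique_def by blast
      have "b \<in> weight_ball u"
        unfolding weight_ball_iff
      proof (intro conjI allI b0)
        show "b \<in> fs" unfolding b_def by (intro fs_scale restr_fs fS)
        show "dot b (\<lambda>n. u n p) \<le> 1" for p
          unfolding b_def dot_scale[OF restr_fs[OF fS]] dot_restr[OF fS] using j[of p] \<epsilon> by (simp add: field_simps)
      qed
      then show "restr T b \<in> weight_ball u" if "finite T" for T
        by (rule weight_ball_solid) (auto simp: restr_def b0)
    qed
    then have "dot (f j) b \<le> 1" using f(2) by (auto simp: fpolar_def)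
    moreover have "dot (f j) b = (2 / \<epsilon>) * dot (f j) a"
      unfolding dot_def b_def sum_distrib_left by (intro sum.cong) (auto simp: S_def restr_def supp_def)
    ultimately have "dot (f j) a \<le> \<epsilon> / 2" using \<epsilon> by (simp add: field_simps)
    moreover have "\<epsilon> \<le> dot (f j) a" using all by blast
    ultimately show False using \<epsilon> by linarith
  qed
qed

text \<open>Restricted to the clique \<open>supp b\<close>, the \<open>f j\<close> lie in the weight
  ball, because evaluations along a clique belong to \<open>K1\<close>; there the shrinking
  assumption applies.\<close>

lemma null_K1: "null_on K1"
  unfolding null_on_def
proof (intro ballI allI impI notI)
  fix b f and \<epsilon> :: real
  assume b: "b \<in> K1" and f: "disj_seq f" "\<forall>j. f j \<in> fpolar K1" and \<epsilon>: "0 < \<epsilon>" and all: "\<forall>j. \<epsilon> \<le> dot (f j) b"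
  show False
  proof (cases "finite (supp b)")
    case True
    then obtain j where "\<And>n. n \<in> supp b \<Longrightarrow> f j n = 0" using disj_seq_avoids_finite[OF f(1)] by blast
    then have "dot (f j) b = 0" unfolding dot_def by (intro sum.neutral) (auto simp: supp_def)
    then show False using all \<epsilon> by (metis not_le)
  next
    case False
    define g where "g j = restr (supp b) (f j)" for j
    have b': "0 \<le> b n" "clique cmp (supp b)" "a \<in> weight_ball u \<Longrightarrow> dot a b \<le> 1" for n a
      using b by (auto simp: K1_def)
    have dg: "disj_seq g" by (rule disj_smaller[OF f(1)]) (simp add: g_def restr_def)
    have swap: "dot (g j) c = dot (f j) (restr (supp b) c)" for j c
    proof -
      have fin: "finite (supp (f j))" using f(2) by (auto simp: fpolar_def fs_def)
      have "supp (g j) \<subseteq> supp (f j)" by (auto simp: g_def restr_def supp_def)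
      from dot_eq[OF fin this] show ?thesis
        unfolding dot_def[of "f j"] by (auto simp: g_def restr_def intro!: sum.cong)
    qed
    have g: "g j \<in> weight_ball u" for j
      unfolding weight_ball_iff
    proof (intro conjI allI)
      show "g j \<in> fs" by (rule fs_mono[of "f j"]) (use f(2) in \<open>simp_all add: g_def restr_def fpolar_def\<close>)
      show "0 \<le> g j n" for n using f(2) by (simp add: g_def restr_def fpolar_def)
      show "dot (g j) (\<lambda>n. u n p) \<le> 1" for p
        unfolding swap using eval_K1[OF b'(2), of p] f(2) by (auto simp: fpolar_def)
    qed
    have gs: "supp (g j) \<subseteq> supp b" for j unfolding g_def by (rule supp_restr)
    obtain j where j: "dot (g j) b < \<epsilon>"
      using clique_sh[OF False b'(2) b'(1) order_refl b'(3) dg g gs \<epsilon>] by blast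
    moreover have "restr (supp b) b = b" by (auto simp: restr_def supp_def)
    ultimately show False using all swap by (metis not_le)
  qed
qed

sublocale null_pair K1 K2
proof
  show "compact K1" "compact K2" "null_on K1" "null_on K2"
    by (rule compact_K1 compact_K2 null_K1 null_K2)+
  show "nneg K1" "nneg K2" by (auto simp: nneg_def K1_def K2_def)
  show "\<exists>b\<in>K2. 0 < b n" for n
    using unit_K2[of n] u_nonzero[of n] by (intro bexI[of _ "unit n (1 / norm (u n))"]) (auto simp: unit_def)
  show "\<exists>b\<in>K1. 0 < b n" for n
  proof -
    obtain p where "0 < u n p" using u_pos by blast
    moreover have "clique cmp {n}" by (simp add: clique_def cmp_refl)
    ultimately show ?thesis using eval_K1[of "{n}" p] by (intro bexI[of _ "restr {n} (\<lambda>n. u n p)"]) (auto simp: restr_def)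
  qed
qed

text \<open>Take \<open>|a| / r\<close> for both factors: it lies in \<open>BF\<close>, and being
  supported on a clique it lies in \<open>K2\<close>, hence in the bipolar
  \<open>BE\<close>.\<close>

lemma q_upper:
  assumes C: "clique cmp (supp a)" and a: "a \<in> fs" and r: "0 < r"
    and le: "\<And>p. (\<Sum>n\<in>supp a. \<bar>a n\<bar> * u n p) \<le> r"
  shows "q a \<le> r"
proof -
  define c where "c = (\<lambda>n. \<bar>a n\<bar> / r)"
  have supp: "supp c = supp a" using r by (auto simp: c_def supp_def)
  have c: "c \<in> fs" "0 \<le> c n" for n using a r supp by (auto simp: fs_def c_def)
  have "dot c (\<lambda>n. u n p) = (\<Sum>n\<in>supp a. \<bar>a n\<bar> * u n p) / r" for p
    unfolding dot_def supp by (simp add: c_def sum_divide_distrib)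
  then have cB: "c \<in> weight_ball u" using le r c by (simp add: weight_ball_iff)
  have "restr S c \<in> weight_ball u" for S by (rule weight_ball_solid[OF cB]) (auto simp: restr_def c)
  then have "c \<in> K2" using c C supp by (simp add: K2_def)
  then have "c \<in> BE"
    using c by (auto simp: fpolar_def dot_commute[OF c(1)])
  moreover have "c \<in> BF" using c cB by (auto simp: fpolar_def K1_def)
  ultimately have "(\<lambda>n. a n / r) \<in> U"
    using a by (intro U_I fs_divide) (auto simp: c_def power2_eq_square abs_mult_self_eq)
  then show ?thesis using r by (intro q_le)
qed

text \<open>The geometric mean is at most the arithmetic mean, and evaluation at \<open>p\<close>
  along the clique is at most 1 on both factors, since it lies in \<open>K1\<close> and in
  \<open>BG\<close>. Together with \<open>q_upper\<close> the product norm on a clique is exactly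
  the weight norm.\<close>

lemma q_lower:
  assumes C: "clique cmp (supp a)" and a: "a \<in> fs"
  shows "(\<Sum>n\<in>supp a. \<bar>a n\<bar> * u n p) \<le> q a"
proof (rule dense_ge)
  fix r assume r: "q a < r"
  then have r0: "0 < r" using q_nonneg[OF a] by simp
  have fin: "finite (supp a)" using a by (simp add: fs_def)
  obtain e f where ef: "e \<in> BE" "f \<in> BF" "\<And>n. (a n / r)\<^sup>2 \<le> e n * f n" "\<And>n. 0 \<le> e n" "\<And>n. 0 \<le> f n"
    using U_E[OF q_less[OF a r]] by metis
  have am: "\<bar>a n\<bar> \<le> r * ((e n + f n) / 2)" for n
  proof -
    have "(a n / r)\<^sup>2 \<le> ((e n + f n) / 2)\<^sup>2"
    proof -
      have "4 * (e n * f n) \<le> (e n + f n)\<^sup>2"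
        using zero_le_power2[of "e n - f n"] by (simp add: power2_eq_square algebra_simps)
      moreover have "((e n + f n) / 2)\<^sup>2 = (e n + f n)\<^sup>2 / 4" by (simp add: power_divide)
      ultimately show ?thesis using ef(3)[of n] by linarith
    qed
    then have "\<bar>a n / r\<bar> \<le> (e n + f n) / 2" using ef(4,5)[of n] by (simp add: abs_le_square_iff[symmetric])
    then show ?thesis using r0 by (simp add: field_simps)
  qed
  define v where "v = restr (supp a) (\<lambda>n. u n p)"
  have v1: "v \<in> K1" unfolding v_def by (rule eval_K1[OF C])
  have v2: "v \<in> BG"
    unfolding fpolar_def
  proof (intro CollectI conjI ballI allI)
    show "v \<in> fs" unfolding v_def by (rule restr_fs[OF fin])
    show "0 \<le> v n" for n using u_nonneg by (simp add: v_def restr_def)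
    fix c assume c: "c \<in> K2"
    then have "restr (supp a) c \<in> weight_ball u" using fin by (simp add: K2_def)
    then have "dot (restr (supp a) c) (\<lambda>n. u n p) \<le> 1" by (simp add: weight_ball_iff)
    then show "dot v c \<le> 1" using fin by (simp add: v_def dot_restr mult.commute)
  qed
  have part: "(\<Sum>n\<in>supp a. g n * u n p) \<le> 1" if g: "g \<in> fs" "\<And>n. 0 \<le> g n" "dot g v \<le> 1" for g
  proof -
    have "dot g v = (\<Sum>n\<in>supp g \<union> supp a. g n * v n)" using g(1) fin by (intro dot_eq) (auto simp: fs_def)
    also have "\<dots> = (\<Sum>n\<in>supp a. g n * u n p)"
      using g(1) fin by (intro sum.mono_neutral_cong_right) (auto simp: fs_def v_def restr_def)
    finally show ?thesis using g(3) by simp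
  qed
  have "(\<Sum>n\<in>supp a. \<bar>a n\<bar> * u n p) \<le> (\<Sum>n\<in>supp a. r * ((e n + f n) / 2) * u n p)"
    by (intro sum_mono mult_right_mono am u_nonneg)
  also have "\<dots> = (r / 2) * ((\<Sum>n\<in>supp a. e n * u n p) + (\<Sum>n\<in>supp a. f n * u n p))"
    unfolding sum.distrib[symmetric] sum_distrib_left by (intro sum.cong) (auto simp: field_simps)
  also have "\<dots> \<le> (r / 2) * (1 + 1)"
    using ef v1 v2 fpolarD r0 by (intro mult_left_mono add_mono part) (auto dest: fpolarD)
  finally show "(\<Sum>n\<in>supp a. \<bar>a n\<bar> * u n p) \<le> r" by simp
qed

end

section \<open>Realization in the space of continuous functions on the Cantor set\<close>

lemma open_contains_cylinder:
  fixes x :: "nat \<Rightarrow> 'c::topological_space"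
  assumes "open X" "x \<in> X"
  shows "\<exists>m. \<forall>y. (\<forall>i<m. y i = x i) \<longrightarrow> y \<in> X"
proof -
  have "openin (product_topology (\<lambda>_. euclidean) UNIV) X"
    using assms by (simp add: euclidean_product_topology)
  from product_topology_open_contains_basis[OF this assms(2)]
  obtain B where B: "x \<in> PiE UNIV B" "finite {i. B i \<noteq> UNIV}" "PiE UNIV B \<subseteq> X"
    by auto
  define m where "m = Suc (Max (insert 0 {i. B i \<noteq> UNIV}))"
  have m: "i < m" if "B i \<noteq> UNIV" for i
    using that B(2) by (auto simp: m_def less_Suc_eq_le intro!: Max_ge)
  have "y \<in> X" if "\<And>i. i < m \<Longrightarrow> y i = x i" for y
  proof -
    have "y i \<in> B i" for i using that[of i] m[of i] B(1) by (cases "B i = UNIV") (auto simp: PiE_def Pi_def)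
    then show ?thesis using B(3) by (auto simp: PiE_def Pi_def)
  qed
  then show ?thesis by blast
qed

lemma open_cylinder:
  fixes x :: "nat \<Rightarrow> 'c::discrete_topology"
  shows "open {y. \<forall>i<m. y i = x i}"
proof -
  have "{y. \<forall>i<m. y i = x i} = (\<Inter>i<m. (\<lambda>y. y i) -` {x i})" by auto
  moreover have "open ((\<lambda>y :: nat \<Rightarrow> 'c. y i) -` {x i})" for i
    by (intro open_vimage open_discrete) (rule continuous_on_subset[OF continuous_on_product_coordinates], simp)
  ultimately show ?thesis by (simp add: open_INT)
qed

lemma continuous_on_finitely_determined:
  fixes f :: "(nat \<Rightarrow> 'c::discrete_topology) \<Rightarrow> 'b::topological_space"
  assumes f: "\<And>p p'. (\<And>i. i < m \<Longrightarrow> p i = p' i) \<Longrightarrow> f p = f p'"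
  shows "continuous_on UNIV f"
proof -
  have "open (f -` B)" if "open B" for B
  proof (subst open_subopen)
    show "\<forall>p\<in>f -` B. \<exists>T. open T \<and> p \<in> T \<and> T \<subseteq> f -` B"
    proof
      fix p assume p: "p \<in> f -` B"
      have "{p'. \<forall>i<m. p' i = p i} \<subseteq> f -` B"
      proof
        fix p' assume "p' \<in> {p'. \<forall>i<m. p' i = p i}"
        then have "f p' = f p" by (intro f) auto
        with p show "p' \<in> f -` B" by simp
      qed
      with open_cylinder show "\<exists>T. open T \<and> p \<in> T \<and> T \<subseteq> f -` B" by blast
    qed
  qed
  then show ?thesis by (simp add: continuous_on_open_vimage)
qed

lemma closed_cylinder_approx:
  fixes C :: "(nat \<Rightarrow> 'c::topological_space) set"
  assumes "closed C" "\<And>m. \<exists>c\<in>C. \<forall>i<m. c i = x i"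
  shows "x \<in> C"
proof (rule ccontr)
  assume "x \<notin> C"
  then obtain m where "\<forall>y. (\<forall>i<m. y i = x i) \<longrightarrow> y \<in> - C"
    using open_contains_cylinder[of "- C" x] assms(1) by (auto simp: open_Compl)
  then show False using assms(2)[of m] by blast
qed

text \<open>Follow the bits of the given point as long as the resulting prefix can be extended to a
  member of the closed set.\<close>

primrec retract_prefix :: "(nat \<Rightarrow> bool) set \<Rightarrow> (nat \<Rightarrow> bool) \<Rightarrow> nat \<Rightarrow> bool list" where
  "retract_prefix C p 0 = []"
| "retract_prefix C p (Suc n) = retract_prefix C p n @
    [if \<exists>c\<in>C. map c [0..<Suc n] = retract_prefix C p n @ [p n] then p n else \<not> p n]"

lemma cantor_retraction:
  assumes C: "closed C" "C \<noteq> {}"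
  obtains \<rho> :: "(nat \<Rightarrow> bool) \<Rightarrow> nat \<Rightarrow> bool"
  where "continuous_on UNIV \<rho>" "\<And>p. \<rho> p \<in> C" "\<And>p. p \<in> C \<Longrightarrow> \<rho> p = p"
proof
  let ?R = "retract_prefix C"
  define \<rho> where "\<rho> p i = ?R p (Suc i) ! i" for p i
  have len: "length (?R p n) = n" for p n by (induction n) auto
  have R_\<rho>: "?R p n = map (\<rho> p) [0..<n]" for p n
    by (induction n) (simp_all add: \<rho>_def nth_append len)
  \<comment> \<open>Invariant: the prefix extends to a member of \<open>C\<close>. If the next bit
    of \<open>p\<close> cannot be followed, the extending member takes the opposite bit.\<close>
  have ext: "\<exists>c\<in>C. map c [0..<n] = ?R p n" for p n
  proof (induction n)
    case (Suc n)
    then obtain c where c: "c \<in> C" "map c [0..<n] = ?R p n" by blast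
    show ?case
    proof (cases "\<exists>c\<in>C. map c [0..<Suc n] = ?R p n @ [p n]")
      case False
      then have "map c [0..<Suc n] \<noteq> ?R p n @ [p n]" using c(1) by blast
      then have "c n = (\<not> p n)" using c(2) by auto
      moreover have "?R p (Suc n) = ?R p n @ [\<not> p n]" using False by (simp only: retract_prefix.simps if_False)
      ultimately have "map c [0..<Suc n] = ?R p (Suc n)" using c(2) by simp
      then show ?thesis using c(1) by blast
    qed auto
  qed (use C in auto)
  show "\<rho> p \<in> C" for p
  proof (rule closed_cylinder_approx[OF C(1)])
    fix m
    obtain c where c: "c \<in> C" "map c [0..<m] = ?R p m" using ext by blast
    then have "\<forall>i<m. c i = \<rho> p i" unfolding R_\<rho> by simp
    then show "\<exists>c\<in>C. \<forall>i<m. c i = \<rho> p i" using c(1) by blast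
  qed
  show "\<rho> p = p" if p: "p \<in> C" for p
  proof
    have "?R p n = map p [0..<n]" for n using p by (induction n) auto
    then show "\<rho> p i = p i" for i unfolding \<rho>_def by (simp del: retract_prefix.simps upt_Suc)
  qed
  have dep: "?R p n = ?R p' n" if "\<And>i. i < n \<Longrightarrow> p i = p' i" for p p' n
    using that by (induction n) auto
  show "continuous_on UNIV \<rho>"
  proof (rule continuous_on_coordinatewise_then_product)
    fix i
    show "continuous_on UNIV (\<lambda>p. \<rho> p i)"
    proof (rule continuous_on_finitely_determined)
      fix p p' :: "nat \<Rightarrow> bool" assume "\<And>k. k < Suc i \<Longrightarrow> p k = p' k"
      from dep[OF this] show "\<rho> p i = \<rho> p' i" unfolding \<rho>_def by (rule arg_cong)
    qed
  qed
qed

section \<open>The Cantor set maps onto boxes\<close>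

definition bin :: "(nat \<Rightarrow> bool) \<Rightarrow> real"
  where "bin s = (\<Sum>k. if s k then (1/2) ^ Suc k else 0)"

lemma continuous_bin: "continuous_on UNIV bin"
proof (rule uniform_limit_theorem)
  show "uniform_limit UNIV (\<lambda>n s. \<Sum>k<n. if s k then (1/2) ^ Suc k else 0 :: real) bin sequentially"
    unfolding bin_def[abs_def]
    by (rule Weierstrass_m_test[where M = "\<lambda>k. (1/2) ^ Suc k"]) (auto intro: summable_geometric summable_mult)
  show "\<forall>\<^sub>F n in sequentially. continuous_on UNIV (\<lambda>s. \<Sum>k<n. if s k then (1/2) ^ Suc k else 0 :: real)"
    by (intro always_eventually allI continuous_on_sum continuous_on_finitely_determined[of "Suc _"]) auto
qed simp

lemma bin_surj:
  assumes t: "0 \<le> t" "t < 1" obtains s where "bin s = t"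
proof
  \<comment> \<open>The binary digits of \<open>t\<close>; the bound \<open>t < 1\<close> makes the
    integral part vanish.\<close>
  define s where "s k \<longleftrightarrow> odd \<lfloor>2 ^ Suc k * t\<rfloor>" for k
  have part: "(\<Sum>k<m. if s k then (1/2) ^ Suc k else 0) = \<lfloor>2 ^ m * t\<rfloor> / 2 ^ m" for m
  proof (induction m)
    case 0
    then show ?case using t by (simp add: floor_eq_iff)
  next
    case (Suc m)
    have "\<lfloor>2 ^ Suc m * t\<rfloor> div 2 = \<lfloor>2 ^ m * t\<rfloor>"
    proof -
      have "\<lfloor>2 ^ m * t\<rfloor> = \<lfloor>(2 ^ Suc m * t) / of_int 2\<rfloor>" by simp
      also have "\<dots> = \<lfloor>2 ^ Suc m * t\<rfloor> div 2" by (rule floor_divide_real_eq_div) simp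
      finally show ?thesis by simp
    qed
    then have "\<lfloor>2 ^ Suc m * t\<rfloor> = 2 * \<lfloor>2 ^ m * t\<rfloor> + (if s m then 1 else 0)"
      by (auto simp: s_def) presburger+
    then have "real_of_int \<lfloor>2 ^ Suc m * t\<rfloor> = 2 * real_of_int \<lfloor>2 ^ m * t\<rfloor> + (if s m then 1 else 0)"
      by auto
    then show ?case unfolding sum.lessThan_Suc Suc.IH by (auto simp: field_simps power_one_over)
  qed
  have "(\<lambda>m. \<lfloor>2 ^ m * t\<rfloor> / 2 ^ m) \<longlonglongrightarrow> t"
  proof (rule tendsto_sandwich)
    show "\<forall>\<^sub>F m in sequentially. t - (1/2) ^ m \<le> \<lfloor>2 ^ m * t\<rfloor> / 2 ^ m"
    proof (intro always_eventually allI)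
      fix m
      have "2 ^ m * t - 1 \<le> \<lfloor>2 ^ m * t\<rfloor>" by linarith
      then have "(2 ^ m * t - 1) / 2 ^ m \<le> \<lfloor>2 ^ m * t\<rfloor> / 2 ^ m" by (intro divide_right_mono) auto
      then show "t - (1/2) ^ m \<le> \<lfloor>2 ^ m * t\<rfloor> / 2 ^ m" by (simp add: diff_divide_distrib power_one_over)
    qed
    show "\<forall>\<^sub>F m in sequentially. \<lfloor>2 ^ m * t\<rfloor> / 2 ^ m \<le> t"
    proof (intro always_eventually allI)
      fix m
      have "\<lfloor>2 ^ m * t\<rfloor> \<le> 2 ^ m * t" by (rule of_int_floor_le)
      then show "\<lfloor>2 ^ m * t\<rfloor> / 2 ^ m \<le> t" by (simp add: divide_le_eq mult.commute)
    qed
    have "(\<lambda>m. t - (1/2) ^ m) \<longlonglongrightarrow> t - 0" by (intro tendsto_intros LIMSEQ_power_zero) auto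
    then show "(\<lambda>m. t - (1/2) ^ m) \<longlonglongrightarrow> t" by simp
  qed auto
  then have "(\<lambda>k. if s k then (1/2) ^ Suc k else 0) sums t"
    unfolding sums_def part by simp
  then show "bin s = t" unfolding bin_def by (rule sums_unique[symmetric])
qed

lemma cantor_onto_box:
  fixes r :: "nat \<Rightarrow> real"
  assumes r: "\<And>n. 0 < r n"
  shows "\<exists>\<theta> :: (nat \<Rightarrow> bool) \<Rightarrow> nat \<Rightarrow> real. continuous_on UNIV \<theta> \<and> (\<forall>b. (\<forall>n. \<bar>b n\<bar> \<le> r n) \<longrightarrow> (\<exists>p. \<theta> p = b))"
proof -
  \<comment> \<open>The pairing function splits one bit sequence into countably many. Since
    \<open>bin_surj\<close> reaches only [0, 1), twice the box is parametrized: the factor 4 in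
    place of 2 puts the endpoints of the box at 1/4 and 3/4.\<close>
  define \<theta> where "\<theta> p n = 4 * r n * (bin (\<lambda>k. p (prod_encode (n, k))) - 1/2)" for p n
  have "continuous_on UNIV (\<lambda>p :: nat \<Rightarrow> bool. bin (\<lambda>k. p (prod_encode (n, k))))" for n
    by (rule continuous_on_compose2[OF continuous_bin])
      (auto intro!: continuous_on_coordinatewise_then_product continuous_on_product_coordinates)
  then have cont: "continuous_on UNIV \<theta>"
    unfolding \<theta>_def[abs_def] by (intro continuous_on_coordinatewise_then_product continuous_intros)
  have "\<exists>p. \<theta> p = b" if b: "\<forall>n. \<bar>b n\<bar> \<le> r n" for b
  proof -
    have "\<exists>s. bin s = b n / (4 * r n) + 1/2" for n
    proof -
      have "-1/4 \<le> b n / (4 * r n)" "b n / (4 * r n) \<le> 1/4" using b[rule_format, of n] r[of n] by (auto simp: field_simps abs_le_iff)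
      then show ?thesis using bin_surj[of "b n / (4 * r n) + 1/2"] by auto
    qed
    then obtain s where s: "\<And>n. bin (s n) = b n / (4 * r n) + 1/2" by metis
    have "\<theta> (\<lambda>i. s (fst (prod_decode i)) (snd (prod_decode i))) = b"
      using r by (auto simp: \<theta>_def s less_imp_neq[symmetric] fun_eq_iff)
    then show ?thesis by blast
  qed
  with cont show ?thesis by blast
qed

context solid_norm
begin

lemma q_zero: "q (\<lambda>n. 0) = 0"
  using q_scale[of "\<lambda>_. 0" 0] by simp

lemma q_ge_0: "a \<in> fs \<Longrightarrow> 0 \<le> q a"
  using q_mono[of a "\<lambda>_. 0"] q_zero by simp

text \<open>Hahn-Banach on \<open>fs\<close>, where a linear functional is determined by its values
  on the unit vectors and so is given by a sequence.\<close>

lemma norming_functional: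
  assumes a: "a \<in> fs"
  obtains b where "\<And>c. c \<in> fs \<Longrightarrow> dot c b \<le> q c" "dot a b = q a"
proof -
  interpret sublinear "\<lambda>r (f :: nat \<Rightarrow> real) z. r * f z" fs q
  proof (intro sublinear.intro vector_space_fun sublinear_axioms.intro)
    show "module.subspace (\<lambda>r (f :: nat \<Rightarrow> real) z. r * f z) fs"
      using fs_add fs_scale fs_zero
      by (auto simp: module.subspace_def[OF vector_space_fun[unfolded module_iff_vector_space[symmetric]]] plus_fun_def zero_fun_def)
  qed (use q_add q_scale in \<open>auto simp: plus_fun_def\<close>)
  obtain L where hb: "(\<forall>x\<in>fs. \<forall>y\<in>fs. L (x + y) = L x + L y) \<and> (\<forall>r. \<forall>x\<in>fs. L (\<lambda>z. r * x z) = r * L x) \<and>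
    (\<forall>x\<in>fs. L x \<le> q x) \<and> L a = q a"
    using hahn_banach[OF a] by (rule exE)
  then have L: "\<And>x y. x \<in> fs \<Longrightarrow> y \<in> fs \<Longrightarrow> L (x + y) = L x + L y"
    "\<And>r x. x \<in> fs \<Longrightarrow> L (\<lambda>z. r * x z) = r * L x" "\<And>x. x \<in> fs \<Longrightarrow> L x \<le> q x" "L a = q a"
    by simp_all
  define b where "b n = L (unit n 1)" for n
  have Ladd: "L (\<lambda>z. x z + y z) = L x + L y" if "x \<in> fs" "y \<in> fs" for x y
    using L(1)[OF that] by (simp add: plus_fun_def)
  have L0: "L (\<lambda>z. 0) = 0" using L(2)[of "\<lambda>_. 0" 0] by simp
  have Lsum: "L (\<lambda>n. \<Sum>j\<in>J. l j * f j n) = (\<Sum>j\<in>J. l j * L (f j))" if "\<And>j. j \<in> J \<Longrightarrow> f j \<in> fs" "finite J"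
    for J :: "nat set" and l and f :: "nat \<Rightarrow> nat \<Rightarrow> real"
    using that(2,1) by (induction J) (auto simp: L0 Ladd L(2) fs_sum fs_scale)
  have "L c = dot c b" if c: "c \<in> fs" for c
  proof -
    have "c = (\<lambda>n. \<Sum>j\<in>supp c. c j * unit j 1 n)"
      using fsD[OF c] by (auto simp: unit_def fun_eq_iff supp_def if_distrib[of "\<lambda>x. _ * x"] cong: if_cong)
    then have "L c = L (\<lambda>n. \<Sum>j\<in>supp c. c j * unit j 1 n)" by simp
    also have "\<dots> = dot c b" unfolding dot_def b_def using fsD[OF c] by (intro Lsum) auto
    finally show ?thesis .
  qed
  then show ?thesis using that[of b] L(3,4) a by simp
qed

text \<open>The sequence is the sequence of coordinate functions on the dual unit ball,
  pulled back along a continuous surjection from the Cantor set.\<close>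

theorem realization:
  obtains e :: "nat \<Rightarrow> C2N" where "\<And>S a. finite S \<Longrightarrow> norm (\<Sum>n\<in>S. a n *\<^sub>R e n) = q (restr S a)"
proof -
  define r where "r n = q (unit n 1)" for n
  have r: "0 < r n" for n unfolding r_def by (rule q_pos[OF unit_fs, of _ _ n]) (simp add: unit_def)
  define K where "K = {b. \<forall>c. c \<in> fs \<longrightarrow> dot c b \<le> q c}"
  have Kabs: "\<bar>dot c b\<bar> \<le> q c" if "b \<in> K" "c \<in> fs" for b c
  proof -
    have "dot (\<lambda>n. (-1) * c n) b \<le> q (\<lambda>n. (-1) * c n)" using that fs_scale[of c "-1"] by (auto simp: K_def)
    then have "- dot c b \<le> q c" unfolding dot_scale[OF that(2)] q_scale[OF that(2)] by simp
    moreover have "dot c b \<le> q c" using that by (simp add: K_def)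
    ultimately show ?thesis by linarith
  qed
  have Kr: "\<bar>b n\<bar> \<le> r n" if "b \<in> K" for b n
    using Kabs[OF that, of "unit n 1"] by (simp add: r_def)
  have K: "closed K"
    unfolding K_def dot_def
    by (intro closed_Collect_all closed_Collect_imp closed_Collect_le open_Collect_const
        continuous_on_sum continuous_on_mult continuous_on_const continuous_on_product_coordinates)
  obtain \<theta> :: "(nat \<Rightarrow> bool) \<Rightarrow> nat \<Rightarrow> real"
    where \<theta>: "continuous_on UNIV \<theta>" "\<forall>b. (\<forall>n. \<bar>b n\<bar> \<le> r n) \<longrightarrow> (\<exists>p. \<theta> p = b)"
  proof -
    have "\<exists>\<theta> :: (nat \<Rightarrow> bool) \<Rightarrow> nat \<Rightarrow> real. continuous_on UNIV \<theta> \<and> (\<forall>b. (\<forall>n. \<bar>b n\<bar> \<le> r n) \<longrightarrow> (\<exists>p. \<theta> p = b))"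
      by (rule cantor_onto_box) (rule r)
    then show ?thesis by (elim exE conjE) (rule that)
  qed
  define C where "C = \<theta> -` K"
  have "closed C" unfolding C_def using continuous_on_closed_vimage[of UNIV \<theta>] \<theta>(1) K by auto
  moreover have "\<exists>p. \<theta> p = (\<lambda>_. 0)" using \<theta>(2)[rule_format, of "\<lambda>_. 0"] r by (simp add: less_imp_le)
  moreover have "(\<lambda>_. 0) \<in> K" using q_ge_0 by (simp add: K_def dot_def)
  ultimately have "closed C" "C \<noteq> {}" unfolding C_def by (auto 4 3)
  \<comment> \<open>The image of \<theta> covers the whole box. Precomposing with a retraction onto
    the preimage of \<open>K\<close> forces all values into \<open>K\<close> and still attains every
    point of \<open>K\<close>.\<close>
  then obtain \<rho> where \<rho>: "continuous_on UNIV \<rho>" "\<And>p. \<rho> p \<in> C" "\<And>p. p \<in> C \<Longrightarrow> \<rho> p = p"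
    using cantor_retraction by metis
  have \<theta>\<rho>: "\<theta> (\<rho> p) \<in> K" for p using \<rho>(2) by (auto simp: C_def)
  define e where "e n = Bcontfun (\<lambda>p. \<theta> (\<rho> p) n)" for n
  have app: "e n p = \<theta> (\<rho> p) n" for n p
  proof -
    have "continuous_on UNIV (\<lambda>p. \<theta> (\<rho> p))"
      by (rule continuous_on_compose2[OF \<theta>(1) \<rho>(1)]) auto
    then have "continuous_on UNIV (\<lambda>p. \<theta> (\<rho> p) n)" by (rule continuous_on_product_then_coordinatewise)
    then have "(\<lambda>p. \<theta> (\<rho> p) n) \<in> bcontfun"
      by (rule bcontfun_normI[where b = "r n"]) (use Kr[OF \<theta>\<rho>] in simp)
    then show ?thesis by (simp add: e_def Bcontfun_inverse)
  qed
  have sum_app: "apply_bcontfun (\<Sum>n\<in>S. a n *\<^sub>R e n) p = (\<Sum>n\<in>S. a n * e n p)" for S a p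
    by (induction S rule: infinite_finite_induct) auto
  have val: "apply_bcontfun (\<Sum>n\<in>S. a n *\<^sub>R e n) p = dot (restr S a) (\<theta> (\<rho> p))" if "finite S" for S a p
    using that by (simp add: sum_app app dot_restr)
  have "norm (\<Sum>n\<in>S. a n *\<^sub>R e n) = q (restr S a)" if S: "finite S" for S a
  proof (rule antisym)
    show "norm (\<Sum>n\<in>S. a n *\<^sub>R e n) \<le> q (restr S a)"
      by (rule norm_bound) (use Kabs[OF \<theta>\<rho> restr_fs[OF S]] val[OF S] in simp)
    obtain b where b: "\<And>c. c \<in> fs \<Longrightarrow> dot c b \<le> q c" "dot (restr S a) b = q (restr S a)"
      using norming_functional[OF restr_fs[OF S]] by blast
    then have "b \<in> K" by (simp add: K_def)
    moreover then obtain p where "\<theta> p = b" using \<theta>(2) Kr by blast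
    ultimately have "\<rho> p = p" "\<theta> p = b" using \<rho>(3) by (auto simp: C_def)
    then have "apply_bcontfun (\<Sum>n\<in>S. a n *\<^sub>R e n) p = q (restr S a)" using val[OF S] b by simp
    then show "q (restr S a) \<le> norm (\<Sum>n\<in>S. a n *\<^sub>R e n)"
      using norm_bounded[of "\<Sum>n\<in>S. a n *\<^sub>R e n" p] by simp
  qed
  then show ?thesis using that by blast
qed

end

section \<open>Unconditional sequences and reflexivity\<close>

definition lincomb :: "(nat \<Rightarrow> 'v::real_normed_vector) \<Rightarrow> (nat \<Rightarrow> real) \<Rightarrow> 'v"
  where "lincomb y a = (\<Sum>n\<in>supp a. a n *\<^sub>R y n)"

definition fs_on :: "nat set \<Rightarrow> (nat \<Rightarrow> real) set"
  where "fs_on I = {a \<in> fs. supp a \<subseteq> I}"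

lemma lincomb_eq: "finite S \<Longrightarrow> supp a \<subseteq> S \<Longrightarrow> lincomb y a = (\<Sum>n\<in>S. a n *\<^sub>R y n)"
  unfolding lincomb_def by (rule sum.mono_neutral_left) (auto simp: supp_def)

lemma lincomb_add: "a \<in> fs \<Longrightarrow> b \<in> fs \<Longrightarrow> lincomb y (\<lambda>n. a n + b n) = lincomb y a + lincomb y b"
  by (subst (1 2 3) lincomb_eq[of "supp a \<union> supp b"])
    (auto simp: fs_def supp_def scaleR_add_left sum.distrib)

lemma lincomb_scale: "a \<in> fs \<Longrightarrow> lincomb y (\<lambda>n. r * a n) = r *\<^sub>R lincomb y a"
  by (subst (1 2) lincomb_eq[of "supp a"]) (auto simp: fs_def supp_def scaleR_sum_right)

lemma lincomb_diff: "a \<in> fs \<Longrightarrow> b \<in> fs \<Longrightarrow> lincomb y (\<lambda>n. a n - b n) = lincomb y a - lincomb y b"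
  using lincomb_add[of a "\<lambda>n. (-1) * b n" y] lincomb_scale[of b y "-1"] fs_scale[of b "-1"] by simp

lemma lincomb_restr: "finite S \<Longrightarrow> lincomb y (restr S a) = (\<Sum>n\<in>S. a n *\<^sub>R y n)"
  unfolding lincomb_eq[OF _ supp_restr] by (intro sum.cong) (auto simp: restr_def)

lemma lincomb_unit: "lincomb y (unit n r) = r *\<^sub>R y n"
  by (subst lincomb_eq[of "{n}"]) (auto simp: supp_def unit_def)

lemma supp_add: "supp (\<lambda>n. a n + b n) \<subseteq> supp a \<union> supp b"
  and supp_diff: "supp (\<lambda>n. a n - b n) \<subseteq> supp a \<union> supp b"
  and supp_scale: "supp (\<lambda>n. r * a n) \<subseteq> supp a"
  by (auto simp: supp_def)

lemma fs_diff: "a \<in> fs \<Longrightarrow> b \<in> fs \<Longrightarrow> (\<lambda>n. a n - b n) \<in> fs"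
  using fs_add[of a "\<lambda>n. (-1) * b n"] fs_scale[of b "-1"] by simp

lemma subspace_lincomb: "subspace (lincomb y ` fs_on I)"
proof (rule subspaceI)
  show "0 \<in> lincomb y ` fs_on I"
    by (rule image_eqI[of _ _ "\<lambda>_. 0"]) (auto simp: lincomb_def fs_on_def supp_def)
next
  fix u v assume "u \<in> lincomb y ` fs_on I" "v \<in> lincomb y ` fs_on I"
  then obtain a b where ab: "u = lincomb y a" "v = lincomb y b" "a \<in> fs" "b \<in> fs" "supp a \<subseteq> I" "supp b \<subseteq> I"
    by (auto simp: fs_on_def)
  then show "u + v \<in> lincomb y ` fs_on I"
    using supp_add[of a b] fs_add[of a b] by (intro image_eqI[of _ _ "\<lambda>n. a n + b n"]) (auto simp: fs_on_def lincomb_add)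
next
  fix u and c :: real assume "u \<in> lincomb y ` fs_on I"
  then obtain a where a: "u = lincomb y a" "a \<in> fs" "supp a \<subseteq> I" by (auto simp: fs_on_def)
  then show "c *\<^sub>R u \<in> lincomb y ` fs_on I"
    using supp_scale[of c a] fs_scale[of a c] by (intro image_eqI[of _ _ "\<lambda>n. c * a n"]) (auto simp: fs_on_def lincomb_scale)
qed

lemma subspace_closure:
  fixes S :: "'v::real_normed_vector set"
  assumes S: "subspace S" shows "subspace (closure S)"
proof (rule subspaceI)
  show "0 \<in> closure S" using subspace_0[OF S] closure_subset by blast
next
  fix x y assume "x \<in> closure S" "y \<in> closure S"
  then obtain f g where "\<And>n. f n \<in> S" "f \<longlonglongrightarrow> x" "\<And>n. g n \<in> S" "g \<longlonglongrightarrow> y"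
    unfolding closure_sequential by blast
  then show "x + y \<in> closure S"
    unfolding closure_sequential
    by (intro exI[of _ "\<lambda>n. f n + g n"]) (auto intro: tendsto_add subspace_add[OF S])
next
  fix x and c :: real assume "x \<in> closure S"
  then obtain f where "\<And>n. f n \<in> S" "f \<longlonglongrightarrow> x" unfolding closure_sequential by blast
  then show "c *\<^sub>R x \<in> closure S"
    unfolding closure_sequential
    by (intro exI[of _ "\<lambda>n. c *\<^sub>R f n"]) (auto intro: tendsto_scaleR subspace_scale[OF S])
qed

lemma has_sum_normI:
  fixes f :: "nat \<Rightarrow> 'v::real_normed_vector"
  assumes "\<And>\<epsilon>. 0 < \<epsilon> \<Longrightarrow> \<exists>S0. finite S0 \<and> (\<forall>S. finite S \<longrightarrow> S0 \<subseteq> S \<longrightarrow> norm (x - sum f S) \<le> \<epsilon>)"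
  shows "(f has_sum x) UNIV"
  unfolding has_sum_def tendsto_iff
proof (intro allI impI)
  fix \<epsilon> :: real assume "0 < \<epsilon>"
  then obtain S0 where S0: "finite S0" "\<And>S. finite S \<Longrightarrow> S0 \<subseteq> S \<Longrightarrow> norm (x - sum f S) \<le> \<epsilon> / 2"
    using assms[of "\<epsilon> / 2"] by auto
  then show "\<forall>\<^sub>F S in finite_subsets_at_top UNIV. dist (sum f S) x < \<epsilon>"
    unfolding eventually_finite_subsets_at_top
    using \<open>0 < \<epsilon>\<close> by (intro exI[of _ S0]) (fastforce simp: dist_norm norm_minus_commute)
qed

lemma has_sum_normD:
  fixes f :: "nat \<Rightarrow> 'v::real_normed_vector"
  assumes "(f has_sum x) UNIV" "0 < \<epsilon>"
  obtains S0 where "finite S0" "\<And>S. finite S \<Longrightarrow> S0 \<subseteq> S \<Longrightarrow> norm (x - sum f S) < \<epsilon>"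
proof -
  have "\<forall>\<^sub>F S in finite_subsets_at_top UNIV. dist (sum f S) x < \<epsilon>"
    using assms unfolding has_sum_def tendsto_iff by blast
  then obtain S0 where "finite S0" "\<forall>S. finite S \<and> S0 \<subseteq> S \<and> S \<subseteq> UNIV \<longrightarrow> dist (sum f S) x < \<epsilon>"
    unfolding eventually_finite_subsets_at_top by auto
  then show ?thesis using that[of S0] by (auto simp: dist_norm norm_minus_commute)
qed

text \<open>The index set is kept variable: it will be all naturals for the amalgam, and a clique of
  nodes for sequences inside a member of the family.\<close>

locale unconditional_seq =
  fixes y :: "nat \<Rightarrow> 'v::real_normed_vector" and I :: "nat set" and Kc :: real
  assumes y_nz: "n \<in> I \<Longrightarrow> y n \<noteq> 0"
    and unc: "finite T \<Longrightarrow> T \<subseteq> I \<Longrightarrow> S \<subseteq> T \<Longrightarrow> norm (\<Sum>n\<in>S. a n *\<^sub>R y n) \<le> Kc * norm (\<Sum>n\<in>T. a n *\<^sub>R y n)"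
    and Kc: "0 < Kc"
begin

lemma unc_fs: "a \<in> fs_on I \<Longrightarrow> finite S \<Longrightarrow> S \<subseteq> I \<Longrightarrow> norm (\<Sum>n\<in>S. a n *\<^sub>R y n) \<le> Kc * norm (lincomb y a)"
  using unc[of "S \<union> supp a" S a] lincomb_eq[of "S \<union> supp a" a y] by (auto simp: fs_on_def fs_def)

text \<open>Coordinates are bounded by the norm of the combination, so they converge. The estimate
  for finite parts of \<open>z l - z k\<close> is uniform in the part and passes to the limit in
  \<open>l\<close>.\<close>

lemma expansion:
  assumes z: "\<And>k. z k \<in> fs_on I" and lim: "(\<lambda>k. lincomb y (z k)) \<longlonglongrightarrow> x"
  obtains a where "supp a \<subseteq> I" "\<And>n. (\<lambda>k. z k n) \<longlonglongrightarrow> a n" "((\<lambda>n. a n *\<^sub>R y n) has_sum x) UNIV"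
proof -
  have zfs: "z k \<in> fs" "supp (z k) \<subseteq> I" for k using z by (auto simp: fs_on_def)
  have zd: "(\<lambda>n. z l n - z k n) \<in> fs_on I" for k l
    using order_trans[OF supp_diff[of "z l" "z k"]] fs_diff zfs by (simp add: fs_on_def)
  have cau: "\<exists>k0. \<forall>k\<ge>k0. \<forall>l\<ge>k0. norm (lincomb y (z l) - lincomb y (z k)) < \<epsilon>" if "0 < \<epsilon>" for \<epsilon>
    using LIMSEQ_imp_Cauchy[OF lim] that unfolding Cauchy_iff by blast
  have diffS: "norm (\<Sum>n\<in>S. (z l n - z k n) *\<^sub>R y n) \<le> Kc * norm (lincomb y (z l) - lincomb y (z k))"
    if "finite S" "S \<subseteq> I" for S k l
    using unc_fs[OF zd that] lincomb_diff[OF zfs(1) zfs(1)] by metis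
  have "convergent (\<lambda>k. z k n)" for n
  proof (cases "n \<in> I")
    case False
    then have "z k n = 0" for k using zfs(2)[of k] by (auto simp: supp_def)
    then show ?thesis by (simp add: convergent_const)
  next
    case True
    have "Cauchy (\<lambda>k. z k n)"
      unfolding Cauchy_iff
    proof (intro allI impI)
      fix \<epsilon> :: real assume \<epsilon>: "0 < \<epsilon>"
      have "0 < \<epsilon> * norm (y n) / Kc" using \<epsilon> Kc y_nz[OF True] by simp
      then obtain k0 where k0: "\<And>k l. k \<ge> k0 \<Longrightarrow> l \<ge> k0 \<Longrightarrow> norm (lincomb y (z l) - lincomb y (z k)) < \<epsilon> * norm (y n) / Kc"
        using cau by blast
      have "norm (z l n - z k n) < \<epsilon>" if "k \<ge> k0" "l \<ge> k0" for k l
      proof -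
        have "norm (z l n - z k n) * norm (y n) \<le> Kc * norm (lincomb y (z l) - lincomb y (z k))"
          using diffS[of "{n}" l k] True by simp
        also have "\<dots> < Kc * (\<epsilon> * norm (y n) / Kc)" using k0[OF that] Kc by (intro mult_strict_left_mono) auto
        finally show ?thesis using Kc y_nz[OF True] by simp
      qed
      then show "\<exists>M. \<forall>m\<ge>M. \<forall>n'\<ge>M. norm (z m n - z n' n) < \<epsilon>" by blast
    qed
    then show ?thesis by (rule real_Cauchy_convergent)
  qed
  then obtain a where a: "\<And>n. (\<lambda>k. z k n) \<longlonglongrightarrow> a n" unfolding convergent_def by metis
  have suppa: "supp a \<subseteq> I"
  proof
    fix n assume n: "n \<in> supp a"
    show "n \<in> I"
    proof (rule ccontr)
      assume "n \<notin> I"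
      then have "z k n = 0" for k using zfs(2)[of k] by (auto simp: supp_def)
      then have "a n = 0" using a[of n] LIMSEQ_unique[of "\<lambda>_. 0 :: real" 0 "a n"] by simp
      then show False using n by (simp add: supp_def)
    qed
  qed
  have "((\<lambda>n. a n *\<^sub>R y n) has_sum x) UNIV"
  proof (rule has_sum_normI)
    fix \<epsilon> :: real assume "0 < \<epsilon>"
    \<comment> \<open>The error consists of \<delta> for approximating \<open>x\<close> by the
      combination of \<open>z k0\<close>, and of \<open>Kc * \<delta>\<close> for the finite part of
      the difference of coefficients.\<close>
    define \<delta> where "\<delta> = \<epsilon> / (1 + Kc)"
    have \<delta>: "0 < \<delta>" "\<delta> + Kc * \<delta> = \<epsilon>" 
    proof -
      have "\<delta> * (1 + Kc) = \<epsilon>" using Kc by (simp add: \<delta>_def)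
      then show "\<delta> + Kc * \<delta> = \<epsilon>" by (simp add: algebra_simps)
    qed (use \<open>0 < \<epsilon>\<close> Kc in \<open>simp add: \<delta>_def\<close>)
    obtain k0 where k0: "\<And>k l. k \<ge> k0 \<Longrightarrow> l \<ge> k0 \<Longrightarrow> norm (lincomb y (z l) - lincomb y (z k)) < \<delta>"
      using cau[OF \<delta>(1)] by blast
    have x: "norm (x - lincomb y (z k0)) \<le> \<delta>"
    proof (rule LIMSEQ_le_const2)
      show "(\<lambda>l. norm (lincomb y (z l) - lincomb y (z k0))) \<longlonglongrightarrow> norm (x - lincomb y (z k0))"
        by (intro tendsto_intros lim)
      show "\<exists>N. \<forall>l\<ge>N. norm (lincomb y (z l) - lincomb y (z k0)) \<le> \<delta>" using k0 by (meson less_imp_le order_refl)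
    qed
    have fin: "norm (\<Sum>n\<in>S. (a n - z k0 n) *\<^sub>R y n) \<le> Kc * \<delta>" if "finite S" "S \<subseteq> I" for S
    proof (rule LIMSEQ_le_const2)
      show "(\<lambda>l. norm (\<Sum>n\<in>S. (z l n - z k0 n) *\<^sub>R y n)) \<longlonglongrightarrow> norm (\<Sum>n\<in>S. (a n - z k0 n) *\<^sub>R y n)"
        by (intro tendsto_intros a)
      show "\<exists>N. \<forall>l\<ge>N. norm (\<Sum>n\<in>S. (z l n - z k0 n) *\<^sub>R y n) \<le> Kc * \<delta>"
      proof (intro exI allI impI)
        fix l assume "l \<ge> k0"
        then have "Kc * norm (lincomb y (z l) - lincomb y (z k0)) \<le> Kc * \<delta>"
          using k0[of k0 l] Kc by (intro mult_left_mono) auto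
        then show "norm (\<Sum>n\<in>S. (z l n - z k0 n) *\<^sub>R y n) \<le> Kc * \<delta>" using diffS[OF that, of l k0] by linarith
      qed
    qed
    show "\<exists>S0. finite S0 \<and> (\<forall>S. finite S \<longrightarrow> S0 \<subseteq> S \<longrightarrow> norm (x - (\<Sum>n\<in>S. a n *\<^sub>R y n)) \<le> \<epsilon>)"
    proof (intro exI conjI allI impI)
      show "finite (supp (z k0))" using zfs by (simp add: fs_def)
      fix S assume S: "finite S" "supp (z k0) \<subseteq> S"
      have 1: "(\<Sum>n\<in>S. a n *\<^sub>R y n) = (\<Sum>n\<in>S \<inter> I. a n *\<^sub>R y n)"
        using S suppa by (intro sum.mono_neutral_right) (auto simp: supp_def)
      have 2: "lincomb y (z k0) = (\<Sum>n\<in>S \<inter> I. z k0 n *\<^sub>R y n)" using S zfs(2) by (intro lincomb_eq) auto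
      have "x - (\<Sum>n\<in>S. a n *\<^sub>R y n) = (x - lincomb y (z k0)) - (\<Sum>n\<in>S \<inter> I. (a n - z k0 n) *\<^sub>R y n)"
        unfolding 1 2 by (simp add: scaleR_diff_left sum_subtractf)
      also have "norm \<dots> \<le> \<delta> + Kc * \<delta>"
        by (rule order_trans[OF norm_triangle_ineq4 add_mono[OF x fin]]) (use S in auto)
      finally show "norm (x - (\<Sum>n\<in>S. a n *\<^sub>R y n)) \<le> \<epsilon>" using \<delta> by simp
    qed
  qed
  with a suppa show ?thesis using that by blast
qed

lemma closure_expansion:
  assumes "x \<in> closure (lincomb y ` fs_on I)"
  obtains a where "supp a \<subseteq> I" "((\<lambda>n. a n *\<^sub>R y n) has_sum x) UNIV"
proof -
  obtain f where f: "\<And>k. f k \<in> lincomb y ` fs_on I" "f \<longlonglongrightarrow> x" using assms unfolding closure_sequential by blast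
  from f(1) have "\<forall>k. \<exists>w. w \<in> fs_on I \<and> f k = lincomb y w" by blast
  then obtain z where z: "\<forall>k. z k \<in> fs_on I \<and> f k = lincomb y (z k)"
    by (rule choice[THEN exE])
  then have "f = (\<lambda>k. lincomb y (z k))" by (simp add: fun_eq_iff)
  then have lim: "(\<lambda>k. lincomb y (z k)) \<longlonglongrightarrow> x" using f(2) by (rule ssubst[of _ _ "\<lambda>g. g \<longlonglongrightarrow> x", OF sym])
  obtain a where "supp a \<subseteq> I" "((\<lambda>n. a n *\<^sub>R y n) has_sum x) UNIV"
    by (rule expansion[OF _ lim]) (use z in blast)+
  then show ?thesis by (rule that)
qed

end

locale unconditional_basic = unconditional_seq y UNIV Kc for y :: "nat \<Rightarrow> 'v::real_normed_vector" and Kc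
begin

abbreviation "Y \<equiv> closure (lincomb y ` fs)"

lemma fs_on_UNIV [simp]: "fs_on UNIV = fs" by (simp add: fs_on_def)

lemma partial_le:
  assumes "((\<lambda>n. a n *\<^sub>R y n) has_sum x) UNIV" "finite S"
  shows "norm (\<Sum>n\<in>S. a n *\<^sub>R y n) \<le> Kc * norm x"
proof (rule field_le_epsilon)
  fix \<epsilon> :: real assume "0 < \<epsilon>"
  then have "0 < \<epsilon> / Kc" using Kc by simp
  from has_sum_normD[OF assms(1) this] obtain S0
    where S0: "finite S0" "\<And>S. finite S \<Longrightarrow> S0 \<subseteq> S \<Longrightarrow> norm (x - (\<Sum>n\<in>S. a n *\<^sub>R y n)) < \<epsilon> / Kc" by metis
  have "norm (\<Sum>n\<in>S. a n *\<^sub>R y n) \<le> Kc * norm (\<Sum>n\<in>S \<union> S0. a n *\<^sub>R y n)"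
    using S0 assms by (intro unc) auto
  also have "\<dots> \<le> Kc * (norm x + \<epsilon> / Kc)"
  proof (intro mult_left_mono)
    have "norm (x - (\<Sum>n\<in>S \<union> S0. a n *\<^sub>R y n)) < \<epsilon> / Kc" using S0 assms by auto
    then show "norm (\<Sum>n\<in>S \<union> S0. a n *\<^sub>R y n) \<le> norm x + \<epsilon> / Kc"
      using norm_triangle_ineq3[of x "\<Sum>n\<in>S \<union> S0. a n *\<^sub>R y n"] by linarith
  qed (use Kc in simp)
  finally show "norm (\<Sum>n\<in>S. a n *\<^sub>R y n) \<le> Kc * norm x + \<epsilon>" using Kc by (simp add: distrib_left)
qed

lemma sums_zero_coeff:
  assumes "(\<lambda>n. a n *\<^sub>R y n) sums 0" shows "a n = 0"
proof -
  have lim: "(\<lambda>m. Kc * norm (\<Sum>k<m. a k *\<^sub>R y k)) \<longlonglongrightarrow> Kc * norm (0::'v)"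
    using assms unfolding sums_def by (intro tendsto_intros)
  have "norm (a n *\<^sub>R y n) \<le> Kc * norm (\<Sum>k<m. a k *\<^sub>R y k)" if "m \<ge> Suc n" for m
    using unc[of "{..<m}" "{n}" a] that by simp
  then have "norm (a n *\<^sub>R y n) \<le> Kc * norm (0::'v)" by (intro LIMSEQ_le_const[OF lim]) blast
  then have "\<bar>a n\<bar> * norm (y n) = 0" by (intro antisym) auto
  then show ?thesis using y_nz[of n] by simp
qed

lemma sums_unique_coeff:
  assumes "(\<lambda>n. a n *\<^sub>R y n) sums x" "(\<lambda>n. b n *\<^sub>R y n) sums x" shows "a = b"
proof
  fix n
  have "(\<lambda>n. (a n - b n) *\<^sub>R y n) sums (x - x)"
    unfolding scaleR_diff_left by (intro sums_diff assms)
  then have "a n - b n = 0" using sums_zero_coeff[of "\<lambda>n. a n - b n"] by simp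
  then show "a n = b n" by simp
qed

lemma has_sum_coeff_unique:
  assumes "((\<lambda>n. a n *\<^sub>R y n) has_sum x) UNIV" "((\<lambda>n. b n *\<^sub>R y n) has_sum x) UNIV" shows "a = b"
  using assms by (intro sums_unique_coeff has_sum_imp_sums)

definition coef :: "'v \<Rightarrow> nat \<Rightarrow> real"
  where "coef x = (SOME a. ((\<lambda>n. a n *\<^sub>R y n) has_sum x) UNIV)"

lemma coef_has_sum: "x \<in> Y \<Longrightarrow> ((\<lambda>n. coef x n *\<^sub>R y n) has_sum x) UNIV"
proof -
  assume "x \<in> Y"
  then have "\<exists>a. ((\<lambda>n. a n *\<^sub>R y n) has_sum x) UNIV"
    using closure_expansion[of x] unfolding fs_on_UNIV by blast
  then show ?thesis unfolding coef_def by (rule someI_ex)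
qed

lemma coef_eq: "((\<lambda>n. a n *\<^sub>R y n) has_sum x) UNIV \<Longrightarrow> coef x = a"
  unfolding coef_def by (rule some_equality) (auto intro: has_sum_coeff_unique)

lemma coef_add: "x \<in> Y \<Longrightarrow> x' \<in> Y \<Longrightarrow> coef (x + x') = (\<lambda>n. coef x n + coef x' n)"
  by (rule coef_eq) (simp add: scaleR_add_left has_sum_add coef_has_sum)

lemma coef_scale: "x \<in> Y \<Longrightarrow> coef (r *\<^sub>R x) = (\<lambda>n. r * coef x n)"
  by (rule coef_eq) (use has_sum_scaleR[OF coef_has_sum, of x r] in simp)

lemma subspace_Y: "subspace Y"
  using subspace_closure[OF subspace_lincomb[of y UNIV]] by simp

lemma y_in: "y n \<in> Y"
proof -
  have "lincomb y (unit n 1) \<in> lincomb y ` fs" by simp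
  then have "lincomb y (unit n 1) \<in> Y" by (rule subsetD[OF closure_subset])
  then show ?thesis by (simp add: lincomb_unit)
qed

lemma coef_bound: "x \<in> Y \<Longrightarrow> \<bar>coef x n\<bar> * norm (y n) \<le> Kc * norm x"
  using partial_le[OF coef_has_sum, of x "{n}"] by simp

end

lemma unconditional_basisI:
  fixes y :: "nat \<Rightarrow> C2N"
  assumes "unconditional_basic y Kc"
  shows "unconditional_basis (closure (lincomb y ` fs)) y"
proof -
  interpret unconditional_basic y Kc by (rule assms)
  have ex: "(\<lambda>n. coef x n *\<^sub>R y n) sums x" if "x \<in> Y" for x
    by (rule has_sum_imp_sums[OF coef_has_sum[OF that]])
  have "schauder_basis Y y"
    unfolding schauder_basis_def
  proof (intro conjI allI ballI ex1I)
    show "y n \<in> Y" for n by (rule y_in)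
    show "(\<lambda>n. coef x n *\<^sub>R y n) sums x" if "x \<in> Y" for x by (rule ex[OF that])
    show "a = coef x" if "x \<in> Y" "(\<lambda>n. a n *\<^sub>R y n) sums x" for x a
      by (rule sums_unique_coeff[OF that(2) ex[OF that(1)]])
  qed
  moreover have "((\<lambda>n. a n *\<^sub>R y n) has_sum x) UNIV" if "x \<in> Y" "(\<lambda>n. a n *\<^sub>R y n) sums x" for x a
    using coef_has_sum[OF that(1)] sums_unique_coeff[OF that(2) ex[OF that(1)]] by simp
  ultimately show ?thesis unfolding unconditional_basis_def by blast
qed

text \<open>Gliding hump: a bound for the supports chosen so far is carried along with each object,
  and the next object starts beyond it.\<close>

lemma disjoint_sequence:
  fixes s :: "'o \<Rightarrow> nat set"
  assumes ex: "\<And>m. \<exists>x. P x \<and> finite (s x) \<and> s x \<subseteq> {m..}"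
  obtains f :: "nat \<Rightarrow> 'o" where "\<And>j. P (f j)" "\<And>j. finite (s (f j))" "\<And>j k. j \<noteq> k \<Longrightarrow> s (f j) \<inter> s (f k) = {}"
proof -
  have "\<exists>g. \<forall>n. (P (fst (g n)) \<and> finite (s (fst (g n))) \<and> s (fst (g n)) \<subseteq> {..<snd (g n)}) \<and>
     (snd (g n) \<le> snd (g (Suc n)) \<and> s (fst (g (Suc n))) \<subseteq> {snd (g n)..})"
  proof (rule dependent_nat_choice)
    obtain x where "P x" "finite (s x)" using ex by blast
    then show "\<exists>g. P (fst g) \<and> finite (s (fst g)) \<and> s (fst g) \<subseteq> {..<snd g}"
      using finite_nat_iff_bounded[of "s x"] by (auto intro!: exI[of _ x])
  next
    fix g :: "'o \<times> nat" and n :: nat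
    obtain x where x: "P x" "finite (s x)" "s x \<subseteq> {snd g..}" using ex by blast
    then obtain b where "s x \<subseteq> {..<b}" using finite_nat_iff_bounded by blast
    with x show "\<exists>g'. (P (fst g') \<and> finite (s (fst g')) \<and> s (fst g') \<subseteq> {..<snd g'}) \<and> snd g \<le> snd g' \<and> s (fst g') \<subseteq> {snd g..}"
      by (intro exI[of _ "(x, max b (snd g))"]) auto
  qed
  then obtain g where g: "\<And>n. P (fst (g n))" "\<And>n. finite (s (fst (g n)))" "\<And>n. s (fst (g n)) \<subseteq> {..<snd (g n)}"
    "\<And>n. snd (g n) \<le> snd (g (Suc n))" "\<And>n. s (fst (g (Suc n))) \<subseteq> {snd (g n)..}" by blast
  have mono: "snd (g i) \<le> snd (g j)" if "i \<le> j" for i j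
    using that by (rule lift_Suc_mono_le[of "\<lambda>n. snd (g n)", rotated]) (rule g(4))
  have dis: "s (fst (g i)) \<inter> s (fst (g j)) = {}" if ij: "i < j" for i j
  proof -
    obtain j' where j': "j = Suc j'" "i \<le> j'" using ij by (cases j) auto
    have "s (fst (g j)) \<subseteq> {snd (g i)..}" using g(5)[of j'] mono[OF j'(2)] j'(1) by auto
    then show ?thesis using g(3)[of i] by force
  qed
  have "s (fst (g i)) \<inter> s (fst (g j)) = {}" if "i \<noteq> j" for i j
    using dis[of i j] dis[of j i] that by (cases i j rule: linorder_cases) auto
  then show ?thesis using that[of "\<lambda>n. fst (g n)"] g by blast
qed

text \<open>The library makes \<open>bcontfun\<close> an instance of \<open>complete_space\<close> only over metric domains.\<close>

lemma Cauchy_convergent_C2N: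
  fixes f :: "nat \<Rightarrow> C2N"
  assumes f: "Cauchy f" shows "convergent f"
proof -
  have "\<forall>e>0. \<exists>M. \<forall>m n x. M \<le> m \<and> M \<le> n \<and> True \<longrightarrow> dist (f m x) (f n x) < e"
    using f unfolding Cauchy_def by (meson dist_fun_lt_imp_dist_val_lt)
  then obtain g where g: "\<And>e. 0 < e \<Longrightarrow> \<exists>N. \<forall>n x. N \<le> n \<longrightarrow> dist (f n x) (g x) < e"
    using uniformly_convergent_eq_cauchy[of "\<lambda>_. True" "\<lambda>n. apply_bcontfun (f n)"] by auto
  then have "uniform_limit UNIV (\<lambda>n. apply_bcontfun (f n)) g sequentially"
    unfolding uniform_limit_sequentially_iff by blast
  then obtain l :: C2N where "f \<longlonglongrightarrow> l"
    by (rule uniform_limit_bcontfunE) simp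
  then show ?thesis by (rule convergentI)
qed

section \<open>Dual spaces and dual norms\<close>

lemma dual_norm_upper:
  assumes \<phi>: "\<phi> \<in> dual X" and x: "x \<in> X" "norm x \<le> 1"
  shows "\<bar>\<phi> x\<bar> \<le> dual_norm X \<phi>"
proof -
  obtain K where K: "\<And>x. x \<in> X \<Longrightarrow> \<bar>\<phi> x\<bar> \<le> K * norm x" using \<phi> unfolding dual_def by blast
  have "bdd_above ((\<lambda>x. \<bar>\<phi> x\<bar>) ` {x \<in> X. norm x \<le> 1})"
  proof (rule bdd_aboveI2)
    fix z assume "z \<in> {x \<in> X. norm x \<le> 1}"
    then have z: "z \<in> X" "norm z \<le> 1" by auto
    have "K * norm z \<le> \<bar>K\<bar> * 1" using z by (intro mult_mono) auto
    then show "\<bar>\<phi> z\<bar> \<le> \<bar>K\<bar>" using K[OF z(1)] by simp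
  qed
  then show ?thesis unfolding dual_norm_def using x by (intro cSUP_upper) auto
qed

lemma dual_norm_le:
  assumes "X \<noteq> {}" "0 \<in> X" "\<And>x. x \<in> X \<Longrightarrow> norm x \<le> 1 \<Longrightarrow> \<bar>\<phi> x\<bar> \<le> c"
  shows "dual_norm X \<phi> \<le> c"
  unfolding dual_norm_def using assms by (intro cSUP_least) auto

lemma dualI:
  assumes "\<And>x y. x \<in> X \<Longrightarrow> y \<in> X \<Longrightarrow> \<phi> (x + y) = \<phi> x + \<phi> y"
    "\<And>x r. x \<in> X \<Longrightarrow> \<phi> (r *\<^sub>R x) = r * \<phi> x" "\<And>x. x \<in> X \<Longrightarrow> \<bar>\<phi> x\<bar> \<le> K * norm x" "\<And>x. x \<notin> X \<Longrightarrow> \<phi> x = 0"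
  shows "\<phi> \<in> dual X"
  unfolding dual_def using assms by blast

lemma dualD:
  assumes "\<phi> \<in> dual X"
  shows "x \<in> X \<Longrightarrow> y \<in> X \<Longrightarrow> \<phi> (x + y) = \<phi> x + \<phi> y" "x \<in> X \<Longrightarrow> \<phi> (r *\<^sub>R x) = r * \<phi> x" "x \<notin> X \<Longrightarrow> \<phi> x = 0"
  using assms unfolding dual_def by blast+

lemma dual_bounded:
  assumes "\<phi> \<in> dual X" obtains K where "0 < K" "\<And>x. x \<in> X \<Longrightarrow> \<bar>\<phi> x\<bar> \<le> K * norm x"
proof -
  obtain K where K: "\<And>x. x \<in> X \<Longrightarrow> \<bar>\<phi> x\<bar> \<le> K * norm x" using assms unfolding dual_def by blast
  have "\<bar>\<phi> x\<bar> \<le> (\<bar>K\<bar> + 1) * norm x" if "x \<in> X" for x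
    by (rule order_trans[OF K[OF that] mult_right_mono]) auto
  then show ?thesis using that[of "\<bar>K\<bar> + 1"] by simp
qed

lemma dual_add: "\<phi> \<in> dual X \<Longrightarrow> \<psi> \<in> dual X \<Longrightarrow> (\<lambda>z. \<phi> z + \<psi> z) \<in> dual X"
proof -
  assume *: "\<phi> \<in> dual X" "\<psi> \<in> dual X"
  obtain K where K: "\<And>x. x \<in> X \<Longrightarrow> \<bar>\<phi> x\<bar> \<le> K * norm x" using dual_bounded[OF *(1)] by blast
  obtain L where L: "\<And>x. x \<in> X \<Longrightarrow> \<bar>\<psi> x\<bar> \<le> L * norm x" using dual_bounded[OF *(2)] by blast
  show ?thesis
    by (rule dualI[where K = "K + L"])
      (simp_all add: dualD[OF *(1)] dualD[OF *(2)] algebra_simps order_trans[OF abs_triangle_ineq add_mono[OF K L]])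
qed

lemma dual_scale: "\<phi> \<in> dual X \<Longrightarrow> (\<lambda>z. r * \<phi> z) \<in> dual X"
proof -
  assume *: "\<phi> \<in> dual X"
  obtain K where K: "\<And>x. x \<in> X \<Longrightarrow> \<bar>\<phi> x\<bar> \<le> K * norm x" using dual_bounded[OF *(1)] by blast
  have "\<bar>r * \<phi> x\<bar> \<le> \<bar>r\<bar> * K * norm x" if "x \<in> X" for x
    using mult_left_mono[OF K[OF that], of "\<bar>r\<bar>"] by (simp add: abs_mult algebra_simps)
  then show ?thesis
    by (intro dualI[where K = "\<bar>r\<bar> * K"]) (simp_all add: dualD[OF *] algebra_simps)
qed

section \<open>James's criterion for the realized space\<close>

locale realized_norm = solid_norm q for q +
  fixes e :: "nat \<Rightarrow> C2N"
  assumes norm_e: "finite S \<Longrightarrow> norm (\<Sum>n\<in>S. a n *\<^sub>R e n) = q (restr S a)"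
begin

sublocale unconditional_basic e 1
proof
  show "e n \<noteq> 0" for n
  proof -
    have "norm (e n) = q (restr {n} (\<lambda>_. 1))" using norm_e[of "{n}" "\<lambda>_. 1"] by simp
    also have "\<dots> > 0" by (rule q_pos[of _ n]) (simp_all, simp add: restr_def)
    finally show ?thesis by simp
  qed
  show "norm (\<Sum>n\<in>S. a n *\<^sub>R e n) \<le> 1 * norm (\<Sum>n\<in>T. a n *\<^sub>R e n)" if "finite T" "S \<subseteq> T" for S T a
  proof -
    have "q (restr S a) \<le> q (restr T a)"
      by (rule q_mono[OF restr_fs[OF that(1)]]) (use that(2) in \<open>auto simp: restr_def\<close>)
    then show ?thesis using that finite_subset[OF that(2,1)] by (simp add: norm_e)
  qed
qed simp

definition funct :: "(nat \<Rightarrow> real) \<Rightarrow> nat set \<Rightarrow> C2N \<Rightarrow> real"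
  where "funct b S x = (if x \<in> Y then \<Sum>n\<in>S. b n * coef x n else 0)"

lemma zero_in_Y: "0 \<in> Y" using subspace_Y subspace_0 by blast

lemma funct_dual: "finite S \<Longrightarrow> funct b S \<in> dual Y"
proof (rule dualI[where K = "\<Sum>n\<in>S. \<bar>b n\<bar> / norm (e n)"])
  fix x assume x: "x \<in> Y"
  have "\<bar>\<Sum>n\<in>S. b n * coef x n\<bar> \<le> (\<Sum>n\<in>S. \<bar>b n\<bar> / norm (e n) * norm x)"
  proof (rule order_trans[OF sum_abs sum_mono])
    fix n
    have "\<bar>coef x n\<bar> \<le> norm x / norm (e n)" using coef_bound[OF x, of n] y_nz[of n] by (simp add: field_simps)
    then show "\<bar>b n * coef x n\<bar> \<le> \<bar>b n\<bar> / norm (e n) * norm x"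
      using mult_left_mono[of "\<bar>coef x n\<bar>" "norm x / norm (e n)" "\<bar>b n\<bar>"] by (simp add: abs_mult)
  qed
  then show "\<bar>funct b S x\<bar> \<le> (\<Sum>n\<in>S. \<bar>b n\<bar> / norm (e n)) * norm x"
    using x by (simp add: funct_def sum_distrib_right)
qed (use subspace_Y in \<open>auto simp: funct_def coef_add coef_scale subspace_add subspace_scale sum.distrib sum_distrib_left algebra_simps\<close>)

lemma partial_q: "x \<in> Y \<Longrightarrow> finite S \<Longrightarrow> q (restr S (coef x)) \<le> norm x"
  using partial_le[OF coef_has_sum, of x S] by (simp add: norm_e)

lemma funct_le:
  assumes b: "\<And>c. c \<in> fs \<Longrightarrow> dot c b \<le> q c" and x: "x \<in> Y" and S: "finite S"
  shows "\<bar>funct b S x\<bar> \<le> norm x"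
proof -
  have "dot (\<lambda>n. r * restr S (coef x) n) b \<le> norm x" if "\<bar>r\<bar> = 1" for r
    using b[OF fs_scale[OF restr_fs[OF S]], of r "coef x"] partial_q[OF x S] that
    by (simp add: q_scale S)
  from this[of 1] this[of "-1"] have "\<bar>dot (restr S (coef x)) b\<bar> \<le> norm x"
    using dot_scale[OF restr_fs[OF S], of "-1" "coef x" b] by (simp add: abs_le_iff)
  then show ?thesis using x S by (simp add: funct_def dot_restr mult.commute)
qed

text \<open>Otherwise a gliding hump produces disjoint blocks of norm at least \<epsilon>; division
  by \<open>M\<close> gives the normalization of \<open>boundedly_complete\<close>.\<close>

lemma tails_bounded:
  assumes \<alpha>: "\<And>S. finite S \<Longrightarrow> q (restr S \<alpha>) \<le> M" and M: "0 < M" and \<epsilon>: "0 < \<epsilon>"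
  obtains m where "\<And>S. finite S \<Longrightarrow> S \<subseteq> {m..} \<Longrightarrow> q (restr S \<alpha>) \<le> \<epsilon>"
proof (rule ccontr)
  assume contr: "\<not> thesis"
  have "\<exists>S. \<epsilon> \<le> q (restr S \<alpha>) \<and> finite S \<and> S \<subseteq> {m..}" for m
  proof (rule ccontr)
    assume "\<not> ?thesis"
    then have "q (restr S \<alpha>) \<le> \<epsilon>" if "finite S" "S \<subseteq> {m..}" for S using that by (meson linear)
    then show False using that contr by blast
  qed
  then obtain S where S: "\<And>j :: nat. \<epsilon> \<le> q (restr (S j) \<alpha>)" "\<And>j. finite (S j)" "\<And>j k. j \<noteq> k \<Longrightarrow> S j \<inter> S k = {}"
    using disjoint_sequence[where P = "\<lambda>S. \<epsilon> \<le> q (restr S \<alpha>)" and s = "\<lambda>S. S"] by metis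
  have scale: "q (restr T (\<lambda>n. \<alpha> n / M)) = q (restr T \<alpha>) / M" if "finite T" for T
  proof -
    have "restr T (\<lambda>n. \<alpha> n / M) = (\<lambda>n. (1 / M) * restr T \<alpha> n)" by (auto simp: restr_def)
    then show ?thesis using q_scale[OF restr_fs[OF that], of "1 / M" \<alpha>] M by simp
  qed
  have "\<not> (\<forall>j. \<epsilon> / M \<le> q (restr (S j) (\<lambda>n. \<alpha> n / M)))"
  proof (rule boundedly_complete)
    show "q (restr T (\<lambda>n. \<alpha> n / M)) \<le> 1" if "finite T" for T
      using \<alpha>[OF that] M by (simp add: scale[OF that])
  qed (use S \<epsilon> M in auto)
  then show False using S(1,2) M by (simp add: scale divide_right_mono)
qed

lemma bounded_converges:
  assumes \<alpha>: "\<And>S. finite S \<Longrightarrow> q (restr S \<alpha>) \<le> M" and M: "0 < M"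
  obtains x where "x \<in> Y" "coef x = \<alpha>"
proof -
  have "Cauchy (\<lambda>m. \<Sum>n<m. \<alpha> n *\<^sub>R e n)"
    unfolding Cauchy_iff
  proof (intro allI impI)
    fix \<epsilon> :: real assume \<epsilon>: "0 < \<epsilon>"
    obtain m where m: "\<And>S. finite S \<Longrightarrow> S \<subseteq> {m..} \<Longrightarrow> q (restr S \<alpha>) \<le> \<epsilon> / 2"
      using tails_bounded[OF \<alpha> M half_gt_zero[OF \<epsilon>]] by blast
    have lt: "norm ((\<Sum>n<k. \<alpha> n *\<^sub>R e n) - (\<Sum>n<l. \<alpha> n *\<^sub>R e n)) < \<epsilon>" if "m \<le> l" "l \<le> k" for k l
    proof -
      have "(\<Sum>n<k. \<alpha> n *\<^sub>R e n) - (\<Sum>n<l. \<alpha> n *\<^sub>R e n) = (\<Sum>n\<in>{l..<k}. \<alpha> n *\<^sub>R e n)"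
        using that sum_diff[of "{..<k}" "{..<l}" "\<lambda>n. \<alpha> n *\<^sub>R e n"]
        by (simp add: lessThan_minus_lessThan)
      then have "norm ((\<Sum>n<k. \<alpha> n *\<^sub>R e n) - (\<Sum>n<l. \<alpha> n *\<^sub>R e n)) \<le> \<epsilon> / 2"
        using m[of "{l..<k}"] that by (simp add: norm_e subset_eq)
      then show ?thesis using \<epsilon> by simp
    qed
    show "\<exists>M. \<forall>k\<ge>M. \<forall>l\<ge>M. norm ((\<Sum>n<k. \<alpha> n *\<^sub>R e n) - (\<Sum>n<l. \<alpha> n *\<^sub>R e n)) < \<epsilon>"
    proof (intro exI allI impI)
      fix k l assume "m \<le> k" "m \<le> l"
      then show "norm ((\<Sum>n<k. \<alpha> n *\<^sub>R e n) - (\<Sum>n<l. \<alpha> n *\<^sub>R e n)) < \<epsilon>"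
        using lt[of l k] lt[of k l] by (cases "l \<le> k") (auto simp: norm_minus_commute)
    qed
  qed
  then have "convergent (\<lambda>m. \<Sum>n<m. \<alpha> n *\<^sub>R e n)" by (rule Cauchy_convergent_C2N)
  then obtain x where x: "(\<lambda>n. \<alpha> n *\<^sub>R e n) sums x"
    unfolding sums_def convergent_def by (rule exE)
  have "x \<in> Y"
  proof (rule closed_sequentially[OF closed_closure _ x[unfolded sums_def]])
    fix m
    have "lincomb e (restr {..<m} \<alpha>) \<in> Y" by (rule subsetD[OF closure_subset]) simp
    then show "(\<Sum>n<m. \<alpha> n *\<^sub>R e n) \<in> Y" by (simp add: lincomb_restr)
  qed
  then show ?thesis using that[of x] sums_unique_coeff[OF has_sum_imp_sums[OF coef_has_sum] x] by simp
qed

text \<open>Shrinking in its usual sense: the truncations of \<phi> converge to it in the dual norm.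
  Otherwise \<phi> is large on vectors of the unit ball supported arbitrarily far out, and these can
  be chosen finite and disjoint.\<close>

lemma functional_tails:
  assumes \<phi>: "\<phi> \<in> dual Y" and \<epsilon>: "0 < \<epsilon>"
  obtains m where "\<And>k x. m \<le> k \<Longrightarrow> x \<in> Y \<Longrightarrow> norm x \<le> 1 \<Longrightarrow> \<bar>\<phi> x - funct (\<lambda>n. \<phi> (e n)) {..<k} x\<bar> \<le> \<epsilon>"
proof (rule ccontr)
  assume contr: "\<not> thesis"
  note step = that
  let ?b = "\<lambda>n. \<phi> (e n)"
  obtain M where M: "0 < M" "\<And>x. x \<in> Y \<Longrightarrow> \<bar>\<phi> x\<bar> \<le> M * norm x" using dual_bounded[OF \<phi>] by blast
  have \<phi>sum: "\<phi> (\<Sum>n\<in>S. a n *\<^sub>R e n) = (\<Sum>n\<in>S. a n * ?b n) \<and> (\<Sum>n\<in>S. a n *\<^sub>R e n) \<in> Y" if "finite S" for S a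
    using that
  proof induction
    case empty
    then show ?case using dualD(2)[OF \<phi> zero_in_Y, of 0] zero_in_Y by simp
  next
    case (insert n S)
    have "a n *\<^sub>R e n \<in> Y" using y_in subspace_Y subspace_scale by blast
    then show ?case using insert subspace_add[OF subspace_Y] by (simp add: dualD[OF \<phi>] y_in)
  qed
  have bM: "dot c (\<lambda>n. ?b n / M) \<le> q c" if c: "c \<in> fs" for c
  proof -
    have "dot c (\<lambda>n. ?b n / M) = \<phi> (\<Sum>n\<in>supp c. c n *\<^sub>R e n) / M"
      using \<phi>sum[OF fsD[OF c]] by (simp add: dot_def sum_divide_distrib)
    also have "\<dots> \<le> norm (\<Sum>n\<in>supp c. c n *\<^sub>R e n)"
      using M(2)[of "\<Sum>n\<in>supp c. c n *\<^sub>R e n"] \<phi>sum[OF fsD[OF c]] M(1) by (simp add: field_simps abs_le_iff)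
    also have "\<dots> = q c" 
    proof -
      have "restr (supp c) c = c" by (auto simp: restr_def supp_def)
      then show ?thesis using norm_e[OF fsD[OF c], of c] by simp
    qed
    finally show ?thesis .
  qed
  have "\<exists>y. (y \<in> fs \<and> q y \<le> 1 \<and> \<epsilon> / M \<le> dot y (\<lambda>n. ?b n / M)) \<and> finite (supp y) \<and> supp y \<subseteq> {m..}" for m
  proof -
    obtain k x where k: "m \<le> k" "x \<in> Y" "norm x \<le> 1" "\<epsilon> < \<bar>\<phi> x - funct ?b {..<k} x\<bar>"
      using contr step[of m] by (meson not_le)
    \<comment> \<open>By continuity of \<phi>, cutting the expansion of \<open>x\<close> at a late
      \<open>l\<close> turns the tail from \<open>k\<close> on into the finite block
      \<open>z\<close>.\<close>
    have "(\<lambda>l. \<Sum>n<l. coef x n *\<^sub>R e n) \<longlonglongrightarrow> x"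
      using has_sum_imp_sums[OF coef_has_sum[OF k(2)]] by (simp add: sums_def)
    then have lim: "(\<lambda>l. \<phi> (\<Sum>n<l. coef x n *\<^sub>R e n)) \<longlonglongrightarrow> \<phi> x"
    proof (subst LIM_zero_iff[symmetric], elim LIM_zero[THEN tendsto_norm_zero, THEN tendsto_mult_right_zero[of _ _ M], THEN Lim_null_comparison[rotated]])
      show "\<forall>\<^sub>F l in sequentially. norm (\<phi> (\<Sum>n<l. coef x n *\<^sub>R e n) - \<phi> x) \<le> M * norm ((\<Sum>n<l. coef x n *\<^sub>R e n) - x)"
      proof (intro always_eventually allI)
        fix l
        let ?s = "\<Sum>n<l. coef x n *\<^sub>R e n"
        have s: "?s \<in> Y" "(-1) *\<^sub>R x \<in> Y" using \<phi>sum k(2) subspace_scale[OF subspace_Y] by blast+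
        have "\<phi> (?s + (-1) *\<^sub>R x) = \<phi> ?s - \<phi> x" unfolding dualD(1)[OF \<phi> s] dualD(2)[OF \<phi> k(2)] by simp
        then show "norm (\<phi> ?s - \<phi> x) \<le> M * norm (?s - x)"
          using M(2)[OF subspace_add[OF subspace_Y s]] by simp
      qed
    qed
    have "(\<lambda>l. \<bar>\<phi> (\<Sum>n<l. coef x n *\<^sub>R e n) - funct ?b {..<k} x\<bar>) \<longlonglongrightarrow> \<bar>\<phi> x - funct ?b {..<k} x\<bar>"
      by (intro tendsto_intros lim)
    then have "\<forall>\<^sub>F l in sequentially. \<epsilon> < \<bar>\<phi> (\<Sum>n<l. coef x n *\<^sub>R e n) - funct ?b {..<k} x\<bar>"
      using k(4) by (rule order_tendstoD)
    then obtain l where l: "k \<le> l" "\<epsilon> < \<bar>\<phi> (\<Sum>n<l. coef x n *\<^sub>R e n) - funct ?b {..<k} x\<bar>"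
    proof -
      from \<open>\<forall>\<^sub>F l in sequentially. \<epsilon> < _\<close> obtain N where
        "\<And>l. N \<le> l \<Longrightarrow> \<epsilon> < \<bar>\<phi> (\<Sum>n<l. coef x n *\<^sub>R e n) - funct ?b {..<k} x\<bar>"
        unfolding eventually_sequentially by blast
      then show ?thesis using that[of "max k N"] by simp
    qed
    define z where "z = restr {k..<l} (coef x)"
    have "\<phi> (\<Sum>n<l. coef x n *\<^sub>R e n) - funct ?b {..<k} x = (\<Sum>n<l. coef x n * ?b n) - (\<Sum>n<k. coef x n * ?b n)"
      using \<phi>sum[of "{..<l}" "coef x"] k(2) by (simp add: funct_def mult.commute)
    also have "\<dots> = dot z ?b"
      using l(1) sum_diff[of "{..<l}" "{..<k}" "\<lambda>n. coef x n * ?b n"]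
      by (simp add: lessThan_minus_lessThan z_def dot_restr)
    finally have zb: "\<epsilon> < \<bar>dot z ?b\<bar>" using l(2) by simp
    have zfs: "z \<in> fs" by (simp add: z_def)
    \<comment> \<open>The sign makes the pairing positive, since \<open>shrinking\<close> is stated
      without absolute values.\<close>
    define y where "y = (\<lambda>n. sgn (dot z ?b) * z n)"
    have "dot y (\<lambda>n. ?b n / M) = \<bar>dot z ?b\<bar> / M"
    proof -
      have "dot z (\<lambda>n. ?b n / M) = dot z ?b / M" by (simp add: dot_def sum_divide_distrib)
      then show ?thesis unfolding y_def dot_scale[OF zfs] by (simp add: abs_sgn[symmetric] mult.commute)
    qed
    then have "\<epsilon> / M \<le> dot y (\<lambda>n. ?b n / M)" using zb M(1) by (simp add: divide_right_mono)
    moreover have "q y \<le> 1"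
      using partial_q[OF k(2), of "{k..<l}"] k(3) \<epsilon> zb unfolding y_def q_scale[OF zfs]
      by (simp add: z_def abs_sgn_eq)
    moreover have "y \<in> fs" unfolding y_def by (rule fs_scale[OF zfs])
    moreover have "supp y \<subseteq> {m..}" using k(1) by (auto simp: y_def z_def supp_def restr_def split: if_splits)
    ultimately show ?thesis using fsD by blast
  qed
  then obtain y where y: "\<And>j :: nat. y j \<in> fs \<and> q (y j) \<le> 1 \<and> \<epsilon> / M \<le> dot (y j) (\<lambda>n. ?b n / M)"
    "\<And>j k. j \<noteq> k \<Longrightarrow> supp (y j) \<inter> supp (y k) = {}"
    using disjoint_sequence[where P = "\<lambda>y. y \<in> fs \<and> q y \<le> 1 \<and> \<epsilon> / M \<le> dot y (\<lambda>n. ?b n / M)" and s = supp] by metis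
  have "disj_seq y" using y(2) by (auto simp: disj_seq_def supp_def)
  then have "\<not> (\<forall>j. \<epsilon> / M \<le> dot (y j) (\<lambda>n. ?b n / M))"
    using y(1) bM \<epsilon> M(1) by (intro shrinking) auto
  then show False using y(1) by blast
qed

text \<open>The values of \<Phi> on the coordinate functionals are the coefficients of the
  representing vector. Norming functionals bound their finite parts, so the series converges by
  bounded completeness. Agreement on finite combinations of coordinate functionals extends to the
  whole dual, in which these are dense by \<open>functional_tails\<close>.\<close>

theorem reflexive_Y: "reflexive_space Y"
  unfolding reflexive_space_def
proof (intro allI impI, elim conjE exE)
  fix \<Phi> :: "(C2N \<Rightarrow> real) \<Rightarrow> real" and K
  assume add: "\<forall>\<phi>\<in>dual Y. \<forall>\<psi>\<in>dual Y. \<Phi> (\<lambda>z. \<phi> z + \<psi> z) = \<Phi> \<phi> + \<Phi> \<psi>"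
    and scale: "\<forall>\<phi>\<in>dual Y. \<forall>r. \<Phi> (\<lambda>z. r * \<phi> z) = r * \<Phi> \<phi>"
    and bound: "\<forall>\<phi>\<in>dual Y. \<bar>\<Phi> \<phi>\<bar> \<le> K * dual_norm Y \<phi>"
  define M where "M = \<bar>K\<bar> + 1"
  have M: "0 < M" by (simp add: M_def)
  have \<Phi>M: "\<bar>\<Phi> \<phi>\<bar> \<le> M * c" if \<phi>: "\<phi> \<in> dual Y" and c: "\<And>x. x \<in> Y \<Longrightarrow> norm x \<le> 1 \<Longrightarrow> \<bar>\<phi> x\<bar> \<le> c" for \<phi> c
  proof -
    have "0 \<le> dual_norm Y \<phi>" using dual_norm_upper[OF \<phi> zero_in_Y] by simp
    then have "\<bar>\<Phi> \<phi>\<bar> \<le> M * dual_norm Y \<phi>"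
      using bound \<phi> unfolding M_def by (meson abs_ge_self add_increasing2 mult_right_mono order_trans zero_le_one order_refl)
    also have "\<dots> \<le> M * c" using M zero_in_Y by (intro mult_left_mono dual_norm_le c) auto
    finally show ?thesis .
  qed
  define \<alpha> where "\<alpha> n = \<Phi> (funct (\<lambda>_. 1) {n})" for n
  have \<Phi>0: "\<Phi> (\<lambda>z. 0) = 0" using scale[rule_format, OF funct_dual[of "{}" "\<lambda>_. 0"], of 0] by simp
  have \<Phi>f: "\<Phi> (funct b S) = (\<Sum>n\<in>S. b n * \<alpha> n)" if "finite S" for b S
    using that
  proof induction
    case empty
    have "funct b {} = (\<lambda>z. 0)" by (auto simp: funct_def)
    then show ?case using \<Phi>0 by simp
  next
    case (insert n S)
    have "funct b (insert n S) = (\<lambda>z. (\<lambda>z. b n * funct (\<lambda>_. 1) {n} z) z + funct b S z)"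
      using insert by (auto simp: funct_def)
    then have "\<Phi> (funct b (insert n S)) = \<Phi> (\<lambda>z. b n * funct (\<lambda>_. 1) {n} z) + \<Phi> (funct b S)"
      using add funct_dual[OF insert(1), of b] dual_scale[OF funct_dual, of "{n}" "b n" "\<lambda>_. 1"] by simp
    also have "\<Phi> (\<lambda>z. b n * funct (\<lambda>_. 1) {n} z) = b n * \<alpha> n"
      using scale funct_dual[of "{n}" "\<lambda>_. 1"] by (simp add: \<alpha>_def)
    finally show ?case using insert by simp
  qed
  have "q (restr S \<alpha>) \<le> M" if S: "finite S" for S
  proof -
    obtain b where b: "\<And>c. c \<in> fs \<Longrightarrow> dot c b \<le> q c" "dot (restr S \<alpha>) b = q (restr S \<alpha>)"
      using norming_functional[OF restr_fs[OF S]] by blast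
    have "q (restr S \<alpha>) = \<Phi> (funct b S)" using b(2) S by (simp add: \<Phi>f dot_restr mult.commute)
    also have "\<dots> \<le> M * 1"
      using \<Phi>M[OF funct_dual[OF S], of b 1] funct_le[OF b(1) _ S] by (force simp: abs_le_iff)
    finally show ?thesis by simp
  qed
  then obtain x where x: "x \<in> Y" "coef x = \<alpha>" using bounded_converges M by blast
  have "\<Phi> \<phi> = \<phi> x" if \<phi>: "\<phi> \<in> dual Y" for \<phi>
  proof -
    have "\<bar>\<Phi> \<phi> - \<phi> x\<bar> \<le> \<epsilon>" if "0 < \<epsilon>" for \<epsilon>
    proof -
      define \<delta> where "\<delta> = \<epsilon> / (M + norm x + 1)"
      have pos: "0 < M + norm x + 1" using M by (simp add: add_pos_nonneg)
      then have \<delta>: "0 < \<delta>" using that by (simp add: \<delta>_def)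
      obtain m where m: "\<And>k x. m \<le> k \<Longrightarrow> x \<in> Y \<Longrightarrow> norm x \<le> 1 \<Longrightarrow> \<bar>\<phi> x - funct (\<lambda>n. \<phi> (e n)) {..<k} x\<bar> \<le> \<delta>"
        using functional_tails[OF \<phi> \<delta>] by blast
      let ?\<psi> = "funct (\<lambda>n. \<phi> (e n)) {..<m}"
      let ?d = "\<lambda>z. \<phi> z + (\<lambda>z. (-1) * ?\<psi> z) z"
      have \<psi>: "?\<psi> \<in> dual Y" by (intro funct_dual) simp
      have m\<psi>: "(\<lambda>z. (-1) * ?\<psi> z) \<in> dual Y" by (rule dual_scale[OF \<psi>])
      have d: "?d \<in> dual Y" by (rule dual_add[OF \<phi> m\<psi>])
      have dle: "\<bar>?d z\<bar> \<le> \<delta>" if "z \<in> Y" "norm z \<le> 1" for z using m[OF order_refl that] by simp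
      have "\<Phi> ?d = \<Phi> \<phi> + \<Phi> (\<lambda>z. (-1) * ?\<psi> z)" by (rule add[rule_format, OF \<phi> m\<psi>])
      also have "\<Phi> (\<lambda>z. (-1) * ?\<psi> z) = (-1) * \<Phi> ?\<psi>" by (rule scale[rule_format, OF \<psi>])
      finally have 1: "\<bar>\<Phi> \<phi> - \<Phi> ?\<psi>\<bar> \<le> M * \<delta>" using \<Phi>M[OF d dle] by simp
      have 2: "\<Phi> ?\<psi> = ?\<psi> x" using x by (simp add: \<Phi>f funct_def)
      have 3: "\<bar>\<phi> x - ?\<psi> x\<bar> \<le> \<delta> * norm x"
      proof (cases "x = 0")
        case True
        then show ?thesis using dualD(2)[OF \<phi> zero_in_Y, of 0] dualD(2)[OF \<psi> zero_in_Y, of 0] by simp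
      next
        case False
        have "(1 / norm x) *\<^sub>R x \<in> Y" using x(1) subspace_Y subspace_scale by blast
        from m[OF order_refl this] have "\<bar>\<phi> ((1 / norm x) *\<^sub>R x) - ?\<psi> ((1 / norm x) *\<^sub>R x)\<bar> \<le> \<delta>" using False by simp
        then have "\<bar>(1 / norm x) * (\<phi> x - ?\<psi> x)\<bar> \<le> \<delta>"
          unfolding dualD(2)[OF \<phi> x(1)] dualD(2)[OF \<psi> x(1)] by (simp add: right_diff_distrib)
        then show ?thesis using False by (simp add: abs_mult field_simps)
      qed
      have "\<bar>\<Phi> \<phi> - \<phi> x\<bar> \<le> M * \<delta> + \<delta> * norm x" using 1 2 3 by linarith
      also have "\<dots> \<le> \<delta> * (M + norm x + 1)" using \<delta> by (simp add: algebra_simps)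
      also have "\<dots> = \<epsilon>" using pos by (simp add: \<delta>_def)
      finally show ?thesis .
    qed
    then show ?thesis using field_le_epsilon[of "\<bar>\<Phi> \<phi> - \<phi> x\<bar>" 0] by simp
  qed
  then show "\<exists>x\<in>Y. \<forall>\<phi>\<in>dual Y. \<Phi> \<phi> = \<phi> x" using x(1) by blast
qed

end

section \<open>The unconditional constant of a basis\<close>

text \<open>The Baire category theorem for \<open>X\<close> as a complete metric space of its own,
  since the balls have to be relative to the subspace.\<close>

lemma Baire_closed_C2N:
  fixes X :: "C2N set" and B :: "nat \<Rightarrow> C2N set"
  assumes X: "closed X" "X \<noteq> {}" and BX: "\<And>k. B k \<subseteq> X" and cover: "X \<subseteq> (\<Union>k. B k)"
  shows "\<exists>k. \<exists>x0\<in>X. \<exists>r>0. \<forall>x\<in>X. dist x0 x < r \<longrightarrow> x \<in> closure (B k)"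
proof -
  interpret M: Metric_space X dist
    by unfold_locales (auto simp: dist_commute dist_triangle)
  have "M.mcomplete"
    unfolding M.mcomplete_def
  proof (intro allI impI)
    fix \<sigma> assume "M.MCauchy \<sigma>"
    then have \<sigma>: "\<And>n. \<sigma> n \<in> X" "Cauchy \<sigma>" by (auto simp: M.MCauchy_def Cauchy_def)
    then obtain l where l: "\<sigma> \<longlonglongrightarrow> l" using Cauchy_convergent_C2N convergent_def by blast
    then have "l \<in> X" by (intro closed_sequentially[OF X(1) \<sigma>(1)])
    then show "\<exists>x. limitin M.mtopology \<sigma> x sequentially"
      using l \<sigma>(1) by (intro exI[of _ l]) (auto simp: M.limitin_metric tendsto_iff)
  qed
  let ?G = "range (\<lambda>k. X \<inter> closure (B k))"
  have ne: "M.mtopology interior_of \<Union>?G \<noteq> {}"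
  proof -
    have "\<Union>?G = X" 
    proof (intro equalityI subsetI)
      fix x assume "x \<in> X"
      then obtain k where "x \<in> B k" using cover by blast
      then show "x \<in> \<Union>?G" using \<open>x \<in> X\<close> closure_subset by blast
    qed blast
    moreover have "M.mtopology interior_of X = X" using interior_of_topspace[of M.mtopology] by simp
    ultimately show ?thesis using X(2) by simp
  qed
  have cl: "closedin M.mtopology (X \<inter> closure (B k))" for k
    unfolding M.metric_closedin_iff_sequentially_closed
  proof (intro conjI allI impI)
    fix \<sigma> l assume *: "range \<sigma> \<subseteq> X \<inter> closure (B k) \<and> limitin M.mtopology \<sigma> l sequentially"
    then have "\<sigma> \<longlonglongrightarrow> l" "l \<in> X" by (auto simp: M.limitin_metric tendsto_iff elim!: eventually_mono)
    moreover have "\<And>n. \<sigma> n \<in> closure (B k)" using * by auto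
    ultimately show "l \<in> X \<inter> closure (B k)" using closed_sequentially[OF closed_closure] by blast
  qed simp
  have "\<exists>k. M.mtopology interior_of (X \<inter> closure (B k)) \<noteq> {}"
  proof (rule ccontr)
    assume "\<not> ?thesis"
    then have "M.mtopology interior_of \<Union>?G = {}"
      using cl by (intro M.metric_Baire_category_alt \<open>M.mcomplete\<close>) auto
    with ne show False by simp
  qed
  then obtain k x0 where x0: "x0 \<in> M.mtopology interior_of (X \<inter> closure (B k))" by blast
  then obtain r where "0 < r" "M.mball x0 r \<subseteq> X \<inter> closure (B k)" "x0 \<in> X"
    by (auto simp: M.metric_interior_of)
  then show ?thesis by (intro exI[of _ k] bexI[of _ x0] exI[of _ r]) (auto simp: subset_iff)
qed

lemma has_sum_partial_sums_bounded:
  fixes f :: "nat \<Rightarrow> 'v::real_normed_vector"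
  assumes "(f has_sum x) UNIV"
  obtains k :: nat where "\<And>S. finite S \<Longrightarrow> norm (sum f S) \<le> real k"
proof -
  obtain S0 where S0: "finite S0" "\<And>S. finite S \<Longrightarrow> S0 \<subseteq> S \<Longrightarrow> norm (x - sum f S) < 1"
    using has_sum_normD[OF assms, of 1] by auto
  define c where "c = norm x + 1 + (\<Sum>n\<in>S0. norm (f n))"
  have "norm (sum f S) \<le> c" if S: "finite S" for S
  proof -
    have "sum f (S \<union> S0) = sum f S + sum f (S0 - S)"
      using S S0 sum.union_disjoint[of S "S0 - S" f] by (simp add: Un_Diff_cancel)
    then have "norm (sum f S) \<le> norm (sum f (S \<union> S0)) + norm (sum f (S0 - S))"
      by (metis add_diff_cancel_right' norm_triangle_ineq4)
    moreover have "norm (sum f (S \<union> S0)) \<le> norm x + 1"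
    proof -
      have "norm (x - sum f (S \<union> S0)) < 1" using S S0 by auto
      then show ?thesis using norm_triangle_ineq3[of x "sum f (S \<union> S0)"] by linarith
    qed
    moreover have "norm (sum f (S0 - S)) \<le> (\<Sum>n\<in>S0. norm (f n))"
      by (rule order_trans[OF norm_sum sum_mono2]) (use S0 in auto)
    ultimately show ?thesis by (simp add: c_def)
  qed
  moreover obtain k :: nat where "c \<le> real k" using real_arch_simple by blast
  ultimately show ?thesis using that[of k] by force
qed

locale unconditional_basis_space =
  fixes X :: "C2N set" and e :: "nat \<Rightarrow> C2N"
  assumes X: "X \<in> SB" and basis: "unconditional_basis X e"
begin

lemma sub: "subspace X" and closed_X: "closed X"
  using X by (auto simp: SB_def)

definition cf :: "C2N \<Rightarrow> nat \<Rightarrow> real"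
  where "cf x = (THE a. (\<lambda>n. a n *\<^sub>R e n) sums x)"

lemma e_in: "e n \<in> X"
  using basis by (auto simp: unconditional_basis_def schauder_basis_def)

lemma cf_ex1: "x \<in> X \<Longrightarrow> \<exists>!a. (\<lambda>n. a n *\<^sub>R e n) sums x"
  using basis by (simp add: unconditional_basis_def schauder_basis_def)

lemma cf_sums: "x \<in> X \<Longrightarrow> (\<lambda>n. cf x n *\<^sub>R e n) sums x"
  unfolding cf_def by (rule theI'[OF cf_ex1])

lemma cf_eq: "x \<in> X \<Longrightarrow> (\<lambda>n. a n *\<^sub>R e n) sums x \<Longrightarrow> cf x = a"
  unfolding cf_def by (rule the1_equality[OF cf_ex1])

lemma cf_has_sum: "x \<in> X \<Longrightarrow> ((\<lambda>n. cf x n *\<^sub>R e n) has_sum x) UNIV"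
  using basis cf_sums by (auto simp: unconditional_basis_def)

lemma cf_add: "x \<in> X \<Longrightarrow> y \<in> X \<Longrightarrow> cf (x + y) = (\<lambda>n. cf x n + cf y n)"
  by (rule cf_eq[OF subspace_add[OF sub]]) (auto simp: scaleR_add_left intro: sums_add cf_sums)

lemma cf_scale: "x \<in> X \<Longrightarrow> cf (r *\<^sub>R x) = (\<lambda>n. r * cf x n)"
  by (rule cf_eq[OF subspace_scale[OF sub]]) (use sums_scaleR_right[OF cf_sums, of x r] in auto)

definition part :: "C2N \<Rightarrow> nat set \<Rightarrow> C2N"
  where "part x S = (\<Sum>n\<in>S. cf x n *\<^sub>R e n)"

lemma part_add: "x \<in> X \<Longrightarrow> y \<in> X \<Longrightarrow> part (x + y) S = part x S + part y S"
  by (simp add: part_def cf_add scaleR_add_left sum.distrib)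

lemma part_scale: "x \<in> X \<Longrightarrow> part (r *\<^sub>R x) S = r *\<^sub>R part x S"
  by (simp add: part_def cf_scale scaleR_sum_right)

lemma e_nz: "e n \<noteq> 0"
proof
  assume "e n = 0"
  then have z: "unit n 1 k *\<^sub>R e k = 0" for k by (simp add: unit_def)
  have "0 \<in> X" using subspace_0[OF sub] .
  have "(\<lambda>k. unit n 1 k *\<^sub>R e k) sums 0" "(\<lambda>k. (0::real) *\<^sub>R e k) sums 0" unfolding z by simp_all
  from cf_eq[OF \<open>0 \<in> X\<close> this(1)] cf_eq[OF \<open>0 \<in> X\<close> this(2)] have "unit n 1 = (\<lambda>_. 0)" by (rule trans[OF sym])
  from fun_cong[OF this, of n] show False by (simp add: unit_def)
qed

text \<open>As in the open mapping theorem. The vectors all of whose finite parts are bounded by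
  \<open>k\<close> cover \<open>X\<close> as \<open>k\<close> grows; by Baire one of these sets is
  dense in a ball, and, after taking differences, in a ball around 0. Homogeneity introduces the
  scale \<open>s\<close>.\<close>

lemma approx:
  obtains k r where "0 < k" "0 < r"
    "\<And>x s \<delta>. x \<in> X \<Longrightarrow> 0 < s \<Longrightarrow> norm x < r * s \<Longrightarrow> 0 < \<delta> \<Longrightarrow>
       \<exists>w\<in>X. (\<forall>S. finite S \<longrightarrow> norm (part w S) \<le> k * s) \<and> norm (x - w) < \<delta>"
proof -
  define B where "B k = {x \<in> X. \<forall>S. finite S \<longrightarrow> norm (part x S) \<le> real k}" for k
  have "\<exists>k. \<exists>x0\<in>X. \<exists>r>0. \<forall>x\<in>X. dist x0 x < r \<longrightarrow> x \<in> closure (B k)"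
  proof (rule Baire_closed_C2N)
    show "closed X" "X \<noteq> {}" using closed_X e_in by auto
    show "B k \<subseteq> X" for k by (auto simp: B_def)
    show "X \<subseteq> (\<Union>k. B k)"
    proof
      fix x assume x: "x \<in> X"
      obtain k :: nat where "\<And>S. finite S \<Longrightarrow> norm (\<Sum>n\<in>S. cf x n *\<^sub>R e n) \<le> real k"
        using has_sum_partial_sums_bounded[OF cf_has_sum[OF x]] by blast
      then show "x \<in> (\<Union>k. B k)" using x by (auto simp: B_def part_def)
    qed
  qed
  then obtain k x0 r where x0: "x0 \<in> X" and r: "0 < r" and ball: "\<And>x. x \<in> X \<Longrightarrow> dist x0 x < r \<Longrightarrow> x \<in> closure (B k)"
    by blast
  have *: "\<exists>w\<in>B k. norm (x - w) < \<delta>" if x: "x \<in> X" "norm x < r" and \<delta>: "0 < \<delta>" for x \<delta>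
  proof -
    have "x0 + x \<in> closure (B k)" using x x0 subspace_add[OF sub] by (intro ball) (auto simp: dist_norm)
    moreover have "x0 - x \<in> closure (B k)" using x x0 subspace_diff[OF sub] by (intro ball) (auto simp: dist_norm)
    ultimately obtain u v where uv: "u \<in> B k" "dist u (x0 + x) < \<delta>" "v \<in> B k" "dist v (x0 - x) < \<delta>"
      using \<delta> unfolding closure_approachable by meson
    \<comment> \<open>Half the difference of approximations of \<open>x0 + x\<close> and
      \<open>x0 - x\<close> approximates \<open>x\<close>, and halving keeps the bound
      \<open>k\<close>.\<close>
    define w where "w = (1/2) *\<^sub>R (u + (-1) *\<^sub>R v)"
    have uvX: "u \<in> X" "v \<in> X" using uv by (auto simp: B_def)
    then have uvX': "(-1) *\<^sub>R v \<in> X" by (intro subspace_scale[OF sub])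
    with uvX have uvX'': "u + (-1) *\<^sub>R v \<in> X" by (intro subspace_add[OF sub])
    have "w \<in> B k"
      unfolding B_def
    proof (intro CollectI conjI allI impI)
      show "w \<in> X" unfolding w_def by (rule subspace_scale[OF sub uvX''])
      fix S :: "nat set" assume S: "finite S"
      have "part w S = (1/2) *\<^sub>R (part u S - part v S)"
        unfolding w_def part_scale[OF uvX''] part_add[OF uvX(1) uvX'] part_scale[OF uvX(2)] by simp
      moreover have "norm (part u S - part v S) \<le> real k + real k"
        by (rule order_trans[OF norm_triangle_ineq4 add_mono]) (use uv S in \<open>auto simp: B_def\<close>)
      ultimately show "norm (part w S) \<le> real k" by simp
    qed
    moreover have "norm (x - w) < \<delta>"
    proof -
      have "x - w = (1/2) *\<^sub>R (((x0 + x) - u) - ((x0 - x) - v))"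
        by (simp add: w_def scaleR_right_diff_distrib scaleR_add_right)
          (simp add: scaleR_left_distrib[symmetric])
      moreover have "norm (((x0 + x) - u) - ((x0 - x) - v)) < \<delta> + \<delta>"
        by (rule le_less_trans[OF norm_triangle_ineq4 add_strict_mono]) (use uv in \<open>simp_all add: dist_norm norm_minus_commute\<close>)
      ultimately show ?thesis by simp
    qed
    ultimately show ?thesis by blast
  qed
  have "\<exists>w\<in>X. (\<forall>S. finite S \<longrightarrow> norm (part w S) \<le> (real k + 1) * s) \<and> norm (x - w) < \<delta>"
    if x: "x \<in> X" and s: "0 < s" and n: "norm x < r * s" and \<delta>: "0 < \<delta>" for x s \<delta>
  proof -
    have "(1/s) *\<^sub>R x \<in> X" by (rule subspace_scale[OF sub x])
    moreover have "norm ((1/s) *\<^sub>R x) < r" using s n by (simp add: field_simps)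
    moreover have "0 < \<delta> / s" using s \<delta> by simp
    ultimately obtain w where w: "w \<in> B k" "norm ((1/s) *\<^sub>R x - w) < \<delta> / s" using * by blast
    have wX: "w \<in> X" using w by (simp add: B_def)
    have "norm (part (s *\<^sub>R w) S) \<le> (real k + 1) * s" if "finite S" for S
    proof -
      have "s * norm (part w S) \<le> s * (real k + 1)" using w that s by (intro mult_left_mono) (force simp: B_def)+
      then show ?thesis using s by (simp add: part_scale[OF wX] mult.commute)
    qed
    moreover have "norm (x - s *\<^sub>R w) < \<delta>"
    proof -
      have "x - s *\<^sub>R w = s *\<^sub>R ((1/s) *\<^sub>R x - w)" using s by (simp add: scaleR_diff_right)
      then have "norm (x - s *\<^sub>R w) = s * norm ((1/s) *\<^sub>R x - w)" using s by simp
      also have "\<dots> < s * (\<delta> / s)" using w(2) s by (intro mult_strict_left_mono) auto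
      finally show ?thesis using s by simp
    qed
    ultimately show ?thesis using subspace_scale[OF sub wX] by blast
  qed
  then show ?thesis using that[of "real k + 1" r] r by simp
qed

text \<open>Continuity of the coordinates is only a consequence, so \<open>x\<close> is expanded
  into vectors \<open>w n\<close> whose finite parts decay like \<open>k / 2 ^ n\<close>. Their
  coefficients add up to a sequence \<open>c\<close> whose series converges to \<open>x\<close>, and
  uniqueness of coefficients identifies \<open>c\<close> with those of \<open>x\<close>.\<close>

lemma part_bounded_ball:
  obtains k r where "0 < k" "0 < r" "\<And>x S. x \<in> X \<Longrightarrow> norm x < r \<Longrightarrow> finite S \<Longrightarrow> norm (part x S) \<le> k"
proof -
  obtain k r where k: "0 < k" and r: "0 < r"
    and ap: "\<And>x s \<delta>. x \<in> X \<Longrightarrow> 0 < s \<Longrightarrow> norm x < r * s \<Longrightarrow> 0 < \<delta> \<Longrightarrow>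
       \<exists>w\<in>X. (\<forall>S. finite S \<longrightarrow> norm (part w S) \<le> k * s) \<and> norm (x - w) < \<delta>"
    using approx by metis
  have "norm (part x S) \<le> 2 * k" if x: "x \<in> X" "norm x < r" and S: "finite S" for x S
  proof -
    have "\<exists>f. \<forall>n. (f n \<in> X \<and> norm (f n) < r * (1/2) ^ n) \<and>
      (\<forall>S. finite S \<longrightarrow> norm (part (f n - f (Suc n)) S) \<le> k * (1/2) ^ n) \<and> (n = 0 \<longrightarrow> f n = x)"
    proof -
      have "\<exists>f. \<forall>n. (f n \<in> X \<and> norm (f n) < r * (1/2) ^ n \<and> (n = 0 \<longrightarrow> f n = x)) \<and>
        (\<forall>S. finite S \<longrightarrow> norm (part (f n - f (Suc n)) S) \<le> k * (1/2) ^ n)"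
      proof (rule dependent_nat_choice)
        show "\<exists>z. z \<in> X \<and> norm z < r * (1/2) ^ 0 \<and> (0 = (0::nat) \<longrightarrow> z = x)" using x by auto
        fix z n assume z: "z \<in> X \<and> norm z < r * (1/2) ^ n \<and> (n = 0 \<longrightarrow> z = x)"
        have "0 < r * (1/2) ^ Suc n" using r by simp
        then obtain w where w: "w \<in> X" "\<And>S. finite S \<Longrightarrow> norm (part w S) \<le> k * (1/2) ^ n" "norm (z - w) < r * (1/2) ^ Suc n"
          using ap[of z "(1/2) ^ n" "r * (1/2) ^ Suc n"] z by auto
        then show "\<exists>z'. (z' \<in> X \<and> norm z' < r * (1/2) ^ Suc n \<and> (Suc n = 0 \<longrightarrow> z' = x)) \<and>
          (\<forall>S. finite S \<longrightarrow> norm (part (z - z') S) \<le> k * (1/2) ^ n)"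
          using subspace_diff[OF sub] z by (intro exI[of _ "z - w"]) auto
      qed
      then show ?thesis by blast
    qed
    then obtain f where f: "\<And>n. f n \<in> X" "\<And>n. norm (f n) < r * (1/2) ^ n"
      "\<And>n S. finite S \<Longrightarrow> norm (part (f n - f (Suc n)) S) \<le> k * (1/2) ^ n" "f 0 = x" by blast
    define w where "w n = f n - f (Suc n)" for n
    have wX: "w n \<in> X" for n using f(1) subspace_diff[OF sub] by (simp add: w_def)
    have wp: "norm (part (w n) S) \<le> k * (1/2) ^ n" if "finite S" for n S using f(3)[OF that] by (simp add: w_def)
    have tel: "(\<Sum>i<I. w i) = x - f I" for I by (induction I) (auto simp: w_def f(4))
    have geo: "(\<Sum>i\<in>{I..<J}. k * (1/2) ^ i) \<le> 2 * k * (1/2) ^ I" for I J :: nat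
    proof (cases "I \<le> J")
      case True
      then have "(\<Sum>i\<in>{I..<J}. (1/2::real) ^ i) = 2 * ((1/2) ^ I - (1/2) ^ J)"
        by (induction J rule: dec_induct) (auto simp: algebra_simps)
      also have "\<dots> \<le> 2 * (1/2) ^ I" by simp
      finally have "k * (\<Sum>i\<in>{I..<J}. (1/2::real) ^ i) \<le> k * (2 * (1/2) ^ I)" using k by (intro mult_left_mono) auto
      then show ?thesis by (simp add: sum_distrib_left mult_ac)
    qed (use k in simp)
    have psum: "norm (\<Sum>i\<in>{I..<J}. part (w i) S) \<le> 2 * k * (1/2) ^ I" if "finite S" for I J S
      by (rule order_trans[OF order_trans[OF norm_sum sum_mono[OF wp[OF that]]] geo])
    have "summable (\<lambda>i. cf (w i) n)" for n
    proof (rule summable_comparison_test')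
      show "summable (\<lambda>i. k / norm (e n) * (1/2) ^ i)" by (intro summable_mult summable_geometric) simp
      show "norm (cf (w i) n) \<le> k / norm (e n) * (1/2) ^ i" if "i \<ge> 0" for i
        using wp[of "{n}" i] e_nz[of n] by (simp add: part_def field_simps)
    qed
    then have c: "(\<lambda>i. cf (w i) n) sums (\<Sum>i. cf (w i) n)" for n by (rule summable_sums)
    define c where "c n = (\<Sum>i. cf (w i) n)" for n
    have csum: "(\<lambda>J. \<Sum>i<J. part (w i) S) \<longlonglongrightarrow> (\<Sum>n\<in>S. c n *\<^sub>R e n)" for S
    proof -
      have "(\<lambda>J. \<Sum>n\<in>S. (\<Sum>i<J. cf (w i) n) *\<^sub>R e n) \<longlonglongrightarrow> (\<Sum>n\<in>S. c n *\<^sub>R e n)"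
        using c unfolding sums_def c_def by (intro tendsto_sum tendsto_scaleR tendsto_const)
      moreover have "(\<Sum>n\<in>S. (\<Sum>i<J. cf (w i) n) *\<^sub>R e n) = (\<Sum>i<J. part (w i) S)" for J
        unfolding part_def scaleR_sum_left by (rule sum.swap)
      ultimately show ?thesis by simp
    qed
    have tail: "norm ((\<Sum>n\<in>S. c n *\<^sub>R e n) - (\<Sum>i<I. part (w i) S)) \<le> 2 * k * (1/2) ^ I" if "finite S" for S I
    proof (rule LIMSEQ_le_const2)
      show "(\<lambda>J. norm ((\<Sum>i<J. part (w i) S) - (\<Sum>i<I. part (w i) S))) \<longlonglongrightarrow> norm ((\<Sum>n\<in>S. c n *\<^sub>R e n) - (\<Sum>i<I. part (w i) S))"
        by (intro tendsto_intros csum)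
      have "norm ((\<Sum>i<J. part (w i) S) - (\<Sum>i<I. part (w i) S)) \<le> 2 * k * (1/2) ^ I" if "J \<ge> I" for J
      proof -
        have "(\<Sum>i<J. part (w i) S) - (\<Sum>i<I. part (w i) S) = (\<Sum>i\<in>{I..<J}. part (w i) S)"
          using that sum_diff[of "{..<J}" "{..<I}" "\<lambda>i. part (w i) S"] by (simp add: lessThan_minus_lessThan)
        then show ?thesis using psum[OF \<open>finite S\<close>] by simp
      qed
      then show "\<exists>N. \<forall>J\<ge>N. norm ((\<Sum>i<J. part (w i) S) - (\<Sum>i<I. part (w i) S)) \<le> 2 * k * (1/2) ^ I" by blast
    qed
    have "(\<lambda>n. c n *\<^sub>R e n) sums x"
      unfolding sums_def LIMSEQ_iff
    proof (intro allI impI)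
      fix \<epsilon> :: real assume \<epsilon>: "0 < \<epsilon>"
      have "(\<lambda>I. (r + 2 * k) * (1/2) ^ I) \<longlonglongrightarrow> (r + 2 * k) * 0" by (intro tendsto_intros LIMSEQ_power_zero) auto
      \<comment> \<open>The choice of \<open>I\<close> makes the remainder and the tails small
        uniformly in the part; \<open>M0\<close> may depend on it and serves the finitely many
        series of the \<open>w i\<close> with \<open>i < I\<close>.\<close>
      then obtain I where I: "(r + 2 * k) * (1/2) ^ I < \<epsilon> / 2"
        using order_tendstoD(2)[of _ 0 sequentially "\<epsilon> / 2"] \<epsilon> by (auto simp: eventually_sequentially)
      have "(\<lambda>M. \<Sum>i<I. part (w i) {..<M}) \<longlonglongrightarrow> (\<Sum>i<I. w i)"
        using cf_sums[OF wX] unfolding part_def sums_def by (intro tendsto_sum)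
      then obtain M0 where M0: "\<And>M. M \<ge> M0 \<Longrightarrow> norm ((\<Sum>i<I. part (w i) {..<M}) - (\<Sum>i<I. w i)) < \<epsilon> / 2"
        using \<epsilon> unfolding LIMSEQ_iff by (meson half_gt_zero)
      show "\<exists>M0. \<forall>M\<ge>M0. norm ((\<Sum>n<M. c n *\<^sub>R e n) - x) < \<epsilon>"
      proof (intro exI allI impI)
        fix M assume M: "M \<ge> M0"
        have "(\<Sum>n<M. c n *\<^sub>R e n) - x = ((\<Sum>n<M. c n *\<^sub>R e n) - (\<Sum>i<I. part (w i) {..<M}))
            + ((\<Sum>i<I. part (w i) {..<M}) - (\<Sum>i<I. w i)) - f I"
          unfolding tel by simp
        also have "norm \<dots> \<le> norm ((\<Sum>n<M. c n *\<^sub>R e n) - (\<Sum>i<I. part (w i) {..<M}))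
            + norm ((\<Sum>i<I. part (w i) {..<M}) - (\<Sum>i<I. w i)) + norm (f I)"
          by (intro order_trans[OF norm_triangle_ineq4] add_right_mono norm_triangle_ineq)
        also have "\<dots> < 2 * k * (1/2) ^ I + \<epsilon> / 2 + r * (1/2) ^ I"
          using tail[of "{..<M}" I] M0[OF M] f(2)[of I] by simp
        also have "\<dots> < \<epsilon>" using I by (simp add: algebra_simps)
        finally show "norm ((\<Sum>n<M. c n *\<^sub>R e n) - x) < \<epsilon>" .
      qed
    qed
    then have "cf x = c" by (rule cf_eq[OF x(1)])
    then show ?thesis using tail[OF S, of 0] by (simp add: part_def)
  qed
  then show ?thesis using that[of "2 * k" r] k r by simp
qed

theorem unconditional_constant:
  obtains K where "0 < K" "\<And>x S. x \<in> X \<Longrightarrow> finite S \<Longrightarrow> norm (\<Sum>n\<in>S. cf x n *\<^sub>R e n) \<le> K * norm x"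
proof -
  obtain k r where k: "0 < k" "0 < r" "\<And>x S. x \<in> X \<Longrightarrow> norm x < r \<Longrightarrow> finite S \<Longrightarrow> norm (part x S) \<le> k"
    using part_bounded_ball by metis
  have "norm (part x S) \<le> (2 * k / r) * norm x" if x: "x \<in> X" and S: "finite S" for x S
  proof (cases "x = 0")
    case True
    then show ?thesis using part_scale[OF x, of 0 S] by simp
  next
    case False
    define t where "t = r / (2 * norm x)"
    have t: "0 < t" using False k by (simp add: t_def)
    have "norm (part (t *\<^sub>R x) S) \<le> k"
      using k t False by (intro k(3) subspace_scale[OF sub x] S) (simp add: t_def)
    then have "t * norm (part x S) \<le> k" using t by (simp add: part_scale[OF x])
    then show ?thesis using False k by (simp add: t_def field_simps)
  qed
  then show ?thesis using that[of "2 * k / r"] k by (simp add: part_def)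
qed

end

section \<open>Unconditional sequences in reflexive spaces\<close>

text \<open>The limit superior of a bounded sequence.\<close>

definition ls :: "(nat \<Rightarrow> real) \<Rightarrow> real"
  where "ls s = Inf {c. \<forall>\<^sub>F j in sequentially. s j \<le> c}"

lemma ls_bdd:
  fixes s :: "nat \<Rightarrow> real"
  assumes "\<And>j. \<bar>s j\<bar> \<le> M" shows "bdd_below {c. \<forall>\<^sub>F j in sequentially. s j \<le> c}"
proof (rule bdd_belowI)
  fix c assume "c \<in> {c. \<forall>\<^sub>F j in sequentially. s j \<le> c}"
  then obtain j where "s j \<le> c" by (auto simp: eventually_sequentially)
  then show "- M \<le> c" using assms[of j] by linarith
qed

lemma ls_le: "(\<And>j. \<bar>s j\<bar> \<le> M) \<Longrightarrow> \<forall>\<^sub>F j in sequentially. s j \<le> c \<Longrightarrow> ls s \<le> c"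
  unfolding ls_def by (intro cInf_lower ls_bdd) auto

lemma ls_less:
  assumes "\<And>j. \<bar>s j\<bar> \<le> M" "ls s < c" shows "\<forall>\<^sub>F j in sequentially. s j \<le> c"
proof -
  have "M \<in> {c. \<forall>\<^sub>F j in sequentially. s j \<le> c}" using assms(1) by (simp add: abs_le_iff)
  then obtain c' where "\<forall>\<^sub>F j in sequentially. s j \<le> c'" "c' < c"
    using cInf_lessD[of "{c. \<forall>\<^sub>F j in sequentially. s j \<le> c}" c] assms(2) unfolding ls_def by blast
  then show ?thesis by (auto elim: eventually_mono)
qed

lemma ls_add:
  assumes s: "\<And>j. \<bar>s j\<bar> \<le> M" and t: "\<And>j. \<bar>t j\<bar> \<le> N"
  shows "ls (\<lambda>j. s j + t j) \<le> ls s + ls t"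
proof (rule field_le_epsilon)
  fix e :: real assume "0 < e"
  then have "\<forall>\<^sub>F j in sequentially. s j \<le> ls s + e/2" "\<forall>\<^sub>F j in sequentially. t j \<le> ls t + e/2"
    by (auto intro: ls_less[OF s] ls_less[OF t])
  then have "\<forall>\<^sub>F j in sequentially. s j + t j \<le> ls s + ls t + e" by eventually_elim linarith
  moreover have "\<bar>s j + t j\<bar> \<le> M + N" for j using s[of j] t[of j] by linarith
  ultimately show "ls (\<lambda>j. s j + t j) \<le> ls s + ls t + e" by (intro ls_le)
qed

lemma ls_scale:
  assumes s: "\<And>j. \<bar>s j\<bar> \<le> M" and r: "0 \<le> r"
  shows "ls (\<lambda>j. r * s j) = r * ls s"
proof -
  have le: "ls (\<lambda>j. r * s j) \<le> r * ls s" if s: "\<And>j. \<bar>s j\<bar> \<le> M" and r: "0 < r" for r s M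
  proof (rule field_le_epsilon)
    fix e :: real assume "0 < e"
    then have "\<forall>\<^sub>F j in sequentially. s j \<le> ls s + e/r" using r by (intro ls_less[OF s]) simp
    then have "\<forall>\<^sub>F j in sequentially. r * s j \<le> r * ls s + e"
    proof eventually_elim
      case (elim j)
      then have "r * s j \<le> r * (ls s + e/r)" using r by (intro mult_left_mono) auto
      then show ?case using r by (simp add: algebra_simps)
    qed
    moreover have "\<bar>r * s j\<bar> \<le> r * M" for j using s[of j] r by (simp add: abs_mult)
    ultimately show "ls (\<lambda>j. r * s j) \<le> r * ls s + e" by (intro ls_le)
  qed
  show ?thesis
  proof (cases "r = 0")
    case True
    have "ls (\<lambda>j. 0) \<le> 0" by (rule ls_le[of _ 0]) auto
    moreover have "0 \<le> ls (\<lambda>j. 0)"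
      unfolding ls_def by (rule cInf_greatest) (auto intro: exI[of _ 0])
    ultimately show ?thesis using True by simp
  next
    case False
    with r have r: "0 < r" by simp
    have rs: "\<bar>r * s j\<bar> \<le> r * M" for j using s[of j] r by (simp add: abs_mult)
    have "ls (\<lambda>j. inverse r * (r * s j)) \<le> inverse r * ls (\<lambda>j. r * s j)" by (rule le[OF rs]) (use r in simp)
    moreover have "(\<lambda>j. inverse r * (r * s j)) = s" using r by auto
    ultimately have "r * ls s \<le> ls (\<lambda>j. r * s j)" using r by (simp add: field_simps)
    moreover have "ls (\<lambda>j. r * s j) \<le> r * ls s" by (rule le) (rule s, rule r)
    ultimately show ?thesis by simp
  qed
qed

lemma dual_norm_bound:
  assumes X: "subspace X" and \<phi>: "\<phi> \<in> dual X" and x: "x \<in> X"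
  shows "\<bar>\<phi> x\<bar> \<le> dual_norm X \<phi> * norm x"
proof (cases "x = 0")
  case True
  then show ?thesis using dualD(2)[OF \<phi> x, of 0] by simp
next
  case False
  have "\<bar>\<phi> ((1 / norm x) *\<^sub>R x)\<bar> \<le> dual_norm X \<phi>"
    using False by (intro dual_norm_upper[OF \<phi>] subspace_scale[OF X x]) simp
  then show ?thesis using False by (simp add: dualD(2)[OF \<phi> x] abs_mult field_simps)
qed

section \<open>Weak cluster points in a reflexive space\<close>

locale unconditional_in_reflexive = unconditional_seq y I Kc for y :: "nat \<Rightarrow> C2N" and I Kc +
  fixes X :: "C2N set"
  assumes X: "X \<in> SB" and refl: "reflexive_space X" and yX: "n \<in> I \<Longrightarrow> y n \<in> X"
begin

lemma subX: "subspace X" using X by (simp add: SB_def)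

lemma X_add: "w \<in> X \<Longrightarrow> w' \<in> X \<Longrightarrow> w + w' \<in> X"
  and X_scale: "w \<in> X \<Longrightarrow> r *\<^sub>R w \<in> X"
  using subX by (auto intro: subspace_add subspace_scale)

lemma lincomb_in: "a \<in> fs_on I \<Longrightarrow> lincomb y a \<in> X"
  unfolding lincomb_def by (intro subspace_sum[OF subX] subspace_scale[OF subX] yX) (auto simp: fs_on_def)

text \<open>Linear functionals dominated by \<open>extension\<close> agree with \<open>b\<close> on the span of the sequence. For
  \<open>b = 0\<close> and \<open>C = 1\<close> it is the distance to that span.\<close>

definition extension :: "(nat \<Rightarrow> real) \<Rightarrow> real \<Rightarrow> C2N \<Rightarrow> real"
  where "extension b C w = (INF a\<in>fs_on I. dot a b + C * norm (w - lincomb y a))"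

definition dominated :: "(nat \<Rightarrow> real) \<Rightarrow> real \<Rightarrow> bool"
  where "dominated b C \<longleftrightarrow> 0 \<le> C \<and> (\<forall>a\<in>fs_on I. \<bar>dot a b\<bar> \<le> C * norm (lincomb y a))"

text \<open>Says that \<open>v\<close> clusters weakly at the limit of the \<open>z k\<close>, in
  terms of coefficients alone: eventual lower bounds for a bounded functional along \<open>v\<close>
  hold along \<open>z\<close> up to \<delta>. Passing to the negative functional covers upper
  bounds.\<close>

definition clusters :: "(nat \<Rightarrow> nat \<Rightarrow> real) \<Rightarrow> (nat \<Rightarrow> nat \<Rightarrow> real) \<Rightarrow> bool"
  where "clusters v z \<longleftrightarrow> (\<forall>b C l \<delta>. dominated b C \<longrightarrow> (\<forall>\<^sub>F j in sequentially. l \<le> dot (v j) b) \<longrightarrow> 0 < \<delta> \<longrightarrow>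
    (\<forall>\<^sub>F k in sequentially. l - \<delta> \<le> dot (z k) b))"

context
  fixes b :: "nat \<Rightarrow> real" and C :: real
  assumes dom: "dominated b C"
begin

lemma dominated_bound: "a \<in> fs_on I \<Longrightarrow> \<bar>dot a b\<bar> \<le> C * norm (lincomb y a)" and dominated_nonneg: "0 \<le> C"
  using dom by (auto simp: dominated_def)

lemma extension_lower: "a \<in> fs_on I \<Longrightarrow> - C * norm w \<le> dot a b + C * norm (w - lincomb y a)"
proof -
  assume a: "a \<in> fs_on I"
  have "C * norm (lincomb y a) \<le> C * (norm w + norm (w - lincomb y a))"
    using norm_triangle_sub[of "lincomb y a" w] dominated_nonneg by (intro mult_left_mono) (auto simp: norm_minus_commute)
  then show ?thesis using dominated_bound[OF a] by (simp add: algebra_simps abs_le_iff)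
qed

lemma extension_le: "a \<in> fs_on I \<Longrightarrow> extension b C w \<le> dot a b + C * norm (w - lincomb y a)"
  unfolding extension_def
  by (intro cINF_lower bdd_belowI2[where m = "- C * norm w"]) (auto dest: extension_lower[of _ w])

lemma zero_fs_on: "(\<lambda>_. 0) \<in> fs_on I" by (auto simp: fs_on_def supp_def)

lemma extension_le_norm: "extension b C w \<le> C * norm w"
  using extension_le[OF zero_fs_on, of w] by (simp add: lincomb_def dot_def supp_def)

lemma extension_le_dot: "a \<in> fs_on I \<Longrightarrow> extension b C (lincomb y a) \<le> dot a b"
  using extension_le[of a "lincomb y a"] by simp

lemma extension_approx:
  assumes "0 < \<delta>" obtains a where "a \<in> fs_on I" "dot a b + C * norm (w - lincomb y a) < extension b C w + \<delta>"
proof -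
  have "(INF a\<in>fs_on I. dot a b + C * norm (w - lincomb y a)) < extension b C w + \<delta>"
    using assms by (simp add: extension_def)
  moreover have bdd: "bdd_below ((\<lambda>a. dot a b + C * norm (w - lincomb y a)) ` fs_on I)"
    by (intro bdd_belowI2[where m = "- C * norm w"] extension_lower)
  moreover have ne: "fs_on I \<noteq> {}" using zero_fs_on by blast
  ultimately have "\<exists>a\<in>fs_on I. dot a b + C * norm (w - lincomb y a) < extension b C w + \<delta>"
    using cINF_less_iff[OF ne bdd] by blast
  then show ?thesis using that by blast
qed

lemma fs_on_add: "a \<in> fs_on I \<Longrightarrow> a' \<in> fs_on I \<Longrightarrow> (\<lambda>n. a n + a' n) \<in> fs_on I"
  using order_trans[OF supp_add[of a a']] by (simp add: fs_on_def fs_add)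

lemma fs_on_scale: "a \<in> fs_on I \<Longrightarrow> (\<lambda>n. r * a n) \<in> fs_on I"
  using order_trans[OF supp_scale[of r a]] by (simp add: fs_on_def fs_scale)

lemma extension_sublinear: "sublinear (*\<^sub>R) UNIV (extension b C)"
proof unfold_locales
  show "module.subspace ((*\<^sub>R) :: real \<Rightarrow> C2N \<Rightarrow> C2N) UNIV"
    by (rule module.subspace_UNIV) (unfold module_iff_vector_space, rule real_vector.vector_space_axioms)
next
  fix w w' :: C2N
  show "extension b C (w + w') \<le> extension b C w + extension b C w'"
  proof (rule field_le_epsilon)
    fix \<delta> :: real assume "0 < \<delta>"
    then have \<delta>: "0 < \<delta>/2" by simp
    obtain a where a: "a \<in> fs_on I" "dot a b + C * norm (w - lincomb y a) < extension b C w + \<delta>/2"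
      using extension_approx[OF \<delta>] by blast
    obtain a' where a': "a' \<in> fs_on I" "dot a' b + C * norm (w' - lincomb y a') < extension b C w' + \<delta>/2"
      using extension_approx[OF \<delta>] by blast
    have fs: "a \<in> fs" "a' \<in> fs" using a a' by (auto simp: fs_on_def)
    have "norm (w + w' - lincomb y (\<lambda>n. a n + a' n)) \<le> norm (w - lincomb y a) + norm (w' - lincomb y a')"
    proof -
      have "w + w' - lincomb y (\<lambda>n. a n + a' n) = (w - lincomb y a) + (w' - lincomb y a')"
        unfolding lincomb_add[OF fs] by simp
      then show ?thesis by (simp only: norm_triangle_ineq)
    qed
    then have "C * norm (w + w' - lincomb y (\<lambda>n. a n + a' n)) \<le> C * norm (w - lincomb y a) + C * norm (w' - lincomb y a')"
      using dominated_nonneg by (simp add: distrib_left[symmetric] mult_left_mono)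
    then show "extension b C (w + w') \<le> extension b C w + extension b C w' + \<delta>"
      using extension_le[OF fs_on_add[OF a(1) a'(1)], of "w + w'"] a(2) a'(2) dot_add[OF fs, of b] by linarith
  qed
next
  fix w :: C2N and r :: real assume r: "0 \<le> r"
  have le: "extension b C (r *\<^sub>R w) \<le> r * extension b C w" if r: "0 < r" for r w
  proof (rule field_le_epsilon)
    fix \<delta> :: real assume "0 < \<delta>"
    then have \<delta>: "0 < \<delta>/r" using r by simp
    obtain a where a: "a \<in> fs_on I" "dot a b + C * norm (w - lincomb y a) < extension b C w + \<delta>/r"
      using extension_approx[OF \<delta>] by blast
    have fs: "a \<in> fs" using a by (auto simp: fs_on_def)
    have "extension b C (r *\<^sub>R w) \<le> r * dot a b + C * norm (r *\<^sub>R w - r *\<^sub>R lincomb y a)"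
      using extension_le[OF fs_on_scale[OF a(1), of r], of "r *\<^sub>R w"] by (simp add: dot_scale[OF fs] lincomb_scale[OF fs])
    also have "norm (r *\<^sub>R w - r *\<^sub>R lincomb y a) = r * norm (w - lincomb y a)"
      using r by (simp add: scaleR_diff_right[symmetric])
    also have "r * dot a b + C * (r * norm (w - lincomb y a)) = r * (dot a b + C * norm (w - lincomb y a))"
      by (simp add: algebra_simps)
    also have "\<dots> \<le> r * (extension b C w + \<delta>/r)" using a(2) r by (intro mult_left_mono) auto
    finally show "extension b C (r *\<^sub>R w) \<le> r * extension b C w + \<delta>" using r by (simp add: algebra_simps)
  qed
  show "extension b C (r *\<^sub>R w) = r * extension b C w"
  proof (cases "r = 0")
    case True
    have "0 \<le> extension b C 0"
      unfolding extension_def using zero_fs_on extension_lower[of _ 0] by (intro cINF_greatest) auto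
    then show ?thesis using True extension_le_norm[of 0] by simp
  next
    case False
    with r have r: "0 < r" by simp
    have "extension b C (inverse r *\<^sub>R (r *\<^sub>R w)) \<le> inverse r * extension b C (r *\<^sub>R w)" using r by (intro le) simp
    then have "r * extension b C w \<le> extension b C (r *\<^sub>R w)" using r by (simp add: field_simps)
    then show ?thesis using le[OF r] by (intro antisym)
  qed
qed

text \<open>The prescribed value at \<open>w0\<close> serves for separation: with
  \<open>b = 0\<close> and \<open>C = 1\<close> it is the distance of \<open>w0\<close> from the
  span.\<close>

lemma dual_extension:
  assumes w0: "w0 \<in> X"
  obtains \<phi> where "\<phi> \<in> dual X" "\<And>a. a \<in> fs_on I \<Longrightarrow> \<phi> (lincomb y a) = dot a b" "\<phi> w0 = extension b C w0"
proof -
  interpret sublinear "(*\<^sub>R)" UNIV "extension b C" by (rule extension_sublinear)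
  have "\<exists>L. (\<forall>x\<in>UNIV. \<forall>y\<in>UNIV. L (x + y) = L x + L y) \<and> (\<forall>r. \<forall>x\<in>UNIV. L (r *\<^sub>R x) = r * L x) \<and>
      (\<forall>x\<in>UNIV. L x \<le> extension b C x) \<and> L w0 = extension b C w0"
    by (rule hahn_banach) simp
  then obtain L where "(\<forall>x\<in>UNIV. \<forall>y\<in>UNIV. L (x + y) = L x + L y) \<and> (\<forall>r. \<forall>x\<in>UNIV. L (r *\<^sub>R x) = r * L x) \<and>
      (\<forall>x\<in>UNIV. L x \<le> extension b C x) \<and> L w0 = extension b C w0" by (rule exE)
  then have L: "\<And>x y. L (x + y) = L x + L y" "\<And>r x. L (r *\<^sub>R x) = r * L x"
    "\<And>x. L x \<le> extension b C x" "L w0 = extension b C w0" by simp_all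
  define \<phi> where "\<phi> w = (if w \<in> X then L w else 0)" for w
  have neg: "L (- w) = - L w" for w using L(2)[of "-1" w] by simp
  have "\<bar>L w\<bar> \<le> C * norm w" for w
    using order_trans[OF L(3) extension_le_norm, of w] order_trans[OF L(3) extension_le_norm, of "- w"] neg[of w]
    by (simp add: abs_le_iff)
  then have "\<phi> \<in> dual X"
    by (intro dualI[where K = C]) (auto simp: \<phi>_def L(1,2) subspace_add[OF subX] subspace_scale[OF subX])
  moreover have "\<phi> (lincomb y a) = dot a b" if a: "a \<in> fs_on I" for a
  proof -
    have fs: "a \<in> fs" using a by (simp add: fs_on_def)
    have 1: "L (lincomb y a) \<le> dot a b" by (rule order_trans[OF L(3) extension_le_dot[OF a]])
    have "L (lincomb y (\<lambda>n. (-1) * a n)) \<le> dot (\<lambda>n. (-1) * a n) b"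
      by (rule order_trans[OF L(3) extension_le_dot[OF fs_on_scale[OF a]]])
    then have "- L (lincomb y a) \<le> - dot a b"
      unfolding lincomb_scale[OF fs] dot_scale[OF fs] L(2) by simp
    with 1 show ?thesis by (simp add: \<phi>_def lincomb_in[OF a])
  qed
  ultimately show ?thesis using that[of \<phi>] L(4) w0 by (simp add: \<phi>_def)
qed

end

text \<open>The limit superior along the sequence is sublinear on the dual. A linear functional
  dominated by it is bounded, hence by reflexivity the evaluation at some \<open>x\<close>. This
  takes the place of a weakly convergent subsequence.\<close>

lemma weak_cluster:
  assumes v: "\<And>j. v j \<in> fs_on I" "\<And>j. norm (lincomb y (v j)) \<le> M"
  obtains z x where "\<And>k. z k \<in> fs_on I" "(\<lambda>k. lincomb y (z k)) \<longlonglongrightarrow> x"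
    "clusters v z"
proof -
  define u where "u j = lincomb y (v j)" for j
  have uX: "u j \<in> X" for j unfolding u_def by (rule lincomb_in[OF v(1)])
  have M: "0 \<le> M" using v(2)[of 0] norm_ge_zero order_trans by blast
  have \<phi>u: "\<bar>\<phi> (u j)\<bar> \<le> dual_norm X \<phi> * M" if \<phi>: "\<phi> \<in> dual X" for \<phi> j
  proof -
    have "0 \<le> dual_norm X \<phi>" using dual_norm_upper[OF \<phi> subspace_0[OF subX]] by simp
    then have "dual_norm X \<phi> * norm (u j) \<le> dual_norm X \<phi> * M" using v(2) by (intro mult_left_mono) (auto simp: u_def)
    then show ?thesis using dual_norm_bound[OF subX \<phi> uX, of j] by linarith
  qed
  have z: "(\<lambda>_. 0) \<in> dual X" by (rule dualI[where K = 0]) auto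
  interpret sublinear "\<lambda>r (f :: C2N \<Rightarrow> real) z. r * f z" "dual X" "\<lambda>\<phi>. ls (\<lambda>j. \<phi> (u j))"
  proof (intro sublinear.intro vector_space_fun sublinear_axioms.intro)
    show "module.subspace (\<lambda>r (f :: C2N \<Rightarrow> real) z. r * f z) (dual X)"
      using z dual_add dual_scale
      by (auto simp: module.subspace_def[OF vector_space_fun[unfolded module_iff_vector_space[symmetric]]] plus_fun_def zero_fun_def)
  next
    fix \<phi> \<psi> assume *: "\<phi> \<in> dual X" "\<psi> \<in> dual X"
    show "ls (\<lambda>j. (\<phi> + \<psi>) (u j)) \<le> ls (\<lambda>j. \<phi> (u j)) + ls (\<lambda>j. \<psi> (u j))"
      using ls_add[of "\<lambda>j. \<phi> (u j)" _ "\<lambda>j. \<psi> (u j)", OF \<phi>u[OF *(1)] \<phi>u[OF *(2)]] by simp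
  next
    fix \<phi> and r :: real assume *: "\<phi> \<in> dual X" "0 \<le> r"
    show "ls (\<lambda>j. r * \<phi> (u j)) = r * ls (\<lambda>j. \<phi> (u j))" by (rule ls_scale[OF \<phi>u[OF *(1)] *(2)])
  qed
  obtain \<Phi> where "(\<forall>\<phi>\<in>dual X. \<forall>\<psi>\<in>dual X. \<Phi> (\<phi> + \<psi>) = \<Phi> \<phi> + \<Phi> \<psi>) \<and>
    (\<forall>r. \<forall>\<phi>\<in>dual X. \<Phi> (\<lambda>z. r * \<phi> z) = r * \<Phi> \<phi>) \<and>
    (\<forall>\<phi>\<in>dual X. \<Phi> \<phi> \<le> ls (\<lambda>j. \<phi> (u j))) \<and> \<Phi> (\<lambda>_. 0) = ls (\<lambda>j. 0)"
    using hahn_banach[OF z] by (rule exE)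
  then have \<Phi>: "\<And>\<phi> \<psi>. \<phi> \<in> dual X \<Longrightarrow> \<psi> \<in> dual X \<Longrightarrow> \<Phi> (\<phi> + \<psi>) = \<Phi> \<phi> + \<Phi> \<psi>"
    "\<And>r \<phi>. \<phi> \<in> dual X \<Longrightarrow> \<Phi> (\<lambda>z. r * \<phi> z) = r * \<Phi> \<phi>" "\<And>\<phi>. \<phi> \<in> dual X \<Longrightarrow> \<Phi> \<phi> \<le> ls (\<lambda>j. \<phi> (u j))"
    by simp_all
  \<comment> \<open>Domination by the limit superior, applied to the negative of \<phi>.\<close>
  have lower: "l \<le> \<Phi> \<phi>" if \<phi>: "\<phi> \<in> dual X" and l: "\<forall>\<^sub>F j in sequentially. l \<le> \<phi> (u j)" for \<phi> l
  proof -
    have m: "(\<lambda>z. (-1) * \<phi> z) \<in> dual X" by (rule dual_scale[OF \<phi>])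
    have "ls (\<lambda>j. (-1) * \<phi> (u j)) \<le> - l"
      by (rule ls_le[OF \<phi>u[OF m]]) (use l in simp)
    then show ?thesis using \<Phi>(3)[OF m] \<Phi>(2)[OF \<phi>, of "-1"] by simp
  qed
  have "\<bar>\<Phi> \<phi>\<bar> \<le> M * dual_norm X \<phi>" if \<phi>: "\<phi> \<in> dual X" for \<phi>
  proof -
    have le: "\<phi> (u j) \<le> M * dual_norm X \<phi>" "- (M * dual_norm X \<phi>) \<le> \<phi> (u j)" for j
      using \<phi>u[OF \<phi>, of j] by (auto simp: abs_le_iff mult.commute)
    have "ls (\<lambda>j. \<phi> (u j)) \<le> M * dual_norm X \<phi>"
      by (rule ls_le[where M = "dual_norm X \<phi> * M"]) (rule \<phi>u[OF \<phi>], simp add: le(1))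
    with \<Phi>(3)[OF \<phi>] have "\<Phi> \<phi> \<le> M * dual_norm X \<phi>" by linarith
    moreover have "- (M * dual_norm X \<phi>) \<le> \<Phi> \<phi>" using le(2) by (intro lower[OF \<phi>]) auto
    ultimately show ?thesis by (simp add: abs_le_iff)
  qed
  moreover have "\<forall>\<phi>\<in>dual X. \<forall>\<psi>\<in>dual X. \<Phi> (\<lambda>z. \<phi> z + \<psi> z) = \<Phi> \<phi> + \<Phi> \<psi>" using \<Phi>(1) by (simp add: plus_fun_def)
  ultimately have "\<exists>x\<in>X. \<forall>\<phi>\<in>dual X. \<Phi> \<phi> = \<phi> x"
    using refl[unfolded reflexive_space_def, rule_format, of \<Phi>] \<Phi>(2) by blast
  then obtain x where x: "x \<in> X" "\<And>\<phi>. \<phi> \<in> dual X \<Longrightarrow> \<Phi> \<phi> = \<phi> x" by blast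
  \<comment> \<open>Off the closed span some functional vanishes on the span and equals the distance
    at \<open>x\<close>; but the value at \<open>x\<close> of a functional that vanishes along the
    sequence cannot be positive.\<close>
  have "x \<in> closure (lincomb y ` fs_on I)"
  proof (rule ccontr)
    assume nx: "x \<notin> closure (lincomb y ` fs_on I)"
    have b0: "dominated (\<lambda>_. 0) 1" by (simp add: dominated_def dot_def)
    obtain \<phi> where \<phi>: "\<phi> \<in> dual X" "\<And>a. a \<in> fs_on I \<Longrightarrow> \<phi> (lincomb y a) = dot a (\<lambda>_. 0)"
      "\<phi> x = extension (\<lambda>_. 0) 1 x"
      using dual_extension[OF b0 x(1)] by metis
    have "\<phi> (u j) = 0" for j unfolding u_def using \<phi>(2)[OF v(1)] by (simp add: dot_def)
    then have "\<forall>\<^sub>F j in sequentially. 0 \<le> (-1) * \<phi> (u j)" by simp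
    then have "0 \<le> (-1) * \<phi> x" using lower[OF dual_scale[OF \<phi>(1)], of 0 "-1"] x(2)[OF dual_scale[OF \<phi>(1)], of "-1"] by simp
    then have le0: "extension (\<lambda>_. 0) 1 x \<le> 0" using \<phi>(3) by simp
    have "\<exists>w\<in>lincomb y ` fs_on I. dist w x < \<delta>" if \<delta>: "0 < \<delta>" for \<delta>
    proof -
      obtain a where "a \<in> fs_on I" "dot a (\<lambda>_. 0) + 1 * norm (x - lincomb y a) < extension (\<lambda>_. 0) 1 x + \<delta>"
        using extension_approx[OF b0 \<delta>] by metis
      then show ?thesis using le0 by (intro bexI[of _ "lincomb y a"]) (auto simp: dot_def dist_norm norm_minus_commute)
    qed
    then show False using nx unfolding closure_approachable by blast
  qed
  then obtain f where f: "\<And>k. f k \<in> lincomb y ` fs_on I" "f \<longlonglongrightarrow> x" unfolding closure_sequential by blast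
  from f(1) have "\<forall>k. \<exists>w. w \<in> fs_on I \<and> f k = lincomb y w" by blast
  then obtain z where z: "\<forall>k. z k \<in> fs_on I \<and> f k = lincomb y (z k)"
    by (rule choice[THEN exE])
  then have zx: "(\<lambda>k. lincomb y (z k)) \<longlonglongrightarrow> x" using f(2) ext[of f "\<lambda>k. lincomb y (z k)"] by metis
  have "\<forall>\<^sub>F k in sequentially. l - \<delta> \<le> dot (z k) b"
    if b: "dominated b C"
      and l: "\<forall>\<^sub>F j in sequentially. l \<le> dot (v j) b" and \<delta>: "0 < \<delta>" for b C l \<delta>
  proof -
    obtain \<phi> where \<phi>: "\<phi> \<in> dual X" "\<And>a. a \<in> fs_on I \<Longrightarrow> \<phi> (lincomb y a) = dot a b"
      using dual_extension[OF b x(1)] by metis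
    have "l \<le> \<phi> x" using lower[OF \<phi>(1), of l] l x(2)[OF \<phi>(1)] by (simp add: u_def \<phi>(2)[OF v(1)])
    obtain K where K: "0 < K" "\<And>x. x \<in> X \<Longrightarrow> \<bar>\<phi> x\<bar> \<le> K * norm x" using dual_bounded[OF \<phi>(1)] by blast
    have "(\<lambda>k. K * norm (lincomb y (z k) - x)) \<longlonglongrightarrow> K * norm (x - x)" by (intro tendsto_intros zx)
    then have "\<forall>\<^sub>F k in sequentially. K * norm (lincomb y (z k) - x) < \<delta>" using \<delta> by (intro order_tendstoD(2)) auto
    then show ?thesis
    proof eventually_elim
      case (elim k)
      have m: "(-1) *\<^sub>R x \<in> X" by (rule X_scale[OF x(1)])
      have zk: "lincomb y (z k) \<in> X" using z lincomb_in by blast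
      have "\<phi> (lincomb y (z k) + (-1) *\<^sub>R x) = dot (z k) b - \<phi> x"
        unfolding dualD(1)[OF \<phi>(1) zk m] dualD(2)[OF \<phi>(1) x(1)] using \<phi>(2) z by simp
      then have "\<bar>dot (z k) b - \<phi> x\<bar> \<le> K * norm (lincomb y (z k) - x)"
        using K(2)[OF X_add[OF zk m]] by simp
      then show ?case using elim \<open>l \<le> \<phi> x\<close> by linarith
    qed
  qed
  then have "clusters v z" unfolding clusters_def by blast
  then show ?thesis using that[of z x] z zx by blast
qed

lemma coordinate_dominated: 
  assumes n: "n \<in> I" shows "dominated (unit n r) (\<bar>r\<bar> * Kc / norm (y n))"
  unfolding dominated_def
proof (intro conjI ballI)
  show "0 \<le> \<bar>r\<bar> * Kc / norm (y n)" using Kc by simp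
  fix a assume a: "a \<in> fs_on I"
  have "dot a (unit n r) = r * a n" using a dot_commute[of a "unit n r"] by (simp add: fs_on_def)
  moreover have "\<bar>a n\<bar> * norm (y n) \<le> Kc * norm (lincomb y a)" using unc_fs[OF a, of "{n}"] n by simp
  then have "\<bar>r\<bar> * (\<bar>a n\<bar> * norm (y n)) \<le> \<bar>r\<bar> * (Kc * norm (lincomb y a))" by (intro mult_left_mono) auto
  ultimately show "\<bar>dot a (unit n r)\<bar> \<le> \<bar>r\<bar> * Kc / norm (y n) * norm (lincomb y a)"
    using y_nz[OF n] by (simp add: field_simps abs_mult)
qed

text \<open>Coordinates are bounded functionals, so a coordinate that is eventually constant along
  \<open>v\<close> has that constant as its limit along \<open>z\<close>; the factors
  \<open>r = 1\<close> and \<open>r = -1\<close> give both inequalities.\<close>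

lemma weak_cluster_expansion:
  assumes v: "\<And>j. v j \<in> fs_on I" "\<And>j. norm (lincomb y (v j)) \<le> M"
    and c: "\<And>n. n \<in> I \<Longrightarrow> \<forall>\<^sub>F j in sequentially. v j n = c n" "supp c \<subseteq> I"
  obtains z x where "\<And>k. z k \<in> fs_on I" "(\<lambda>k. lincomb y (z k)) \<longlonglongrightarrow> x" "((\<lambda>n. c n *\<^sub>R y n) has_sum x) UNIV"
    "clusters v z"
proof -
  obtain z x where z: "\<And>k. z k \<in> fs_on I" "(\<lambda>k. lincomb y (z k)) \<longlonglongrightarrow> x"
    "clusters v z"
    by (rule weak_cluster[where v = v, OF v]) (rule that)
  obtain a where a: "supp a \<subseteq> I" "\<And>n. (\<lambda>k. z k n) \<longlonglongrightarrow> a n" "((\<lambda>n. a n *\<^sub>R y n) has_sum x) UNIV"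
    by (rule expansion[where z = z, OF z(1,2)]) (rule that)
  have fs: "v j \<in> fs" "z j \<in> fs" for j using v(1)[of j] z(1)[of j] by (auto simp: fs_on_def)
  have ge: "r * c n \<le> r * a n" if n: "n \<in> I" for n r
  proof (rule field_le_epsilon)
    fix \<delta> :: real assume \<delta>: "0 < \<delta>"
    have "\<forall>\<^sub>F k in sequentially. r * c n - \<delta> \<le> dot (z k) (unit n r)"
    proof (rule z(3)[unfolded clusters_def, rule_format, OF coordinate_dominated[OF n]])
      show "\<forall>\<^sub>F j in sequentially. r * c n \<le> dot (v j) (unit n r)"
        using c(1)[OF n] by eventually_elim (simp add: dot_commute[OF fs(1)])
    qed (rule \<delta>)
    then have "\<forall>\<^sub>F k in sequentially. r * c n - \<delta> \<le> r * z k n" by (simp add: dot_commute[OF fs(2)])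
    then have "r * c n - \<delta> \<le> r * a n"
      by (intro tendsto_lowerbound[OF tendsto_mult[OF tendsto_const a(2)]]) auto
    then show "r * c n \<le> r * a n + \<delta>" by simp
  qed
  have "a = c"
  proof
    fix n
    show "a n = c n"
    proof (cases "n \<in> I")
      case True
      then show ?thesis using ge[OF True, of 1] ge[OF True, of "-1"] by simp
    next
      case False
      then have "n \<notin> supp a" "n \<notin> supp c" using a(1) c(2) by auto
      then show ?thesis by (simp add: supp_def)
    qed
  qed
  then show ?thesis using that[of z x] z a by blast
qed

text \<open>The partial sums are bounded and eventually constant in each coordinate, so they cluster
  weakly at a vector with expansion \<open>a\<close>. Hence the series of \<open>a\<close> converges
  unconditionally, and a block that avoids a large finite set is small.\<close>

lemma reflexive_boundedly_complete:
  assumes a: "supp a \<subseteq> I" "\<And>S. finite S \<Longrightarrow> S \<subseteq> I \<Longrightarrow> norm (\<Sum>n\<in>S. a n *\<^sub>R y n) \<le> M"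
    and S: "\<And>j. finite (S j)" "\<And>j k :: nat. j \<noteq> k \<Longrightarrow> S j \<inter> S k = {}" and \<epsilon>: "0 < \<epsilon>"
  obtains j where "norm (\<Sum>n\<in>S j. a n *\<^sub>R y n) \<le> \<epsilon>"
proof -
  define v where "v m = restr ({..<m} \<inter> I) a" for m
  have v: "v m \<in> fs_on I" for m using supp_restr[of "{..<m} \<inter> I" a] by (auto simp: v_def fs_on_def)
  have vM: "norm (lincomb y (v m)) \<le> M" for m unfolding v_def using a(2) by (simp add: lincomb_restr)
  have vc: "\<forall>\<^sub>F m in sequentially. v m n = a n" if "n \<in> I" for n
    using eventually_gt_at_top[of n] by eventually_elim (use that in \<open>simp add: v_def restr_def\<close>)
  obtain x where x: "((\<lambda>n. a n *\<^sub>R y n) has_sum x) UNIV"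
    by (rule weak_cluster_expansion[where v = v, OF v vM vc a(1)]) (assumption, rule that)
  obtain S0 where S0: "finite S0" "\<And>S. finite S \<Longrightarrow> S0 \<subseteq> S \<Longrightarrow> norm (x - (\<Sum>n\<in>S. a n *\<^sub>R y n)) < \<epsilon> / 2"
    by (rule has_sum_normD[OF x half_gt_zero[OF \<epsilon>]]) (rule that)
  have "disj_seq (\<lambda>j n. if n \<in> S j then 1 else 0)" using S(2) by (auto simp: disj_seq_def disjoint_iff)
  then obtain j where "\<And>n. n \<in> S0 \<Longrightarrow> (if n \<in> S j then 1 else 0) = (0::real)"
    using disj_seq_avoids_finite[OF _ S0(1)] by blast
  then have j: "S0 \<inter> S j = {}" by (force split: if_splits)
  have "(\<Sum>n\<in>S j. a n *\<^sub>R y n) = (x - (\<Sum>n\<in>S0. a n *\<^sub>R y n)) - (x - (\<Sum>n\<in>S0 \<union> S j. a n *\<^sub>R y n))"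
    using S0(1) S(1) j by (simp add: sum.union_disjoint)
  also have "norm \<dots> \<le> \<epsilon> / 2 + \<epsilon> / 2"
    by (rule order_trans[OF norm_triangle_ineq4 add_mono]) (use S0 S(1) in \<open>auto intro: less_imp_le\<close>)
  finally show ?thesis using that[of j] by simp
qed

text \<open>In each coordinate a disjoint sequence is eventually 0, so its weak cluster point is 0.
  A lower bound \<epsilon> for the pairings with \<open>b\<close> would persist, up to
  \<open>\<epsilon> / 2\<close>, along a sequence of combinations that tends to 0 in norm.\<close>

lemma reflexive_shrinking:
  assumes b: "dominated b C"
    and f: "disj_seq f" "\<And>j. f j \<in> fs_on I" "\<And>j. norm (lincomb y (f j)) \<le> M" and \<epsilon>: "0 < \<epsilon>"
  obtains j where "dot (f j) b < \<epsilon>"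
proof (rule ccontr)
  assume "\<not> thesis"
  then have all: "\<epsilon> \<le> dot (f j) b" for j using that by (meson not_le)
  have fc: "\<forall>\<^sub>F j in sequentially. f j n = 0" if "n \<in> I" for n
  proof (cases "\<exists>j. f j n \<noteq> 0")
    case True
    then obtain j where "f j n \<noteq> 0" by blast
    then have "f k n = 0" if "k > j" for k using f(1) that unfolding disj_seq_def by (metis less_irrefl)
    then show ?thesis unfolding eventually_sequentially by (intro exI[of _ "Suc j"]) auto
  qed auto
  have s0: "supp (\<lambda>_. 0) \<subseteq> I" by (simp add: supp_def)
  obtain z x where z: "\<And>k. z k \<in> fs_on I" "(\<lambda>k. lincomb y (z k)) \<longlonglongrightarrow> x" "((\<lambda>n. 0 *\<^sub>R y n) has_sum x) UNIV"
    "clusters f z"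
    by (rule weak_cluster_expansion[where v = f and c = "\<lambda>_. 0", OF f(2,3) fc s0]) (assumption, rule that)
  have "x = 0" using z(3) by (auto intro: has_sum_unique)
  have "\<forall>\<^sub>F k in sequentially. \<epsilon> - \<epsilon> / 2 \<le> dot (z k) b"
    using all by (intro z(4)[unfolded clusters_def, rule_format, OF b] half_gt_zero \<epsilon>) auto
  moreover have "(\<lambda>k. C * norm (lincomb y (z k))) \<longlonglongrightarrow> C * norm x" by (intro tendsto_intros z)
  then have "\<forall>\<^sub>F k in sequentially. C * norm (lincomb y (z k)) < \<epsilon> / 2"
    using \<epsilon> \<open>x = 0\<close> by (intro order_tendstoD(2)) auto
  ultimately have "\<forall>\<^sub>F k in sequentially. False"
  proof eventually_elim
    case (elim k)
    have "\<bar>dot (z k) b\<bar> \<le> C * norm (lincomb y (z k))" using b z(1) unfolding dominated_def by blast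
    with elim show False by linarith
  qed
  then show False by simp
qed

end

section \<open>Analytic sets and separability\<close>

text \<open>Analytic sets as projections of closed sets. The second component, the witness, later
  becomes part of the branches.\<close>

definition projective :: "(nat \<Rightarrow> nat) set \<Rightarrow> bool"
  where "projective S \<longleftrightarrow> (\<exists>C :: ((nat \<Rightarrow> nat) \<times> (nat \<Rightarrow> nat)) set. closed C \<and> S = fst ` C)"

lemma closed_preimage: "closed C \<Longrightarrow> continuous_on UNIV h \<Longrightarrow> closed {x. h x \<in> C}"
  using continuous_on_closed_vimage[of UNIV h] by (simp add: vimage_def)

lemma projective_closed: "closed F \<Longrightarrow> projective F"
  unfolding projective_def by (intro exI[of _ "F \<times> UNIV"]) (auto intro: closed_Times)

lemma continuous_on_coord_snd: "continuous_on UNIV (\<lambda>x :: 'x::topological_space \<times> (nat \<Rightarrow> 'c::topological_space). snd x i)"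
  by (rule continuous_on_product_then_coordinatewise) (rule continuous_on_snd, rule continuous_on_id)

lemma projective_UN:
  assumes "\<And>i :: nat. projective (A i)" shows "projective (\<Union>i. A i)"
proof -
  obtain C where C: "\<And>i. closed (C i :: ((nat \<Rightarrow> nat) \<times> (nat \<Rightarrow> nat)) set)" "\<And>i. A i = fst ` C i"
    using assms unfolding projective_def by metis
  \<comment> \<open>The first entry of the witness names one of the sets; the remaining entries are
    the witness for that set.\<close>
  define D where "D = {x :: (nat \<Rightarrow> nat) \<times> (nat \<Rightarrow> nat). \<forall>i. snd x 0 = i \<longrightarrow> (fst x, \<lambda>n. snd x (Suc n)) \<in> C i}"
  have "closed D"
    unfolding D_def
  proof (intro closed_Collect_all closed_Collect_imp)
    fix i
    have "open ((\<lambda>x :: (nat \<Rightarrow> nat) \<times> (nat \<Rightarrow> nat). snd x 0) -` {i})"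
      by (intro open_vimage open_discrete continuous_on_coord_snd)
    then show "open {x :: (nat \<Rightarrow> nat) \<times> (nat \<Rightarrow> nat). snd x 0 = i}" by (simp add: vimage_def)
    show "closed {x. (fst x, \<lambda>n. snd x (Suc n)) \<in> C i}"
      by (intro closed_preimage C continuous_on_Pair continuous_on_fst continuous_on_id
          continuous_on_coordinatewise_then_product continuous_on_coord_snd)
  qed
  moreover have "(\<Union>i. A i) = fst ` D"
  proof (intro equalityI subsetI)
    fix z assume "z \<in> (\<Union>i. A i)"
    then obtain i \<gamma> where "(z, \<gamma>) \<in> C i" using C(2) by auto
    then have "(z, case_nat i \<gamma>) \<in> D" by (simp add: D_def)
    then show "z \<in> fst ` D" by force
  next
    fix z assume "z \<in> fst ` D"
    then obtain \<gamma> where "(z, \<lambda>n. \<gamma> (Suc n)) \<in> C (\<gamma> 0)" by (auto simp: D_def)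
    then have "z \<in> A (\<gamma> 0)" using C(2) by force
    then show "z \<in> (\<Union>i. A i)" by blast
  qed
  ultimately show ?thesis unfolding projective_def by blast
qed

lemma projective_INT:
  assumes "\<And>i :: nat. projective (A i)" shows "projective (\<Inter>i. A i)"
proof -
  obtain C where C: "\<And>i. closed (C i :: ((nat \<Rightarrow> nat) \<times> (nat \<Rightarrow> nat)) set)" "\<And>i. A i = fst ` C i"
    using assms unfolding projective_def by metis
  \<comment> \<open>One sequence holds witnesses for all the sets, separated by the pairing
    function.\<close>
  define D where "D = {x :: (nat \<Rightarrow> nat) \<times> (nat \<Rightarrow> nat). \<forall>i. (fst x, \<lambda>n. snd x (prod_encode (i, n))) \<in> C i}"
  have "closed D"
    unfolding D_def
    by (intro closed_Collect_all closed_preimage C continuous_on_Pair continuous_on_fst continuous_on_id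
        continuous_on_coordinatewise_then_product continuous_on_coord_snd)
  moreover have "(\<Inter>i. A i) = fst ` D"
  proof (intro equalityI subsetI)
    fix z assume z: "z \<in> (\<Inter>i. A i)"
    have "\<exists>\<gamma>. (z, \<gamma>) \<in> C i" for i using z C(2)[of i] by force
    then obtain \<gamma> where \<gamma>: "\<And>i. (z, \<gamma> i) \<in> C i" by metis
    have "(z, \<lambda>k. \<gamma> (fst (prod_decode k)) (snd (prod_decode k))) \<in> D" using \<gamma> by (simp add: D_def)
    then show "z \<in> fst ` D" by force
  next
    fix z assume "z \<in> fst ` D"
    then obtain \<gamma> where "\<And>i. (z, \<lambda>n. \<gamma> (prod_encode (i, n))) \<in> C i" by (auto simp: D_def)
    then have "z \<in> A i" for i using C(2) by force
    then show "z \<in> (\<Inter>i. A i)" by blast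
  qed
  ultimately show ?thesis unfolding projective_def by blast
qed

lemma closed_list_cylinder: "closed {y :: nat \<Rightarrow> nat. \<forall>i<length l. y i = l ! i}"
  by (intro closed_Collect_all closed_Collect_imp closed_Collect_eq open_Collect_const continuous_on_const
      continuous_on_product_coordinates)

text \<open>An open set is the union of the cylinders inside it; these are closed and indexed by
  lists, hence countably many.\<close>

lemma projective_open:
  assumes "open (U :: (nat \<Rightarrow> nat) set)" shows "projective U"
proof -
  define A where "A k = (let l = from_nat k :: nat list in
    if {y. \<forall>i<length l. y i = l ! i} \<subseteq> U then {y. \<forall>i<length l. y i = l ! i} else {})" for k :: nat
  have "projective (A k)" for k
    using closed_list_cylinder by (auto simp: A_def Let_def intro: projective_closed)
  then have "projective (\<Union>k. A k)" by (rule projective_UN)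
  moreover have "(\<Union>k. A k) = U"
  proof (intro equalityI subsetI)
    fix x assume "x \<in> U"
    then obtain m where m: "\<forall>y. (\<forall>i<m. y i = x i) \<longrightarrow> y \<in> U" using open_contains_cylinder[OF assms] by blast
    define l where "l = map x [0..<m]"
    have "{y. \<forall>i<length l. y i = l ! i} \<subseteq> U" using m by (auto simp: l_def)
    moreover have "x \<in> {y. \<forall>i<length l. y i = l ! i}" by (simp add: l_def)
    ultimately have "x \<in> A (to_nat l)" by (simp add: A_def)
    then show "x \<in> (\<Union>k. A k)" by blast
  qed (auto simp: A_def Let_def split: if_splits)
  ultimately show ?thesis by simp
qed

lemma projective_borel:
  assumes "S \<in> sets (borel :: (nat \<Rightarrow> nat) measure)" shows "projective S"
proof -
  have "S \<in> sigma_sets UNIV {S. open S}" using assms by (simp add: borel_def)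
  \<comment> \<open>Complements of projections need not be projections, so the induction carries the
    complement along.\<close>
  then have "projective S \<and> projective (- S)"
  proof induction
    case (Basic a)
    then show ?case by (auto intro: projective_open projective_closed)
  next
    case Empty
    then show ?case by (auto intro: projective_open)
  next
    case (Compl a)
    then show ?case by (simp add: Compl_eq_Diff_UNIV[symmetric])
  next
    case (Union a)
    have "- (\<Union>i. a i) = (\<Inter>i. - a i)" by auto
    then show ?case using Union projective_UN projective_INT by (metis (no_types, lifting))
  qed
  then show ?thesis ..
qed

text \<open>Point and witness are merged entry by entry, so that an initial segment of the code
  determines an initial segment of each. This makes the codes usable as branches of a tree.\<close>

lemma borel_closed_code:
  assumes "S \<in> sets (borel :: (nat \<Rightarrow> nat) measure)"
  obtains C :: "(nat \<Rightarrow> nat) set" where "closed C" "S = (\<lambda>\<omega> n. fst (prod_decode (\<omega> n))) ` C"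
proof -
  obtain D :: "((nat \<Rightarrow> nat) \<times> (nat \<Rightarrow> nat)) set" where D: "closed D" "S = fst ` D"
    using projective_borel[OF assms] unfolding projective_def by blast
  define C where "C = {\<omega>. ((\<lambda>n. fst (prod_decode (\<omega> n))), (\<lambda>n. snd (prod_decode (\<omega> n)))) \<in> D}"
  have cont: "continuous_on UNIV (\<lambda>\<omega> :: nat \<Rightarrow> nat. h (\<omega> n))" for h :: "nat \<Rightarrow> nat" and n
    by (rule continuous_on_compose2[of UNIV h]) (auto intro: continuous_on_discrete continuous_on_product_coordinates)
  have "closed C"
    unfolding C_def
    by (intro closed_preimage D continuous_on_Pair continuous_on_coordinatewise_then_product cont)
  moreover have "S = (\<lambda>\<omega> n. fst (prod_decode (\<omega> n))) ` C"
  proof (intro equalityI subsetI)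
    fix z assume "z \<in> S"
    then obtain \<gamma> where "(z, \<gamma>) \<in> D" using D(2) by force
    then show "z \<in> (\<lambda>\<omega> n. fst (prod_decode (\<omega> n))) ` C"
      by (intro image_eqI[of _ _ "\<lambda>n. prod_encode (z n, \<gamma> n)"]) (auto simp: C_def)
  qed (use D(2) in \<open>force simp: C_def\<close>)
  ultimately show ?thesis using that by blast
qed

section \<open>Separability of the space of continuous functions\<close>

lemma compact_cantor: "compact (UNIV :: (nat \<Rightarrow> bool) set)"
proof -
  have "compactin (product_topology (\<lambda>_. euclidean) UNIV) (PiE UNIV (\<lambda>_ :: nat. UNIV :: bool set))"
    by (subst compactin_PiE) (auto intro: finite_imp_compact)
  then show ?thesis by (simp add: euclidean_product_topology PiE_UNIV_domain)
qed

lemma uniformly_finitely_determined: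
  fixes f :: C2N assumes "0 < \<epsilon>"
  obtains n where "\<And>p p'. (\<And>i. i < n \<Longrightarrow> p i = p' i) \<Longrightarrow> \<bar>f p - f p'\<bar> < \<epsilon>"
proof -
  have "\<exists>m. \<forall>y. (\<forall>i<m. y i = p i) \<longrightarrow> \<bar>f y - f p\<bar> < \<epsilon> / 2" for p
  proof -
    have o: "open (apply_bcontfun f -` ball (f p) (\<epsilon> / 2))" by (intro open_vimage) auto
    have p: "p \<in> apply_bcontfun f -` ball (f p) (\<epsilon> / 2)" using assms by simp
    obtain m where "\<forall>y. (\<forall>i<m. y i = p i) \<longrightarrow> y \<in> apply_bcontfun f -` ball (f p) (\<epsilon> / 2)"
      using open_contains_cylinder[OF o p] by (rule exE)
    then have "\<forall>y. (\<forall>i<m. y i = p i) \<longrightarrow> \<bar>f y - f p\<bar> < \<epsilon> / 2"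
      by (simp add: dist_real_def abs_minus_commute)
    then show ?thesis by (rule exI)
  qed
  then obtain m where m: "\<And>p y. (\<forall>i<m p. y i = p i) \<Longrightarrow> \<bar>f y - f p\<bar> < \<epsilon> / 2" by metis
  obtain P where P: "finite P" "UNIV \<subseteq> (\<Union>p\<in>P. {y. \<forall>i<m p. y i = p i})"
    by (rule compactE_image[OF compact_cantor, of UNIV "\<lambda>p. {y. \<forall>i<m p. y i = p i}"]) (auto intro: open_cylinder)
  define n where "n = Max (insert 0 (m ` P))"
  have n: "m p \<le> n" if "p \<in> P" for p using P(1) that by (auto simp: n_def)
  have "\<bar>f p - f p'\<bar> < \<epsilon>" if pp': "\<And>i. i < n \<Longrightarrow> p i = p' i" for p p'
  proof -
    obtain p0 where p0: "p0 \<in> P" "\<forall>i<m p0. p i = p0 i" using P(2) by blast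
    then have "\<forall>i<m p0. p' i = p0 i" using pp' n[OF p0(1)] by force
    then have "\<bar>f p' - f p0\<bar> < \<epsilon> / 2" by (rule m)
    moreover have "\<bar>f p - f p0\<bar> < \<epsilon> / 2" using p0(2) by (rule m)
    ultimately show ?thesis by linarith
  qed
  then show ?thesis using that by blast
qed

text \<open>Rational step functions on the cylinders of length \<open>n\<close>; association lists
  make them countably coded.\<close>

definition step_fun :: "nat \<Rightarrow> (bool list \<times> rat) list \<Rightarrow> C2N"
  where "step_fun n xs = Bcontfun (\<lambda>p. case map_of xs (map p [0..<n]) of None \<Rightarrow> 0 | Some r \<Rightarrow> real_of_rat r)"

lemma apply_step_fun:
  "apply_bcontfun (step_fun n xs) p = (case map_of xs (map p [0..<n]) of None \<Rightarrow> 0 | Some r \<Rightarrow> real_of_rat r)"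
proof -
  let ?g = "\<lambda>p. case map_of xs (map p [0..<n]) of None \<Rightarrow> 0 | Some r \<Rightarrow> real_of_rat r"
  have "continuous_on UNIV ?g"
  proof (rule continuous_on_finitely_determined)
    fix p p' :: "nat \<Rightarrow> bool" assume "\<And>i. i < n \<Longrightarrow> p i = p' i"
    then have "map p [0..<n] = map p' [0..<n]" by simp
    then show "?g p = ?g p'" by (simp only:)
  qed
  moreover have "norm (?g p) \<le> (\<Sum>r\<in>snd ` set xs. \<bar>real_of_rat r\<bar>)" for p
  proof (cases "map_of xs (map p [0..<n])")
    case (Some r)
    then have "r \<in> snd ` set xs" by (force dest: map_of_SomeD)
    then have "\<bar>real_of_rat r\<bar> \<le> (\<Sum>r\<in>snd ` set xs. \<bar>real_of_rat r\<bar>)" by (intro member_le_sum) auto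
    then show ?thesis using Some by simp
  qed (simp add: sum_nonneg)
  ultimately have "?g \<in> bcontfun" by (rule bcontfun_normI)
  then show ?thesis by (simp add: step_fun_def Bcontfun_inverse)
qed

lemma C2N_separable:
  obtains d :: "nat \<Rightarrow> C2N" where "\<And>f \<epsilon>. 0 < \<epsilon> \<Longrightarrow> \<exists>k. norm (f - d k) < \<epsilon>"
proof -
  define d where "d k = (case from_nat k of (n, xs) \<Rightarrow> step_fun n xs)" for k
  have "\<exists>k. norm (f - d k) < \<epsilon>" if \<epsilon>: "0 < \<epsilon>" for f \<epsilon>
  proof -
    obtain n where n: "\<And>p p'. (\<And>i. i < n \<Longrightarrow> p i = p' i) \<Longrightarrow> \<bar>f p - f p'\<bar> < \<epsilon> / 4"
      using uniformly_finitely_determined[of "\<epsilon> / 4" f] \<epsilon> by auto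
    define pad where "pad l = (\<lambda>i. if i < n then l ! i else False)" for l
    have "\<exists>r. \<bar>real_of_rat r - f (pad l)\<bar> < \<epsilon> / 4" for l
    proof -
      obtain r where "f (pad l) - \<epsilon> / 4 < real_of_rat r" "real_of_rat r < f (pad l)"
        using of_rat_dense[of "f (pad l) - \<epsilon> / 4" "f (pad l)"] \<epsilon> by auto
      then show ?thesis by (intro exI[of _ r]) (auto simp: abs_if)
    qed
    then obtain r where r: "\<And>l. \<bar>real_of_rat (r l) - f (pad l)\<bar> < \<epsilon> / 4" by metis
    have "finite {l :: bool list. length l = n}" using finite_lists_length_eq[of "UNIV :: bool set" n] by simp
    then obtain L where L: "set L = {l :: bool list. length l = n}" using finite_list by blast
    let ?xs = "map (\<lambda>l. (l, r l)) L"
    have "norm (f - step_fun n ?xs) \<le> \<epsilon> / 2"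
    proof (rule norm_bound)
      fix p :: "nat \<Rightarrow> bool"
      let ?l = "map p [0..<n]"
      have "map_of ?xs ?l = Some (r ?l)" using L by (simp add: map_of_map_restrict restrict_map_def)
      then have "apply_bcontfun (step_fun n ?xs) p = real_of_rat (r ?l)" by (simp add: apply_step_fun)
      moreover have "\<bar>f p - f (pad ?l)\<bar> < \<epsilon> / 4" by (rule n) (simp add: pad_def)
      ultimately have "\<bar>f p - apply_bcontfun (step_fun n ?xs) p\<bar> \<le> \<epsilon> / 2" using r[of ?l] by linarith
      then show "norm (apply_bcontfun (f - step_fun n ?xs) p) \<le> \<epsilon> / 2" by simp
    qed
    moreover have "d (to_nat (n, ?xs)) = step_fun n ?xs" by (simp add: d_def)
    ultimately show ?thesis using \<epsilon> by (intro exI[of _ "to_nat (n, ?xs)"]) simp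
  qed
  then show ?thesis using that by blast
qed

section \<open>Coding unconditional bases\<close>

definition absf :: "C2N \<Rightarrow> C2N"
  where "absf f = Bcontfun (\<lambda>p. \<bar>f p\<bar>)"

lemma apply_absf [simp]: "apply_bcontfun (absf f) p = \<bar>f p\<bar>"
proof -
  have "(\<lambda>p. \<bar>f p\<bar>) \<in> bcontfun"
    by (rule bcontfun_normI[where b = "norm f"]) (use norm_bounded[of f] in \<open>auto intro!: continuous_intros\<close>)
  then show ?thesis by (simp add: absf_def Bcontfun_inverse)
qed

lemma absf_eq_0: "absf f = 0 \<Longrightarrow> f = 0"
  by (rule bcontfun_eqI) (metis abs_eq_0 apply_absf zero_bcontfun.rep_eq)

lemma apply_lincomb:
  fixes x :: "nat \<Rightarrow> C2N"
  shows "apply_bcontfun (lincomb x a) p = (\<Sum>n\<in>supp a. a n * x n p)"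
proof -
  have "apply_bcontfun (\<Sum>n\<in>S. a n *\<^sub>R x n) p = (\<Sum>n\<in>S. a n * x n p)" for S
    by (induction S rule: infinite_finite_induct) auto
  then show ?thesis by (simp add: lincomb_def)
qed

lemma norm_lincomb_le_weight:
  fixes x :: "nat \<Rightarrow> C2N"
  assumes "\<And>p. (\<Sum>n\<in>supp a. \<bar>a n\<bar> * \<bar>x n p\<bar>) \<le> r" shows "norm (lincomb x a) \<le> r"
proof (rule norm_bound)
  fix p
  have "norm (apply_bcontfun (lincomb x a) p) \<le> (\<Sum>n\<in>supp a. \<bar>a n * x n p\<bar>)"
    unfolding apply_lincomb by (simp add: sum_abs)
  also have "\<dots> \<le> r" using assms[of p] by (simp add: abs_mult)
  finally show "norm (apply_bcontfun (lincomb x a) p) \<le> r" .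
qed

text \<open>The tolerances \<open>(1/2) ^ (n + 2)\<close> have total sum \<open>1/2\<close>, and
  each coefficient is bounded by the norm of the combination.\<close>

lemma perturbation:
  fixes w w' :: "nat \<Rightarrow> 'v::real_normed_vector"
  assumes coord: "\<And>n. \<bar>a n\<bar> \<le> norm (lincomb w a)" and close: "\<And>n. norm (w n - w' n) \<le> (1/2) ^ (n + 2)"
    and a: "a \<in> fs"
  shows "norm (lincomb w a - lincomb w' a) \<le> norm (lincomb w a) / 2"
proof -
  have geo: "(\<Sum>n<m. (1/2::real) ^ (n + 2)) = 1/2 - (1/2) ^ (m + 1)" for m by (induction m) auto
  obtain m where m: "supp a \<subseteq> {..<m}" using finite_nat_iff_bounded fsD[OF a] by blast
  have "lincomb w a - lincomb w' a = (\<Sum>n\<in>supp a. a n *\<^sub>R (w n - w' n))"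
    by (simp add: lincomb_def scaleR_diff_right sum_subtractf)
  also have "norm \<dots> \<le> (\<Sum>n\<in>supp a. norm (lincomb w a) * (1/2) ^ (n + 2))"
  proof (rule order_trans[OF norm_sum sum_mono])
    fix n
    have "\<bar>a n\<bar> * norm (w n - w' n) \<le> norm (lincomb w a) * (1/2) ^ (n + 2)"
      by (intro mult_mono coord close) auto
    then show "norm (a n *\<^sub>R (w n - w' n)) \<le> norm (lincomb w a) * (1/2) ^ (n + 2)" by simp
  qed
  also have "\<dots> \<le> (\<Sum>n<m. norm (lincomb w a) * (1/2) ^ (n + 2))"
    by (intro sum_mono2 m) auto
  also have "\<dots> = norm (lincomb w a) * (1/2 - (1/2) ^ (m + 1))" by (simp only: sum_distrib_left[symmetric] geo)
  also have "\<dots> \<le> norm (lincomb w a) * (1/2)" by (intro mult_left_mono) auto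
  finally show ?thesis by simp
qed

text \<open>The supremum over \<open>p\<close> of the weighted sums is the largest norm of the linear combination over all
  choices of signs, so the second condition is unconditionality with constant \<open>c\<close>; the first one makes
  the coordinate functionals have norm at most 1.\<close>

definition good :: "real \<Rightarrow> (nat \<Rightarrow> C2N) \<Rightarrow> bool"
  where "good c x \<longleftrightarrow> (\<forall>n. c \<le> norm (x n)) \<and> (\<forall>a. a \<in> fs \<longrightarrow> (\<forall>p. (\<Sum>n\<in>supp a. \<bar>a n\<bar> * \<bar>x n p\<bar>) \<le> c * norm (lincomb x a)))"

text \<open>Using \<open>c\<close> both as the unconditional constant and as the lower bound of the
  norms makes it cancel; hence one sequence of tolerances serves for all values of
  \<open>c\<close>.\<close>

lemma coord_le_of_weight:
  fixes x :: "nat \<Rightarrow> C2N"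
  assumes c: "0 < c" and a: "a \<in> fs"
    and le: "\<And>p. (\<Sum>n\<in>supp a. \<bar>a n\<bar> * \<bar>x n p\<bar>) \<le> c * norm (lincomb x a)" and x: "c \<le> norm (x n)"
  shows "\<bar>a n\<bar> \<le> norm (lincomb x a)"
proof (cases "n \<in> supp a")
  case True
  have "norm (a n *\<^sub>R x n) \<le> c * norm (lincomb x a)"
  proof (rule norm_bound)
    fix p
    have "\<bar>a n\<bar> * \<bar>x n p\<bar> \<le> (\<Sum>n\<in>supp a. \<bar>a n\<bar> * \<bar>x n p\<bar>)"
      using True fsD[OF a] by (intro member_le_sum) auto
    also have "\<dots> \<le> c * norm (lincomb x a)" by (rule le)
    finally show "norm (apply_bcontfun (a n *\<^sub>R x n) p) \<le> c * norm (lincomb x a)" by (simp add: abs_mult)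
  qed
  moreover have "\<bar>a n\<bar> * c \<le> \<bar>a n\<bar> * norm (x n)" by (intro mult_left_mono x) auto
  ultimately have "c * \<bar>a n\<bar> \<le> c * norm (lincomb x a)" by (simp add: mult.commute)
  then show ?thesis using c by simp
next
  case False
  then show ?thesis by (simp add: supp_def)
qed

lemma good_coord: "0 < c \<Longrightarrow> good c x \<Longrightarrow> a \<in> fs \<Longrightarrow> \<bar>a n\<bar> \<le> norm (lincomb x a)"
  unfolding good_def by (rule coord_le_of_weight) auto

text \<open>By \<open>perturbation\<close> the norms of corresponding combinations of
  \<open>x\<close> and \<open>y\<close> agree up to a factor 2. This compares the weights of a coded
  sequence \<open>x\<close> with a nearby sequence \<open>y\<close> in a member of the
  family.\<close>

lemma good_perturbed:
  fixes x :: "nat \<Rightarrow> C2N"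
  assumes c: "0 < c" and x: "good c x" and close: "\<And>n. norm (x n - y n) \<le> (1/2) ^ (n + 2)" and a: "a \<in> fs"
  shows "(\<Sum>n\<in>supp a. \<bar>a n\<bar> * \<bar>x n p\<bar>) \<le> 2 * c * norm (lincomb y a)"
    and "(\<And>p. (\<Sum>n\<in>supp a. \<bar>a n\<bar> * \<bar>x n p\<bar>) \<le> r) \<Longrightarrow> norm (lincomb y a) \<le> 2 * r"
proof -
  have 1: "norm (lincomb x a - lincomb y a) \<le> norm (lincomb x a) / 2"
    by (rule perturbation[OF good_coord[OF c x a] close a])
  have 2: "norm (lincomb x a) \<le> 2 * norm (lincomb y a)" "norm (lincomb y a) \<le> 2 * norm (lincomb x a)"
    using 1 norm_triangle_ineq2[of "lincomb x a" "lincomb y a"] norm_triangle_ineq2[of "lincomb y a" "lincomb x a"]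
    by (auto simp: norm_minus_commute)
  have "(\<Sum>n\<in>supp a. \<bar>a n\<bar> * \<bar>x n p\<bar>) \<le> c * norm (lincomb x a)" using x a by (simp add: good_def)
  also have "\<dots> \<le> c * (2 * norm (lincomb y a))" using 2 c by (intro mult_left_mono) auto
  finally show "(\<Sum>n\<in>supp a. \<bar>a n\<bar> * \<bar>x n p\<bar>) \<le> 2 * c * norm (lincomb y a)" by simp
  show "norm (lincomb y a) \<le> 2 * r" if "\<And>p. (\<Sum>n\<in>supp a. \<bar>a n\<bar> * \<bar>x n p\<bar>) \<le> r"
    using norm_lincomb_le_weight[OF that] 2(2) by linarith
qed

text \<open>The last two assumptions make the weight norm equivalent to the norm of a sequence in a
  reflexive space. Bounded completeness and shrinking are thereby carried over to the weights, in
  the form that \<open>clique_family\<close> demands.\<close>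

locale weighted_in_reflexive =
  fixes y :: "nat \<Rightarrow> C2N" and I :: "nat set" and u :: "nat \<Rightarrow> C2N" and c :: real and X :: "C2N set"
  assumes X: "X \<in> SB" and refl: "reflexive_space X" and yX: "i \<in> I \<Longrightarrow> y i \<in> X" and c: "0 < c"
    and u_nonneg: "0 \<le> u i p" and u_nz: "u i \<noteq> 0"
    and weight_le: "a \<in> fs_on I \<Longrightarrow> (\<Sum>n\<in>supp a. \<bar>a n\<bar> * u n p) \<le> c * norm (lincomb y a)"
    and norm_le: "a \<in> fs_on I \<Longrightarrow> (\<And>p. (\<Sum>n\<in>supp a. \<bar>a n\<bar> * u n p) \<le> r) \<Longrightarrow> norm (lincomb y a) \<le> 2 * r"
begin

lemma restr_fs_on: "finite S \<Longrightarrow> S \<subseteq> I \<Longrightarrow> restr S a \<in> fs_on I"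
  using supp_restr[of S a] by (auto simp: fs_on_def)

lemma weight_sum: "finite S \<Longrightarrow> (\<Sum>n\<in>supp (restr S a). \<bar>restr S a n\<bar> * u n p) = (\<Sum>n\<in>S. \<bar>a n\<bar> * u n p)"
  by (rule sum.mono_neutral_cong_left) (auto simp: supp_def restr_def)

lemma weight_le': "finite S \<Longrightarrow> S \<subseteq> I \<Longrightarrow> (\<Sum>n\<in>S. \<bar>a n\<bar> * u n p) \<le> c * norm (\<Sum>n\<in>S. a n *\<^sub>R y n)"
  using weight_le[OF restr_fs_on, of S a p] by (simp add: weight_sum lincomb_restr)

lemma norm_le': "finite S \<Longrightarrow> S \<subseteq> I \<Longrightarrow> (\<And>p. (\<Sum>n\<in>S. \<bar>a n\<bar> * u n p) \<le> r) \<Longrightarrow> norm (\<Sum>n\<in>S. a n *\<^sub>R y n) \<le> 2 * r"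
  using norm_le[OF restr_fs_on, of S a r] by (simp add: weight_sum lincomb_restr)

sublocale unconditional_in_reflexive y I "2 * c" X
proof
  show "y n \<noteq> 0" if n: "n \<in> I" for n
  proof
    assume "y n = 0"
    then have "u n p \<le> 0" for p using weight_le'[of "{n}" "\<lambda>_. 1" p] n by simp
    then have "u n p = 0" for p using u_nonneg by (intro antisym)
    then have "u n = 0" by (intro bcontfun_eqI) simp
    then show False using u_nz by simp
  qed
  show "norm (\<Sum>n\<in>S. a n *\<^sub>R y n) \<le> 2 * c * norm (\<Sum>n\<in>T. a n *\<^sub>R y n)" if T: "finite T" "T \<subseteq> I" "S \<subseteq> T" for S T a
  proof -
    have "norm (\<Sum>n\<in>S. a n *\<^sub>R y n) \<le> 2 * (c * norm (\<Sum>n\<in>T. a n *\<^sub>R y n))"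
    proof (rule norm_le')
      show "finite S" "S \<subseteq> I" using T finite_subset by auto
      fix p
      have "(\<Sum>n\<in>S. \<bar>a n\<bar> * u n p) \<le> (\<Sum>n\<in>T. \<bar>a n\<bar> * u n p)" using T u_nonneg by (intro sum_mono2) auto
      also have "\<dots> \<le> c * norm (\<Sum>n\<in>T. a n *\<^sub>R y n)" by (rule weight_le'[OF T(1,2)])
      finally show "(\<Sum>n\<in>S. \<bar>a n\<bar> * u n p) \<le> c * norm (\<Sum>n\<in>T. a n *\<^sub>R y n)" .
    qed
    then show ?thesis by simp
  qed
qed (use X refl yX c in auto)

lemma weight_ballD: "a \<in> weight_ball u \<Longrightarrow> (\<Sum>n\<in>supp a. a n * u n p) \<le> 1"
  by (auto simp: weight_ball_def fpolar_def dot_def)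

lemma clique_bc:
  assumes a: "\<And>n. 0 \<le> a n" "supp a \<subseteq> I" "\<And>S. finite S \<Longrightarrow> restr S a \<in> weight_ball u"
    and S: "\<And>j :: nat. finite (S j)" "\<And>j k. j \<noteq> k \<Longrightarrow> S j \<inter> S k = {}" and \<epsilon>: "0 < \<epsilon>"
  shows "\<exists>j. \<forall>p. (\<Sum>n\<in>S j. a n * u n p) \<le> \<epsilon>"
proof -
  have one: "(\<Sum>n\<in>T. \<bar>a n\<bar> * u n p) \<le> 1" if T: "finite T" for T p
  proof -
    have "(\<Sum>n\<in>T. \<bar>a n\<bar> * u n p) = (\<Sum>n\<in>supp (restr T a). \<bar>restr T a n\<bar> * u n p)" by (rule weight_sum[OF T, symmetric])
    also have "\<dots> = (\<Sum>n\<in>supp (restr T a). restr T a n * u n p)" using a(1) by (simp add: restr_def)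
    also have "\<dots> \<le> 1" by (rule weight_ballD[OF a(3)[OF T]])
    finally show ?thesis .
  qed
  have fin: "finite (S j \<inter> I)" and dis: "j \<noteq> k \<Longrightarrow> (S j \<inter> I) \<inter> (S k \<inter> I) = {}" for j k using S by auto
  have bound: "norm (\<Sum>n\<in>T. a n *\<^sub>R y n) \<le> 2 * 1" if "finite T" "T \<subseteq> I" for T
    using that one by (intro norm_le')
  have pos: "0 < \<epsilon> / c" using \<epsilon> c by simp
  obtain j where j: "norm (\<Sum>n\<in>S j \<inter> I. a n *\<^sub>R y n) \<le> \<epsilon> / c"
    by (rule reflexive_boundedly_complete[where S = "\<lambda>j. S j \<inter> I", OF a(2) bound fin dis pos]) (assumption | rule that)+
  have "(\<Sum>n\<in>S j. a n * u n p) \<le> \<epsilon>" for p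
  proof -
    have "(\<Sum>n\<in>S j. a n * u n p) = (\<Sum>n\<in>S j \<inter> I. \<bar>a n\<bar> * u n p)"
      using S(1) a(1,2) by (intro sum.mono_neutral_cong_right) (auto simp: supp_def)
    also have "\<dots> \<le> c * norm (\<Sum>n\<in>S j \<inter> I. a n *\<^sub>R y n)" by (rule weight_le'[OF fin]) auto
    also have "\<dots> \<le> c * (\<epsilon> / c)" using j c by (intro mult_left_mono) auto
    finally show ?thesis using c by simp
  qed
  then show ?thesis by blast
qed

lemma clique_sh:
  assumes b: "\<And>n. 0 \<le> b n" "\<And>a. a \<in> weight_ball u \<Longrightarrow> dot a b \<le> 1"
    and f: "disj_seq f" "\<And>j. f j \<in> weight_ball u" "\<And>j. supp (f j) \<subseteq> I" and \<epsilon>: "0 < \<epsilon>"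
  shows "\<exists>j. dot (f j) b < \<epsilon>"
proof -
  have dom: "dominated b c"
    unfolding dominated_def
  proof (intro conjI ballI)
    show "0 \<le> c" using c by simp
    fix a assume a: "a \<in> fs_on I"
    have afs: "a \<in> fs" using a by (simp add: fs_on_def)
    define r where "r = c * norm (lincomb y a)"
    have r0: "0 \<le> r" using c by (simp add: r_def)
    have sle: "(\<Sum>n\<in>supp a. \<bar>a n\<bar> * u n p) \<le> r" for p unfolding r_def by (rule weight_le[OF a])
    have abs: "\<bar>dot a b\<bar> \<le> (\<Sum>n\<in>supp a. \<bar>a n\<bar> * b n)"
      unfolding dot_def by (rule order_trans[OF sum_abs]) (simp add: abs_mult b(1))
    \<comment> \<open>The added \<open>e\<close> makes the divisor positive even for
      \<open>r = 0\<close>.\<close>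
    have "(\<Sum>n\<in>supp a. \<bar>a n\<bar> * b n) \<le> r + e" if e: "0 < e" for e
    proof -
      define t where "t = r + e"
      have t: "0 < t" using r0 e by (simp add: t_def)
      define a' where "a' = (\<lambda>n. \<bar>a n\<bar> / t)"
      have supp: "supp a' = supp a" using t by (auto simp: a'_def supp_def)
      have "dot a' (\<lambda>n. u n p) \<le> 1" for p
      proof -
        have "dot a' (\<lambda>n. u n p) = (\<Sum>n\<in>supp a. \<bar>a n\<bar> * u n p) / t"
          unfolding dot_def supp by (simp add: a'_def sum_divide_distrib)
        also have "\<dots> \<le> 1" using sle[of p] e t by (simp add: t_def)
        finally show ?thesis .
      qed
      then have "a' \<in> weight_ball u"
        using afs supp t by (auto simp: weight_ball_def fpolar_def fs_def) (simp add: a'_def)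
      then have "dot a' b \<le> 1" by (rule b(2))
      moreover have "dot a' b = (\<Sum>n\<in>supp a. \<bar>a n\<bar> * b n) / t"
        unfolding dot_def supp by (simp add: a'_def sum_divide_distrib)
      ultimately show ?thesis using t by (simp add: t_def)
    qed
    then have "(\<Sum>n\<in>supp a. \<bar>a n\<bar> * b n) \<le> r" by (rule field_le_epsilon)
    then show "\<bar>dot a b\<bar> \<le> c * norm (lincomb y a)" using abs by (simp add: r_def)
  qed
  have fI: "f j \<in> fs_on I" for j using f(2,3) by (auto simp: fs_on_def weight_ball_def fpolar_def)
  have fM: "norm (lincomb y (f j)) \<le> 2 * 1" for j
  proof (rule norm_le[OF fI])
    fix p
    have "0 \<le> f j n" for n using f(2)[of j] by (auto simp: weight_ball_def fpolar_def)
    then show "(\<Sum>n\<in>supp (f j). \<bar>f j n\<bar> * u n p) \<le> 1" using weight_ballD[OF f(2)[of j], of p] by simp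
  qed
  obtain j where "dot (f j) b < \<epsilon>"
    by (rule reflexive_shrinking[where f = f, OF dom f(1) fI fM \<epsilon>]) (rule that)
  then show ?thesis by blast
qed

end

section \<open>Borel codes of perturbed bases\<close>

definition dec1 :: "nat \<Rightarrow> nat" where "dec1 k = fst (prod_decode k)"
definition dec2 :: "nat \<Rightarrow> nat" where "dec2 k = snd (prod_decode k)"

text \<open>A code interleaves the indices of a sequence in the dense set with a parameter of a member of the
  family to which the sequence is close.\<close>

definition code_set :: "((nat \<Rightarrow> nat) \<Rightarrow> C2N set) \<Rightarrow> (nat \<Rightarrow> C2N) \<Rightarrow> (nat \<Rightarrow> nat) set"
  where "code_set f d = {\<zeta>. (\<exists>c :: nat. 1 \<le> c \<and> good (real c) (\<lambda>n. d (dec1 (\<zeta> n)))) \<and>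
    (\<forall>n. f (\<lambda>k. dec2 (\<zeta> k)) \<inter> ball (d (dec1 (\<zeta> n))) ((1/2) ^ (n + 2)) \<noteq> {})}"

lemma continuous_on_coord_compose:
  "continuous_on UNIV (\<lambda>\<zeta> :: nat \<Rightarrow> nat. h (\<zeta> n) :: 'b::topological_space)"
  by (rule continuous_on_compose2[of UNIV h]) (auto intro: continuous_on_discrete continuous_on_product_coordinates)

text \<open>Each inequality depends on finitely many entries of the code, and these are
  discrete.\<close>

lemma closed_good: "closed {\<zeta>. good c (\<lambda>n. d (dec1 (\<zeta> n)))}"
  unfolding good_def lincomb_def
  by (intro closed_Collect_conj closed_Collect_all closed_Collect_imp closed_Collect_le open_Collect_const
      continuous_on_sum continuous_on_mult continuous_on_const continuous_on_norm continuous_on_scaleR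
      continuous_on_coord_compose[of "\<lambda>k. norm (d (dec1 k))"] continuous_on_coord_compose[of "\<lambda>k. \<bar>d (dec1 k) _\<bar>"]
      continuous_on_coord_compose[of "\<lambda>k. d (dec1 k)"])

lemma code_set_borel:
  assumes f: "f \<in> borel \<rightarrow>\<^sub>M Effros"
  shows "code_set f d \<in> sets borel"
proof -
  have z: "(\<lambda>\<zeta> k. dec2 (\<zeta> k)) \<in> borel \<rightarrow>\<^sub>M (borel :: (nat \<Rightarrow> nat) measure)"
    by (intro borel_measurable_continuous_onI continuous_on_coordinatewise_then_product continuous_on_coord_compose)
  have fz: "(\<lambda>\<zeta>. f (\<lambda>k. dec2 (\<zeta> k))) \<in> borel \<rightarrow>\<^sub>M Effros" by (rule measurable_compose[OF z f])
  have hit: "{\<zeta>. f (\<lambda>k. dec2 (\<zeta> k)) \<inter> V \<noteq> {}} \<in> sets borel" if "open V" for V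
  proof -
    have "{X \<in> SB. X \<inter> V \<noteq> {}} \<in> sets Effros"
      unfolding Effros_def using that by (auto intro!: in_measure_of)
    from measurable_sets[OF fz this] have "(\<lambda>\<zeta>. f (\<lambda>k. dec2 (\<zeta> k))) -` {X \<in> SB. X \<inter> V \<noteq> {}} \<in> sets borel" by simp
    moreover have "f (\<lambda>k. dec2 (\<zeta> k)) \<in> SB" for \<zeta>
      using measurable_space[OF fz, of \<zeta>] by (simp add: Effros_def space_measure_of_conv)
    then have "(\<lambda>\<zeta>. f (\<lambda>k. dec2 (\<zeta> k))) -` {X \<in> SB. X \<inter> V \<noteq> {}} = {\<zeta>. f (\<lambda>k. dec2 (\<zeta> k)) \<inter> V \<noteq> {}}" by auto
    ultimately show ?thesis by simp
  qed
  \<comment> \<open>Splitting by the value \<open>k\<close> of \<open>\<zeta> n\<close> makes the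
    ball a fixed open set, so that hitting it is the preimage of a generator of the Effros
    structure.\<close>
  have eq: "code_set f d = (\<Union>c\<in>{1..}. {\<zeta>. good (real c) (\<lambda>n. d (dec1 (\<zeta> n)))}) \<inter>
    (\<Inter>n. \<Union>k. {\<zeta>. \<zeta> n = k} \<inter> {\<zeta>. f (\<lambda>k. dec2 (\<zeta> k)) \<inter> ball (d (dec1 k)) ((1/2) ^ (n + 2)) \<noteq> {}})"
    unfolding code_set_def by auto
  have coord: "{\<zeta> :: nat \<Rightarrow> nat. \<zeta> n = k} \<in> sets borel" for n k
    by (intro borel_closed closed_Collect_eq continuous_on_const continuous_on_product_coordinates)
  show ?thesis
    unfolding eq
    by (intro sets.Int sets.countable_UN' sets.countable_INT'' sets.countable_UN coord hit borel_closed closed_good open_ball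
        image_subsetI | simp)+
qed

context unconditional_basis_space
begin

text \<open>Equivalence on finite sums makes the series in \<open>g\<close> converge along with the
  one in \<open>e\<close>, which defines the embedding.\<close>

lemma embeds_by_basis:
  fixes g :: "nat \<Rightarrow> C2N"
  assumes Y: "Y \<in> SB" and g: "\<And>n. g n \<in> Y" and c1: "0 < c1"
    and lower: "\<And>S a. finite S \<Longrightarrow> c1 * norm (\<Sum>n\<in>S. a n *\<^sub>R e n) \<le> norm (\<Sum>n\<in>S. a n *\<^sub>R g n)"
    and upper: "\<And>S a. finite S \<Longrightarrow> norm (\<Sum>n\<in>S. a n *\<^sub>R g n) \<le> c2 * norm (\<Sum>n\<in>S. a n *\<^sub>R e n)"
  shows "embeds X Y"
proof -
  have subY: "subspace Y" and closedY: "closed Y" using Y by (auto simp: SB_def)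
  have "0 < norm (e 0)" using e_nz by simp
  moreover have "c1 * norm (e 0) \<le> c2 * norm (e 0)" using lower[of "{0}" "\<lambda>_. 1"] upper[of "{0}" "\<lambda>_. 1"] by simp
  ultimately have c2: "0 < c2" using c1 by simp
  have conv: "convergent (\<lambda>m. \<Sum>n<m. cf x n *\<^sub>R g n)" if x: "x \<in> X" for x
  proof (rule Cauchy_convergent_C2N)
    show "Cauchy (\<lambda>m. \<Sum>n<m. cf x n *\<^sub>R g n)"
      unfolding Cauchy_iff
    proof (intro allI impI)
      fix \<epsilon> :: real assume \<epsilon>: "0 < \<epsilon>"
      have "Cauchy (\<lambda>m. \<Sum>n<m. cf x n *\<^sub>R e n)"
        using cf_sums[OF x] unfolding sums_def by (rule LIMSEQ_imp_Cauchy)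
      then obtain m where m: "\<And>k l. m \<le> k \<Longrightarrow> m \<le> l \<Longrightarrow> norm ((\<Sum>n<k. cf x n *\<^sub>R e n) - (\<Sum>n<l. cf x n *\<^sub>R e n)) < \<epsilon> / c2"
        unfolding Cauchy_iff using \<epsilon> c2 by (meson divide_pos_pos)
      have dif: "(\<Sum>n<k. cf x n *\<^sub>R w n) - (\<Sum>n<l. cf x n *\<^sub>R w n) = (\<Sum>n\<in>{l..<k}. cf x n *\<^sub>R w n)"
        if "l \<le> k" for k l and w :: "nat \<Rightarrow> C2N"
        using that sum_diff[of "{..<k}" "{..<l}" "\<lambda>n. cf x n *\<^sub>R w n"] by (simp add: lessThan_minus_lessThan)
      have lt: "norm ((\<Sum>n<k. cf x n *\<^sub>R g n) - (\<Sum>n<l. cf x n *\<^sub>R g n)) < \<epsilon>" if "m \<le> l" "l \<le> k" for k l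
      proof -
        have "norm ((\<Sum>n<k. cf x n *\<^sub>R g n) - (\<Sum>n<l. cf x n *\<^sub>R g n)) \<le> c2 * norm (\<Sum>n\<in>{l..<k}. cf x n *\<^sub>R e n)"
          unfolding dif[OF that(2)] by (rule upper) simp
        also have "\<dots> < c2 * (\<epsilon> / c2)"
          using m[of k l] that c2 unfolding dif[OF that(2)] by (intro mult_strict_left_mono) auto
        finally show ?thesis using c2 by simp
      qed
      show "\<exists>M. \<forall>k\<ge>M. \<forall>l\<ge>M. norm ((\<Sum>n<k. cf x n *\<^sub>R g n) - (\<Sum>n<l. cf x n *\<^sub>R g n)) < \<epsilon>"
      proof (intro exI allI impI)
        fix k l assume "m \<le> k" "m \<le> l"
        then show "norm ((\<Sum>n<k. cf x n *\<^sub>R g n) - (\<Sum>n<l. cf x n *\<^sub>R g n)) < \<epsilon>"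
          using lt[of l k] lt[of k l] by (cases "l \<le> k") (auto simp: norm_minus_commute)
      qed
    qed
  qed
  define T where "T x = lim (\<lambda>m. \<Sum>n<m. cf x n *\<^sub>R g n)" for x
  have T: "(\<lambda>m. \<Sum>n<m. cf x n *\<^sub>R g n) \<longlonglongrightarrow> T x" if "x \<in> X" for x
    using conv[OF that] unfolding T_def by (simp add: convergent_LIMSEQ_iff)
  have "T x \<in> Y" if "x \<in> X" for x
    by (rule closed_sequentially[OF closedY _ T[OF that]])
      (intro subspace_sum[OF subY] subspace_scale[OF subY] g)
  moreover have "T (x + y) = T x + T y" if x: "x \<in> X" "y \<in> X" for x y
  proof (rule LIMSEQ_unique[OF T[OF subspace_add[OF sub x]]])
    show "(\<lambda>m. \<Sum>n<m. cf (x + y) n *\<^sub>R g n) \<longlonglongrightarrow> T x + T y"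
      using tendsto_add[OF T[OF x(1)] T[OF x(2)]] by (simp add: cf_add x scaleR_add_left sum.distrib)
  qed
  moreover have "T (r *\<^sub>R x) = r *\<^sub>R T x" if x: "x \<in> X" for x r
  proof (rule LIMSEQ_unique[OF T[OF subspace_scale[OF sub x]]])
    show "(\<lambda>m. \<Sum>n<m. cf (r *\<^sub>R x) n *\<^sub>R g n) \<longlonglongrightarrow> r *\<^sub>R T x"
      using tendsto_scaleR[OF tendsto_const T[OF x], of r] by (simp add: cf_scale x scaleR_sum_right)
  qed
  moreover have "c1 * norm x \<le> norm (T x)" if x: "x \<in> X" for x
  proof (rule LIMSEQ_le)
    show "(\<lambda>m. c1 * norm (\<Sum>n<m. cf x n *\<^sub>R e n)) \<longlonglongrightarrow> c1 * norm x"
      using cf_sums[OF x] unfolding sums_def by (intro tendsto_intros)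
    show "(\<lambda>m. norm (\<Sum>n<m. cf x n *\<^sub>R g n)) \<longlonglongrightarrow> norm (T x)" by (intro tendsto_norm T x)
  qed (use lower in auto)
  moreover have "norm (T x) \<le> c2 * norm x" if x: "x \<in> X" for x
  proof (rule LIMSEQ_le)
    show "(\<lambda>m. c2 * norm (\<Sum>n<m. cf x n *\<^sub>R e n)) \<longlonglongrightarrow> c2 * norm x"
      using cf_sums[OF x] unfolding sums_def by (intro tendsto_intros)
    show "(\<lambda>m. norm (\<Sum>n<m. cf x n *\<^sub>R g n)) \<longlonglongrightarrow> norm (T x)" by (intro tendsto_norm T x)
  qed (use upper in auto)
  ultimately show ?thesis unfolding embeds_def using c1 by blast
qed

text \<open>At a point of the Cantor set the terms of one sign add up to the value of a partial sum.\<close>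

lemma weight_le_norm:
  assumes K: "\<And>x S. x \<in> X \<Longrightarrow> finite S \<Longrightarrow> norm (\<Sum>n\<in>S. cf x n *\<^sub>R e n) \<le> K * norm x" and a: "a \<in> fs"
  shows "(\<Sum>n\<in>supp a. \<bar>a n\<bar> * \<bar>s n * e n p\<bar>) \<le> 2 * K * norm (lincomb (\<lambda>n. s n *\<^sub>R e n) a)"
proof -
  define w where "w = lincomb (\<lambda>n. s n *\<^sub>R e n) a"
  have fin: "finite (supp a)" by (rule fsD[OF a])
  have w: "w \<in> X"
    unfolding w_def lincomb_def by (intro subspace_sum[OF sub] subspace_scale[OF sub] e_in)
  have "(\<lambda>n. (if n \<in> supp a then a n * s n else 0) *\<^sub>R e n) sums (\<Sum>n\<in>supp a. (if n \<in> supp a then a n * s n else 0) *\<^sub>R e n)"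
    by (rule sums_finite[OF fin]) auto
  moreover have "(\<Sum>n\<in>supp a. (if n \<in> supp a then a n * s n else 0) *\<^sub>R e n) = w"
    unfolding w_def lincomb_def by (intro sum.cong) auto
  ultimately have cfw: "cf w = (\<lambda>n. if n \<in> supp a then a n * s n else 0)" using cf_eq[OF w] by simp
  have part_le: "\<bar>\<Sum>n\<in>S. a n * (s n * e n p)\<bar> \<le> K * norm w" if S: "S \<subseteq> supp a" for S
  proof -
    have fS: "finite S" using S fin finite_subset by blast
    have "apply_bcontfun (\<Sum>n\<in>S. cf w n *\<^sub>R e n) p = (\<Sum>n\<in>S. cf w n * e n p)"
      using fS by induction auto
    also have "\<dots> = (\<Sum>n\<in>S. a n * (s n * e n p))" using S by (intro sum.cong) (auto simp: cfw)
    finally have "\<bar>\<Sum>n\<in>S. a n * (s n * e n p)\<bar> \<le> norm (\<Sum>n\<in>S. cf w n *\<^sub>R e n)"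
      using norm_bounded[of "\<Sum>n\<in>S. cf w n *\<^sub>R e n" p] by simp
    also have "\<dots> \<le> K * norm w" by (rule K[OF w fS])
    finally show ?thesis .
  qed
  let ?t = "\<lambda>n. a n * (s n * e n p)"
  let ?P = "{n \<in> supp a. 0 \<le> ?t n}"
  have "(\<Sum>n\<in>supp a. \<bar>a n\<bar> * \<bar>s n * e n p\<bar>) = (\<Sum>n\<in>supp a. \<bar>?t n\<bar>)" by (simp add: abs_mult)
  also have "\<dots> = (\<Sum>n\<in>?P. \<bar>?t n\<bar>) + (\<Sum>n\<in>supp a - ?P. \<bar>?t n\<bar>)"
    using fin sum.subset_diff[of ?P "supp a" "\<lambda>n. \<bar>?t n\<bar>"] by simp
  also have "(\<Sum>n\<in>?P. \<bar>?t n\<bar>) = (\<Sum>n\<in>?P. ?t n)" by (intro sum.cong) auto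
  also have "(\<Sum>n\<in>supp a - ?P. \<bar>?t n\<bar>) = - (\<Sum>n\<in>supp a - ?P. ?t n)"
    unfolding sum_negf[symmetric] by (intro sum.cong) auto
  also have "(\<Sum>n\<in>?P. ?t n) + - (\<Sum>n\<in>supp a - ?P. ?t n) \<le> K * norm w + K * norm w"
    using part_le[of ?P] part_le[of "supp a - ?P"] by (intro add_mono) (auto simp: abs_le_iff)
  finally show ?thesis by (simp add: w_def)
qed

text \<open>Any basis is first scaled up, so that one and the same tolerance sequence is harmless
  for it, and then approximated in the dense set; its unconditional constant controls the weights of
  the approximation.\<close>

lemma code_of_basis:
  fixes d :: "nat \<Rightarrow> C2N"
  assumes d: "\<And>f \<epsilon>. 0 < \<epsilon> \<Longrightarrow> \<exists>k. norm (f - d k) < \<epsilon>" and z: "f z = X"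
  shows "\<exists>\<beta> s c. (\<lambda>n. prod_encode (\<beta> n, z n)) \<in> code_set f d \<and> (\<forall>n. 0 < s n) \<and> 0 < c \<and> good c (\<lambda>n. d (\<beta> n)) \<and>
    (\<forall>a. a \<in> fs \<longrightarrow> norm (lincomb (\<lambda>n. s n *\<^sub>R e n) a) \<le> 2 * norm (lincomb (\<lambda>n. d (\<beta> n)) a) \<and>
      norm (lincomb (\<lambda>n. d (\<beta> n)) a) \<le> 2 * norm (lincomb (\<lambda>n. s n *\<^sub>R e n) a))"
proof -
  obtain K where K: "0 < K" "\<And>x S. x \<in> X \<Longrightarrow> finite S \<Longrightarrow> norm (\<Sum>n\<in>S. cf x n *\<^sub>R e n) \<le> K * norm x"
    using unconditional_constant by metis
  \<comment> \<open>The factor 6 is the loss \<open>3/2 * 2 * 2\<close> incurred below; the added 1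
    gives \<open>1 <= c\<close>.\<close>
  obtain c :: nat where c0: "6 * K + 1 \<le> real c" using real_arch_simple by blast
  then have c: "6 * K \<le> real c" "1 \<le> c" using K(1) by (simp, linarith)
  \<comment> \<open>Vectors of length \<open>c + 1\<close> keep norm at least \<open>c\<close> after
    an error of at most 1.\<close>
  define s where "s n = (real c + 1) / norm (e n)" for n
  have s: "0 < s n" for n using e_nz[of n] by (simp add: s_def add_nonneg_pos)
  define w where "w n = s n *\<^sub>R e n" for n
  have nw: "norm (w n) = real c + 1" for n using e_nz[of n] by (simp add: w_def s_def)
  have wX: "w n \<in> X" for n unfolding w_def by (intro subspace_scale[OF sub] e_in)
  have "\<forall>n. \<exists>k. norm (w n - d k) < (1/2) ^ (n + 2)" by (intro allI d) simp
  then obtain \<beta> where \<beta>: "\<And>n. norm (w n - d (\<beta> n)) < (1/2) ^ (n + 2)" by metis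
  define x where "x n = d (\<beta> n)" for n
  have ww: "(\<Sum>n\<in>supp a. \<bar>a n\<bar> * \<bar>w n p\<bar>) \<le> 2 * K * norm (lincomb w a)" if "a \<in> fs" for a p
    using weight_le_norm[OF K(2) that, of s p] by (simp add: w_def[abs_def])
  have coord: "\<bar>a n\<bar> \<le> norm (lincomb w a)" if a: "a \<in> fs" for a n
    by (rule coord_le_of_weight[OF _ a ww[OF a]]) (use K(1) c nw in auto)
  have dist: "norm (lincomb w a - lincomb x a) \<le> norm (lincomb w a) / 2" if a: "a \<in> fs" for a
    using perturbation[where w = w and w' = x, OF coord[OF a] _ a] \<beta> by (auto simp: x_def intro: less_imp_le)
  have wx: "norm (lincomb w a) \<le> 2 * norm (lincomb x a)" "norm (lincomb x a) \<le> 2 * norm (lincomb w a)" 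
    and xw: "norm (lincomb x a) \<le> (3/2) * norm (lincomb w a)" if a: "a \<in> fs" for a
    using dist[OF a] norm_triangle_ineq2[of "lincomb w a" "lincomb x a"] norm_triangle_ineq2[of "lincomb x a" "lincomb w a"]
    by (auto simp: norm_minus_commute)
  have "good (real c) x"
    unfolding good_def
  proof (intro conjI allI impI)
    fix n
    have "(1/2::real) ^ (n + 2) \<le> 1" by (rule power_le_one) auto
    then have "norm (w n - x n) \<le> 1" using \<beta>[of n] by (simp add: x_def)
    then show "real c \<le> norm (x n)" using nw[of n] norm_triangle_ineq2[of "w n" "x n"] by linarith
  next
    fix a p assume a: "a \<in> fs"
    \<comment> \<open>Signs are adjusted at the fixed point \<open>p\<close>, so that the weighted
      sum becomes the value of a combination of \<open>x\<close>. The sign change is undone after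
      passing to the basis, where unconditionality is known.\<close>
    define a' where "a' = (\<lambda>n. sgn (a n * x n p) * a n)"
    have a': "a' \<in> fs" using a by (rule fs_mono) (simp add: a'_def)
    have supp': "supp a' \<subseteq> supp a" by (auto simp: a'_def supp_def)
    have abs': "\<bar>a' n\<bar> \<le> \<bar>a n\<bar>" for n by (simp add: a'_def abs_mult abs_sgn_eq)
    have "(\<Sum>n\<in>supp a. \<bar>a n\<bar> * \<bar>x n p\<bar>) = (\<Sum>n\<in>supp a. a' n * x n p)"
    proof (rule sum.cong[OF refl])
      fix n
      have "\<bar>a n * x n p\<bar> = a n * x n p * sgn (a n * x n p)" by (rule abs_sgn)
      then show "\<bar>a n\<bar> * \<bar>x n p\<bar> = a' n * x n p" by (simp only: a'_def abs_mult[symmetric] mult_ac)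
    qed
    also have "\<dots> = (\<Sum>n\<in>supp a'. a' n * x n p)"
      using supp' fsD[OF a] by (intro sum.mono_neutral_right) (auto simp: supp_def)
    also have "\<dots> \<le> norm (lincomb x a')"
      using norm_bounded[of "lincomb x a'" p] by (simp add: apply_lincomb abs_le_iff)
    also have "\<dots> \<le> (3/2) * norm (lincomb w a')" by (rule xw[OF a'])
    also have "norm (lincomb w a') \<le> 2 * K * norm (lincomb w a)"
    proof (rule norm_lincomb_le_weight)
      fix p
      have "(\<Sum>n\<in>supp a'. \<bar>a' n\<bar> * \<bar>w n p\<bar>) \<le> (\<Sum>n\<in>supp a'. \<bar>a n\<bar> * \<bar>w n p\<bar>)"
        by (intro sum_mono mult_right_mono abs') auto
      also have "\<dots> \<le> (\<Sum>n\<in>supp a. \<bar>a n\<bar> * \<bar>w n p\<bar>)" using supp' fsD[OF a] by (intro sum_mono2) auto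
      also have "\<dots> \<le> 2 * K * norm (lincomb w a)" by (rule ww[OF a])
      finally show "(\<Sum>n\<in>supp a'. \<bar>a' n\<bar> * \<bar>w n p\<bar>) \<le> 2 * K * norm (lincomb w a)" .
    qed
    also have "(3/2) * (2 * K * norm (lincomb w a)) = 3 * K * norm (lincomb w a)" by simp
    also have "\<dots> \<le> 3 * K * (2 * norm (lincomb x a))" using K(1) wx(1)[OF a] by (intro mult_left_mono) auto
    also have "\<dots> \<le> real c * norm (lincomb x a)"
      using mult_right_mono[OF c(1), of "norm (lincomb x a)"] by simp
    finally show "(\<Sum>n\<in>supp a. \<bar>a n\<bar> * \<bar>x n p\<bar>) \<le> real c * norm (lincomb x a)" by simp
  qed
  moreover have "(\<lambda>n. prod_encode (\<beta> n, z n)) \<in> code_set f d"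
    unfolding code_set_def
  proof (intro CollectI conjI allI exI)
    show "1 \<le> c" by (rule c(2))
    show "good (real c) (\<lambda>n. d (dec1 (prod_encode (\<beta> n, z n))))"
      using calculation by (simp add: dec1_def x_def[abs_def])
    fix n
    have "w n \<in> ball (d (\<beta> n)) ((1/2) ^ (n + 2))" using \<beta>[of n] by (simp add: dist_norm norm_minus_commute)
    then show "f (\<lambda>k. dec2 (prod_encode (\<beta> k, z k))) \<inter> ball (d (dec1 (prod_encode (\<beta> n, z n)))) ((1/2) ^ (n + 2)) \<noteq> {}"
      using wX[of n] z by (auto simp: dec1_def dec2_def)
  qed
  moreover have "0 < real c" using c by simp
  ultimately show ?thesis using s wx unfolding w_def x_def by blast
qed

end

section \<open>Reindexing, nodes and branches\<close>

lemma transport: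
  fixes lev :: "nat \<Rightarrow> nat"
  assumes a: "a \<in> fs" and inj: "inj_on lev (supp a)"
  obtains a' where "a' \<in> fs" "supp a' = lev ` supp a" "\<And>y :: nat \<Rightarrow> C2N. lincomb y a' = lincomb (\<lambda>i. y (lev i)) a"
    "\<And>h. (\<Sum>n\<in>supp a'. \<bar>a' n\<bar> * h n) = (\<Sum>i\<in>supp a. \<bar>a i\<bar> * h (lev i))"
proof -
  define a' where "a' n = (if n \<in> lev ` supp a then a (the_inv_into (supp a) lev n) else 0)" for n
  have val: "a' (lev i) = a i" if "i \<in> supp a" for i
    using that inj by (simp add: a'_def the_inv_into_f_f)
  have supp': "supp a' = lev ` supp a"
  proof
    show "supp a' \<subseteq> lev ` supp a" by (auto simp: supp_def a'_def split: if_splits)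
    show "lev ` supp a \<subseteq> supp a'" using val by (force simp: supp_def)
  qed
  have "lincomb y a' = lincomb (\<lambda>i. y (lev i)) a" for y :: "nat \<Rightarrow> C2N"
    unfolding lincomb_def supp' by (subst sum.reindex[OF inj]) (simp add: val)
  moreover have "(\<Sum>n\<in>supp a'. \<bar>a' n\<bar> * h n) = (\<Sum>i\<in>supp a. \<bar>a i\<bar> * h (lev i))" for h
    unfolding supp' by (subst sum.reindex[OF inj]) (simp add: val)
  moreover have "a' \<in> fs" using fsD[OF a] by (simp add: fs_def supp')
  ultimately show ?thesis using that supp' by blast
qed

text \<open>With \<open>k + 1\<close> entries its last one is \<open>\<omega> k\<close>, which codes
  the vector attached to the node.\<close>

definition node :: "(nat \<Rightarrow> nat) \<Rightarrow> nat \<Rightarrow> nat list"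
  where "node \<omega> k = map \<omega> [0..<Suc k]"

text \<open>Comparability in the tree: one list is an initial segment of the other.\<close>

definition compat :: "nat list \<Rightarrow> nat list \<Rightarrow> bool"
  where "compat s t \<longleftrightarrow> (\<forall>i. i < length s \<longrightarrow> i < length t \<longrightarrow> s ! i = t ! i)"

lemma length_node [simp]: "length (node \<omega> k) = Suc k"
  by (simp add: node_def)

lemma nth_node: "i \<le> k \<Longrightarrow> node \<omega> k ! i = \<omega> i"
  unfolding node_def by (simp del: upt_Suc)

lemma compat_nodes: "compat (node \<omega> k) (node \<omega> l)"
  by (simp add: compat_def nth_node)

text \<open>Comparable lists of equal length coincide, so an infinite set of them contains
  arbitrarily long ones and glues to a single sequence. Every initial segment of this sequence is
  shared with a member of \<open>C\<close>, and closedness puts the sequence itself into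
  \<open>C\<close>.\<close>

lemma clique_branch:
  assumes C: "closed C" and L: "infinite L" "\<And>s t. s \<in> L \<Longrightarrow> t \<in> L \<Longrightarrow> compat s t"
    and nodes: "\<And>t. t \<in> L \<Longrightarrow> \<exists>\<omega>\<in>C. \<exists>k. t = node \<omega> k"
  shows "\<exists>\<omega>\<in>C. \<forall>t\<in>L. \<exists>k. t = node \<omega> k"
proof -
  have "inj_on length L"
  proof (rule inj_onI)
    fix s t assume st: "s \<in> L" "t \<in> L" "length s = length t"
    then show "s = t" using L(2)[OF st(1,2)] by (intro nth_equalityI) (auto simp: compat_def)
  qed
  then have "infinite (length ` L)" using L(1) finite_image_iff by blast
  then have long: "\<exists>t. t \<in> L \<and> n < length t" for n
    using infinite_nat_iff_unbounded[of "length ` L"] by auto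
  define \<omega> where "\<omega> n = (SOME t. t \<in> L \<and> n < length t) ! n" for n
  have \<omega>: "t ! n = \<omega> n" if t: "t \<in> L" "n < length t" for t n
  proof -
    have "(SOME t. t \<in> L \<and> n < length t) \<in> L \<and> n < length (SOME t. t \<in> L \<and> n < length t)"
      by (rule someI_ex) (rule long)
    then show ?thesis using L(2)[OF t(1)] t(2) unfolding \<omega>_def compat_def by blast
  qed
  have "\<omega> \<in> C"
  proof (rule closed_cylinder_approx[OF C])
    fix m
    obtain t where t: "t \<in> L" "m < length t" using long by blast
    obtain \<omega>' k where k: "\<omega>' \<in> C" "t = node \<omega>' k" using nodes[OF t(1)] by blast
    have "\<omega>' i = \<omega> i" if "i < m" for i
      using \<omega>[OF t(1), of i] t(2) k(2) that nth_node[of i k \<omega>'] by simp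
    then show "\<exists>c\<in>C. \<forall>i<m. c i = \<omega> i" using k(1) by blast
  qed
  moreover have "\<exists>k. t = node \<omega> k" if t: "t \<in> L" for t
  proof -
    obtain \<omega>' k where k: "t = node \<omega>' k" using nodes[OF t] by blast
    have "t = node \<omega> k"
      using \<omega>[OF t] k by (intro nth_equalityI) (auto simp: nth_node less_Suc_eq_le)
    then show ?thesis by blast
  qed
  ultimately show ?thesis by blast
qed

section \<open>The amalgam of an analytic family\<close>

lemma (in clique_family) realized:
  obtains e where "realized_norm q e"
proof -
  obtain e :: "nat \<Rightarrow> C2N" where "\<And>S a. finite S \<Longrightarrow> norm (\<Sum>n\<in>S. a n *\<^sub>R e n) = q (restr S a)"
    by (rule realization) (rule that)
  then have "realized_norm q e" by unfold_locales
  then show ?thesis by (rule that)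
qed

text \<open>The map \<open>dec1\<close> in the last equation drops the witnesses of the projection,
  as in \<open>borel_closed_code\<close>.\<close>

locale coded_family =
  fixes f :: "(nat \<Rightarrow> nat) \<Rightarrow> C2N set" and d :: "nat \<Rightarrow> C2N" and C :: "(nat \<Rightarrow> nat) set"
  assumes f_SB: "f z \<in> SB" and f_reflexive: "reflexive_space (f z)"
    and closed_C: "closed C" and code: "code_set f d = (\<lambda>\<omega> n. dec1 (\<omega> n)) ` C" and C_ne: "C \<noteq> {}"
begin

definition T :: "nat list set"
  where "T = {node \<omega> k | \<omega> k. \<omega> \<in> C}"

lemma countable_T: "countable T" by simp

lemma infinite_T: "infinite T"
proof
  assume "finite T"
  obtain \<omega> where \<omega>: "\<omega> \<in> C" using C_ne by blast
  have "inj (node \<omega>)" by (rule injI) (metis Suc_inject length_node)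
  then have "infinite (range (node \<omega>))" using finite_imageD infinite_UNIV_nat by blast
  moreover have "range (node \<omega>) \<subseteq> T" using \<omega> by (auto simp: T_def)
  ultimately show False using \<open>finite T\<close> finite_subset by blast
qed

definition \<tau> :: "nat \<Rightarrow> nat list"
  where "\<tau> = from_nat_into T"

lemma bij_\<tau>: "bij_betw \<tau> UNIV T"
  unfolding \<tau>_def by (rule bij_betw_from_nat_into[OF countable_T infinite_T])

lemma inj_\<tau>: "inj \<tau>" and \<tau>_in: "\<tau> i \<in> T"
  using bij_\<tau> by (auto simp: bij_betw_def)

text \<open>Two layers of pairing are undone: the outer one splits off the witness of the
  projection, the inner one the parameter of the member of the family.\<close>

definition seq :: "(nat \<Rightarrow> nat) \<Rightarrow> nat \<Rightarrow> C2N"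
  where "seq \<omega> n = d (dec1 (dec1 (\<omega> n)))"

text \<open>Only the last entry of a node counts, so that the nodes of a branch reproduce the terms
  of its sequence one by one.\<close>

definition u :: "nat \<Rightarrow> C2N"
  where "u i = absf (d (dec1 (dec1 (last (\<tau> i)))))"

definition cmp :: "nat \<Rightarrow> nat \<Rightarrow> bool"
  where "cmp i j \<longleftrightarrow> compat (\<tau> i) (\<tau> j)"

lemma u_node: "\<tau> i = node \<omega> k \<Longrightarrow> u i = absf (seq \<omega> k)"
  by (simp add: u_def seq_def node_def)

lemma branch_good:
  assumes "\<omega> \<in> C"
  obtains c :: nat and z y where "1 \<le> c" "good (real c) (seq \<omega>)"
    "\<And>n. y n \<in> f z" "\<And>n. norm (seq \<omega> n - y n) \<le> (1/2) ^ (n + 2)"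
proof -
  have "(\<lambda>n. dec1 (\<omega> n)) \<in> code_set f d" using code assms by blast
  then obtain c :: nat where c: "1 \<le> c" "good (real c) (seq \<omega>)"
    and hit: "\<forall>n. f (\<lambda>k. dec2 (dec1 (\<omega> k))) \<inter> ball (seq \<omega> n) ((1/2) ^ (n + 2)) \<noteq> {}"
    unfolding code_set_def seq_def[abs_def] by blast
  let ?z = "\<lambda>k. dec2 (dec1 (\<omega> k))"
  have "\<forall>n. \<exists>y. y \<in> f ?z \<and> norm (seq \<omega> n - y) \<le> (1/2) ^ (n + 2)"
  proof
    fix n
    from hit have "f ?z \<inter> ball (seq \<omega> n) ((1/2) ^ (n + 2)) \<noteq> {}" by blast
    then obtain y where "y \<in> f ?z" "dist (seq \<omega> n) y < (1/2) ^ (n + 2)" unfolding mem_ball by auto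
    then show "\<exists>y. y \<in> f ?z \<and> norm (seq \<omega> n - y) \<le> (1/2) ^ (n + 2)" by (auto simp: dist_norm intro!: exI[of _ y])
  qed
  then obtain y where "\<forall>n. y n \<in> f ?z \<and> norm (seq \<omega> n - y n) \<le> (1/2) ^ (n + 2)" by (rule choice[THEN exE])
  then show ?thesis using that[OF c, of y ?z] by blast
qed

lemma u_nonzero: "u i \<noteq> 0"
proof -
  obtain \<omega> k where \<omega>: "\<omega> \<in> C" "\<tau> i = node \<omega> k" using \<tau>_in[of i] by (auto simp: T_def)
  obtain c :: nat where "1 \<le> c" "good (real c) (seq \<omega>)" using branch_good[OF \<omega>(1)] by metis
  then have "1 \<le> real c" "real c \<le> norm (seq \<omega> k)" by (simp_all add: good_def)
  then have "1 \<le> norm (seq \<omega> k)" by linarith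
  then show ?thesis using absf_eq_0[of "seq \<omega> k"] u_node[OF \<omega>(2)] by auto
qed

text \<open>An infinite clique lies on a single branch of \<open>C\<close>, whose sequence is a
  perturbation of vectors of one space \<open>f z\<close>. Reindexed by the levels of the nodes,
  these vectors have a norm equivalent to the weight norm on the clique.\<close>

lemma clique_reflexive:
  assumes Q: "infinite Q" "clique cmp Q"
  obtains y c X where "weighted_in_reflexive y Q u c X"
proof -
  have "\<exists>\<omega>\<in>C. \<forall>t\<in>\<tau> ` Q. \<exists>k. t = node \<omega> k"
  proof (rule clique_branch[OF closed_C])
    show "infinite (\<tau> ` Q)" using Q(1) inj_\<tau> by (simp add: finite_image_iff inj_on_subset[OF inj_\<tau>])
    show "compat s t" if "s \<in> \<tau> ` Q" "t \<in> \<tau> ` Q" for s t using that Q(2) by (auto simp: clique_def cmp_def)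
    show "\<exists>\<omega>\<in>C. \<exists>k. t = node \<omega> k" if "t \<in> \<tau> ` Q" for t using that \<tau>_in by (force simp: T_def)
  qed
  then obtain \<omega> where \<omega>: "\<omega> \<in> C" and lev0: "\<forall>i\<in>Q. \<exists>k. \<tau> i = node \<omega> k" by blast
  from bchoice[OF lev0] obtain lev where lev: "\<And>i. i \<in> Q \<Longrightarrow> \<tau> i = node \<omega> (lev i)" by blast
  have inj: "inj_on lev Q"
    by (rule inj_onI) (metis lev inj_\<tau> injD)
  obtain c :: nat and z y where c: "1 \<le> c" "good (real c) (seq \<omega>)"
    and y: "\<And>n. y n \<in> f z" "\<And>n. norm (seq \<omega> n - y n) \<le> (1/2) ^ (n + 2)"
    using branch_good[OF \<omega>] by metis
  have c0: "0 < real c" using c by simp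
  have uQ: "apply_bcontfun (u i) p = \<bar>seq \<omega> (lev i) p\<bar>" if "i \<in> Q" for i p using u_node[OF lev[OF that]] by simp
  have tr: "\<exists>a'. a' \<in> fs \<and> lincomb y a' = lincomb (\<lambda>i. y (lev i)) a \<and>
      (\<forall>p. (\<Sum>n\<in>supp a'. \<bar>a' n\<bar> * \<bar>seq \<omega> n p\<bar>) = (\<Sum>i\<in>supp a. \<bar>a i\<bar> * u i p))"
    if a: "a \<in> fs_on Q" for a
  proof -
    have aQ: "a \<in> fs" "supp a \<subseteq> Q" using a by (auto simp: fs_on_def)
    obtain a' where a': "a' \<in> fs" "\<And>y :: nat \<Rightarrow> C2N. lincomb y a' = lincomb (\<lambda>i. y (lev i)) a"
      "\<And>h. (\<Sum>n\<in>supp a'. \<bar>a' n\<bar> * h n) = (\<Sum>i\<in>supp a. \<bar>a i\<bar> * h (lev i))"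
      using transport[OF aQ(1) inj_on_subset[OF inj aQ(2)]] by metis
    have "(\<Sum>n\<in>supp a'. \<bar>a' n\<bar> * \<bar>seq \<omega> n p\<bar>) = (\<Sum>i\<in>supp a. \<bar>a i\<bar> * u i p)" for p
      unfolding a'(3) using aQ(2) uQ by (intro sum.cong) auto
    with a' show ?thesis by blast
  qed
  have "weighted_in_reflexive (\<lambda>i. y (lev i)) Q u (2 * real c) (f z)"
  proof
    show "f z \<in> SB" "reflexive_space (f z)" by (rule f_SB f_reflexive)+
    show "y (lev i) \<in> f z" for i by (rule y)
    show "0 < 2 * real c" using c0 by simp
    show "0 \<le> apply_bcontfun (u i) p" for i p by (simp add: u_def)
    show "u i \<noteq> 0" for i by (rule u_nonzero)
    show "(\<Sum>n\<in>supp a. \<bar>a n\<bar> * u n p) \<le> 2 * real c * norm (lincomb (\<lambda>i. y (lev i)) a)" if a: "a \<in> fs_on Q" for a p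
    proof -
      obtain a' where "a' \<in> fs" "lincomb y a' = lincomb (\<lambda>i. y (lev i)) a"
        "\<And>p. (\<Sum>n\<in>supp a'. \<bar>a' n\<bar> * \<bar>seq \<omega> n p\<bar>) = (\<Sum>i\<in>supp a. \<bar>a i\<bar> * u i p)"
        using tr[OF a] by blast
      then show ?thesis using good_perturbed(1)[OF c0 c(2) y(2), of a' p] by simp
    qed
    show "norm (lincomb (\<lambda>i. y (lev i)) a) \<le> 2 * r"
      if a: "a \<in> fs_on Q" and r: "\<And>p. (\<Sum>n\<in>supp a. \<bar>a n\<bar> * u n p) \<le> r" for a r
    proof -
      obtain a' where "a' \<in> fs" "lincomb y a' = lincomb (\<lambda>i. y (lev i)) a"
        "\<And>p. (\<Sum>n\<in>supp a'. \<bar>a' n\<bar> * \<bar>seq \<omega> n p\<bar>) = (\<Sum>i\<in>supp a. \<bar>a i\<bar> * u i p)"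
        using tr[OF a] by blast
      then show ?thesis using good_perturbed(2)[OF c0 c(2) y(2), of a' r] r by simp
    qed
  qed
  then show ?thesis by (rule that)
qed

sublocale clique_family u cmp
proof
  show "0 \<le> apply_bcontfun (u n) p" for n p by (simp add: u_def)
  show "u n \<noteq> 0" for n by (rule u_nonzero)
  show "cmp n n" for n by (simp add: cmp_def compat_def)
next
  fix Q a and S :: "nat \<Rightarrow> nat set" and \<epsilon> :: real
  assume Q: "infinite Q" "clique cmp Q"
    and a: "\<And>n. 0 \<le> a n" "supp a \<subseteq> Q" "\<And>S. finite S \<Longrightarrow> restr S a \<in> weight_ball u"
    and S: "\<And>j. finite (S j)" "\<And>j k. j \<noteq> k \<Longrightarrow> S j \<inter> S k = {}" and \<epsilon>: "0 < \<epsilon>"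
  obtain y c X where "weighted_in_reflexive y Q u c X" using clique_reflexive[OF Q] .
  then show "\<exists>j. \<forall>p. (\<Sum>n\<in>S j. a n * apply_bcontfun (u n) p) \<le> \<epsilon>"
    by (rule weighted_in_reflexive.clique_bc[where S = S]) (use a S \<epsilon> in auto)
next
  fix Q b f and \<epsilon> :: real
  assume Q: "infinite Q" "clique cmp Q"
    and b: "\<And>n. 0 \<le> b n" "supp b \<subseteq> Q" "\<And>a. a \<in> weight_ball u \<Longrightarrow> dot a b \<le> 1"
    and f: "disj_seq f" "\<And>j. f j \<in> weight_ball u" "\<And>j. supp (f j) \<subseteq> Q" and \<epsilon>: "0 < \<epsilon>"
  obtain y c X where "weighted_in_reflexive y Q u c X" using clique_reflexive[OF Q] .
  then show "\<exists>j. dot (f j) b < \<epsilon>"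
    by (rule weighted_in_reflexive.clique_sh[where f = f]) (use b f \<epsilon> in auto)
qed

text \<open>The nodes of a branch form a clique, where \<open>q\<close> is the weight norm by
  \<open>q_lower\<close> and \<open>q_upper\<close>; \<open>idx\<close> locates them in the
  enumeration.\<close>

lemma branch_norm:
  assumes \<omega>: "\<omega> \<in> C" and e: "realized_norm q e"
  shows "\<exists>idx :: nat \<Rightarrow> nat. \<forall>a\<in>fs. (\<forall>p. (\<Sum>n\<in>supp a. \<bar>a n\<bar> * \<bar>seq \<omega> n p\<bar>) \<le> norm (lincomb (\<lambda>n. e (idx n)) a)) \<and>
    (\<forall>r>0. (\<forall>p. (\<Sum>n\<in>supp a. \<bar>a n\<bar> * \<bar>seq \<omega> n p\<bar>) \<le> r) \<longrightarrow> norm (lincomb (\<lambda>n. e (idx n)) a) \<le> r)"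
proof -
  interpret r: realized_norm q e by (rule e)
  define idx where "idx n = inv_into UNIV \<tau> (node \<omega> n)" for n
  have \<tau>_idx: "\<tau> (idx n) = node \<omega> n" for n
  proof -
    have "node \<omega> n \<in> range \<tau>" using bij_\<tau> \<omega> by (auto simp: bij_betw_def T_def)
    then show ?thesis unfolding idx_def by (rule f_inv_into_f)
  qed
  have inj: "inj idx" by (rule injI) (metis \<tau>_idx length_node Suc_inject)
  have cl: "clique cmp (range idx)" by (auto simp: clique_def cmp_def \<tau>_idx compat_nodes)
  have u_idx: "apply_bcontfun (u (idx n)) p = \<bar>seq \<omega> n p\<bar>" for n p using u_node[OF \<tau>_idx] by simp
  have tr: "\<exists>a'. a' \<in> fs \<and> clique cmp (supp a') \<and> norm (lincomb (\<lambda>n. e (idx n)) a) = q a' \<and>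
      (\<forall>p. (\<Sum>n\<in>supp a'. \<bar>a' n\<bar> * u n p) = (\<Sum>n\<in>supp a. \<bar>a n\<bar> * \<bar>seq \<omega> n p\<bar>))"
    if a: "a \<in> fs" for a
  proof -
    obtain a' where a': "a' \<in> fs" "supp a' = idx ` supp a" "\<And>y :: nat \<Rightarrow> C2N. lincomb y a' = lincomb (\<lambda>i. y (idx i)) a"
      "\<And>h. (\<Sum>n\<in>supp a'. \<bar>a' n\<bar> * h n) = (\<Sum>i\<in>supp a. \<bar>a i\<bar> * h (idx i))"
      using transport[OF a inj_on_subset[OF inj]] by (metis subset_UNIV)
    have "clique cmp (supp a')" using cl a'(2) by (auto simp: clique_def)
    moreover have "norm (lincomb (\<lambda>n. e (idx n)) a) = q a'"
    proof -
      have "restr (supp a') a' = a'" by (auto simp: restr_def supp_def)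
      then have "norm (lincomb e a') = q a'" using r.norm_e[OF fsD[OF a'(1)], of a'] by (simp add: lincomb_def)
      then show ?thesis by (simp only: a'(3))
    qed
    moreover have "(\<Sum>n\<in>supp a'. \<bar>a' n\<bar> * u n p) = (\<Sum>n\<in>supp a. \<bar>a n\<bar> * \<bar>seq \<omega> n p\<bar>)" for p
      unfolding a'(4) u_idx ..
    ultimately show ?thesis using a'(1) by blast
  qed
  show ?thesis
  proof (intro exI[of _ idx] ballI conjI allI impI)
    fix a p assume a: "a \<in> fs"
    obtain a' where a': "a' \<in> fs" "clique cmp (supp a')" "norm (lincomb (\<lambda>n. e (idx n)) a) = q a'"
      "\<And>p. (\<Sum>n\<in>supp a'. \<bar>a' n\<bar> * u n p) = (\<Sum>n\<in>supp a. \<bar>a n\<bar> * \<bar>seq \<omega> n p\<bar>)"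
      using tr[OF a] by blast
    show "(\<Sum>n\<in>supp a. \<bar>a n\<bar> * \<bar>seq \<omega> n p\<bar>) \<le> norm (lincomb (\<lambda>n. e (idx n)) a)"
      using q_lower[OF a'(2,1), of p] a'(3,4) by simp
  next
    fix a and r :: real assume a: "a \<in> fs" and r: "0 < r" "\<forall>p. (\<Sum>n\<in>supp a. \<bar>a n\<bar> * \<bar>seq \<omega> n p\<bar>) \<le> r"
    obtain a' where a': "a' \<in> fs" "clique cmp (supp a')" "norm (lincomb (\<lambda>n. e (idx n)) a) = q a'"
      "\<And>p. (\<Sum>n\<in>supp a'. \<bar>a' n\<bar> * u n p) = (\<Sum>n\<in>supp a. \<bar>a n\<bar> * \<bar>seq \<omega> n p\<bar>)"
      using tr[OF a] by blast
    show "norm (lincomb (\<lambda>n. e (idx n)) a) \<le> r"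
      unfolding a'(3) by (rule q_upper[OF a'(2,1) r(1)]) (simp add: a'(4) r(2))
  qed
qed

end

lemma (in realized_norm) Y_properties:
  shows "Y \<in> SB" "reflexive_space Y" "unconditional_basis Y e"
proof -
  show "Y \<in> SB" using subspace_Y by (simp add: SB_def)
  show "reflexive_space Y" by (rule reflexive_Y)
  show "unconditional_basis Y e" by (rule unconditional_basisI) (rule unconditional_basic_axioms)
qed

text \<open>For the empty family any example will do; the amalgam over an antichain is a copy of the
  Hilbert space.\<close>

lemma antichain_family: "clique_family (\<lambda>_. const_bcontfun 1) (=)"
proof
  have fin: "finite Q" if "clique (=) Q" for Q :: "nat set"
  proof (cases "Q = {}")
    case False
    then obtain i where "i \<in> Q" by blast
    then have "Q \<subseteq> {i}" using that by (auto simp: clique_def)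
    then show ?thesis by (rule finite_subset) simp
  qed simp
  show "const_bcontfun 1 \<noteq> (0 :: C2N)"
    by (metis const_bcontfun.rep_eq zero_bcontfun.rep_eq zero_neq_one)
  show "\<exists>j. \<forall>p. (\<Sum>n\<in>S j. a n * apply_bcontfun (const_bcontfun 1 :: C2N) p) \<le> \<epsilon>"
    if "infinite Q" "clique (=) Q" for Q and S :: "nat \<Rightarrow> nat set" and a \<epsilon> using fin that by blast
  show "\<exists>j. dot (f j) b < \<epsilon>" if "infinite Q" "clique (=) Q" for Q f b \<epsilon> using fin that by blast
qed (simp_all add: const_bcontfun.rep_eq)

text \<open>A chain of equivalences: the rescaled basis of \<open>f z\<close> is close to a coded
  sequence, whose norm is its weight norm up to the factor \<open>c\<close>, and the latter is the
  norm of the amalgam on the corresponding branch.\<close>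

lemma (in coded_family) coded_embedding:
  assumes e: "realized_norm q e"
    and d: "\<And>g \<epsilon>. 0 < \<epsilon> \<Longrightarrow> \<exists>k. norm (g - d k) < \<epsilon>"
    and basis: "unconditional_basis (f z) b"
  shows "embeds (f z) (closure (lincomb e ` fs))"
proof -
  interpret r: realized_norm q e by (rule e)
  interpret X: unconditional_basis_space "f z" b by unfold_locales (rule f_SB, rule basis)
  obtain \<beta> s c where \<beta>: "(\<lambda>n. prod_encode (\<beta> n, z n)) \<in> code_set f d" and s: "\<And>n. 0 < s n" and c: "0 < c"
    and good: "good c (\<lambda>n. d (\<beta> n))"
    and bx: "\<And>a. a \<in> fs \<Longrightarrow> norm (lincomb (\<lambda>n. s n *\<^sub>R b n) a) \<le> 2 * norm (lincomb (\<lambda>n. d (\<beta> n)) a)"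
    and xb: "\<And>a. a \<in> fs \<Longrightarrow> norm (lincomb (\<lambda>n. d (\<beta> n)) a) \<le> 2 * norm (lincomb (\<lambda>n. s n *\<^sub>R b n) a)"
    using X.code_of_basis[of d f z, OF d refl] by blast
  obtain \<omega> where \<omega>: "\<omega> \<in> C" "\<And>n. dec1 (\<omega> n) = prod_encode (\<beta> n, z n)"
    using \<beta> unfolding code by (auto simp: fun_eq_iff)
  have seq: "seq \<omega> = (\<lambda>n. d (\<beta> n))" by (simp add: fun_eq_iff seq_def \<omega>(2)) (simp add: dec1_def)
  obtain idx :: "nat \<Rightarrow> nat" where idx: "\<forall>a\<in>fs. (\<forall>p. (\<Sum>n\<in>supp a. \<bar>a n\<bar> * \<bar>seq \<omega> n p\<bar>) \<le> norm (lincomb (\<lambda>n. e (idx n)) a)) \<and>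
      (\<forall>r>0. (\<forall>p. (\<Sum>n\<in>supp a. \<bar>a n\<bar> * \<bar>seq \<omega> n p\<bar>) \<le> r) \<longrightarrow> norm (lincomb (\<lambda>n. e (idx n)) a) \<le> r)"
    using branch_norm[OF \<omega>(1) e] by (rule exE)
  have lo: "(\<Sum>n\<in>supp a. \<bar>a n\<bar> * \<bar>seq \<omega> n p\<bar>) \<le> norm (lincomb (\<lambda>n. e (idx n)) a)" if "a \<in> fs" for a p
    using idx that by blast
  have up: "norm (lincomb (\<lambda>n. e (idx n)) a) \<le> r"
    if "a \<in> fs" "0 < r" "\<And>p. (\<Sum>n\<in>supp a. \<bar>a n\<bar> * \<bar>seq \<omega> n p\<bar>) \<le> r" for a r
    using idx that by blast
  have lower: "norm (lincomb (\<lambda>n. s n *\<^sub>R b n) a) \<le> 2 * norm (lincomb (\<lambda>n. e (idx n)) a)" if a: "a \<in> fs" for a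
    using bx[OF a] norm_lincomb_le_weight[of a "seq \<omega>", OF lo[OF a]] unfolding seq by linarith
  have upper: "norm (lincomb (\<lambda>n. e (idx n)) a) \<le> 2 * c * norm (lincomb (\<lambda>n. s n *\<^sub>R b n) a)" if a: "a \<in> fs" for a
  proof (rule field_le_epsilon)
    \<comment> \<open>The added \<delta> makes the bound positive, as \<open>up\<close>
      requires.\<close>
    fix \<delta> :: real assume \<delta>: "0 < \<delta>"
    have le: "(\<Sum>n\<in>supp a. \<bar>a n\<bar> * \<bar>seq \<omega> n p\<bar>) \<le> 2 * c * norm (lincomb (\<lambda>n. s n *\<^sub>R b n) a) + \<delta>" for p
    proof -
      have "(\<Sum>n\<in>supp a. \<bar>a n\<bar> * \<bar>seq \<omega> n p\<bar>) \<le> c * norm (lincomb (seq \<omega>) a)"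
        using good a by (simp add: good_def seq)
      also have "\<dots> \<le> c * (2 * norm (lincomb (\<lambda>n. s n *\<^sub>R b n) a))"
        using xb[OF a] c by (intro mult_left_mono) (auto simp: seq)
      finally show ?thesis using \<delta> by simp
    qed
    show "norm (lincomb (\<lambda>n. e (idx n)) a) \<le> 2 * c * norm (lincomb (\<lambda>n. s n *\<^sub>R b n) a) + \<delta>"
      by (rule up[OF a _ le]) (use c \<delta> in \<open>simp add: add_nonneg_pos\<close>)
  qed
  \<comment> \<open>The images of the original basis vectors; division by \<open>s n\<close> undoes
    the scaling.\<close>
  define g where "g n = (1 / s n) *\<^sub>R e (idx n)" for n
  have rescale: "(\<Sum>n\<in>S. a n *\<^sub>R b n) = lincomb (\<lambda>n. s n *\<^sub>R b n) (restr S (\<lambda>n. a n / s n))"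
    "(\<Sum>n\<in>S. a n *\<^sub>R g n) = lincomb (\<lambda>n. e (idx n)) (restr S (\<lambda>n. a n / s n))" if "finite S" for S a
    unfolding lincomb_restr[OF that] g_def using s by (auto intro!: sum.cong simp: less_imp_neq[symmetric])
  show ?thesis
  proof (rule X.embeds_by_basis[where ?c1.0 = "1/2" and ?c2.0 = "2 * c" and g = g])
    show "r.Y \<in> SB" by (rule r.Y_properties)
    show "g n \<in> r.Y" for n unfolding g_def by (rule subspace_scale[OF r.subspace_Y r.y_in])
    show "1/2 * norm (\<Sum>n\<in>S. a n *\<^sub>R b n) \<le> norm (\<Sum>n\<in>S. a n *\<^sub>R g n)" if "finite S" for S a
      using lower[OF restr_fs[OF that], of "\<lambda>n. a n / s n"] by (simp add: rescale[OF that])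
    show "norm (\<Sum>n\<in>S. a n *\<^sub>R g n) \<le> 2 * c * norm (\<Sum>n\<in>S. a n *\<^sub>R b n)" if "finite S" for S a
      using upper[OF restr_fs[OF that], of "\<lambda>n. a n / s n"] by (simp add: rescale[OF that])
  qed simp
qed

theorem theorem4p1:
  assumes "analytic_SB A"
    and "\<forall>X\<in>A. reflexive_space X \<and> (\<exists>e. unconditional_basis X e)"
  shows "\<exists>Y\<in>SB. reflexive_space Y \<and> (\<exists>e. unconditional_basis Y e) \<and> (\<forall>X\<in>A. embeds X Y)"
proof (cases "A = {}")
  case True
  interpret clique_family "\<lambda>_. const_bcontfun 1" "(=)" by (rule antichain_family)
  obtain e where "realized_norm q e" by (rule realized) (rule that)
  then interpret r: realized_norm q e .
  show ?thesis using r.Y_properties True by blast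
next
  case False
  then obtain f where f: "f \<in> (borel :: (nat \<Rightarrow> nat) measure) \<rightarrow>\<^sub>M Effros" and A: "A = range f"
    using assms(1) unfolding analytic_SB_def by blast
  obtain d :: "nat \<Rightarrow> C2N" where d: "\<And>g \<epsilon>. 0 < \<epsilon> \<Longrightarrow> \<exists>k. norm (g - d k) < \<epsilon>"
    using C2N_separable by blast
  obtain C where C: "closed C" "code_set f d = (\<lambda>\<omega> n. dec1 (\<omega> n)) ` C"
    using borel_closed_code[OF code_set_borel[OF f, of d]] unfolding dec1_def by blast
  have SB: "f z \<in> SB" for z using assms(1) A unfolding analytic_SB_def by blast
  have "\<forall>z. \<exists>b. unconditional_basis (f z) b" using assms(2) A by blast
  then obtain b where b: "\<And>z. unconditional_basis (f z) (b z)" by metis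
  \<comment> \<open>The basis of any one member of the family has a code, so the tree is not
    empty.\<close>
  have "C \<noteq> {}"
  proof -
    interpret X: unconditional_basis_space "f (\<lambda>_. 0)" "b (\<lambda>_. 0)" by unfold_locales (rule SB, rule b)
    have "code_set f d \<noteq> {}" using X.code_of_basis[of d f "\<lambda>_. 0", OF d refl] by blast
    then show ?thesis using C(2) by blast
  qed
  then interpret coded_family f d C
    using SB assms(2) A C by unfold_locales auto
  obtain e where e: "realized_norm q e" by (rule realized) (rule that)
  interpret r: realized_norm q e by (rule e)
  have "embeds (f z) r.Y" for z
    by (rule coded_embedding[OF e d b])
  then show ?thesis using r.Y_properties A by blast
qed

end
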